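(* Let $\lambda,\sigma_\mu,\sigma_S>0$, $\tau>0$, $m>0$ and $x>0$, and let $S$, $\mu$, $\tilde\mu$ and $P$ be the price, trend, exponential moving average and portfolio processes defined in the context. Then $$\lim_{T\to\infty}\frac{\mathbb{E}\left[\ln\left(\frac{P_T}{P_0}\right)\right]}{T}=m\,\frac{\tau(\beta^2-1)(2-m)-m\left(\tau+\frac1\lambda\right)}{4\tau\left(\tau+\frac1\lambda\right)},\qquad \text{where } \beta=\left(1+\frac{\sigma_\mu^2}{\lambda^2\sigma_S^2}\right)^{1/2}.$$
   Context: Market model: $(W^S,W^\mu)$ is a two-dimensional Wiener process with independent components. The risky asset price $S$ (with $S_0>0$ a constant) and its trend $\mu$ satisfy $$\frac{dS_t}{S_t}=\mu_t\,dt+\sigma_S\,dW^S_t,\qquad d\mu_t=-\lambda\mu_t\,dt+\sigma_\mu\,dW^\mu_t,\qquad \mu_0=0,$$ with constants $\lambda,\sigma_\mu,\sigma_S>0$. Strategy: for a duration $\tau>0$, the exponential moving average of returns $\tilde\mu$ is given by $$d\tilde\mu_t=-\frac1\tau\tilde\mu_t\,dt+\frac1\tau\frac{dS_t}{S_t},\qquad \tilde\mu_0=0.$$ For $m>0$, the portfolio value $P$ is given by $$\frac{dP_t}{P_t}=m\frac{\tilde\mu_t}{\sigma_S^2}\frac{dS_t}{S_t},\qquad P_0=x>0.$$ *)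

theory Defs
  imports "HOL-Probability.Probability"
begin

text \<open>Real-valued processes are maps \<open>X :: real \<Rightarrow> 'a \<Rightarrow> real\<close>; only their values at times
  \<open>t \<ge> 0\<close> are relevant.\<close>

definition filtration_on :: "'a measure \<Rightarrow> (real \<Rightarrow> 'a measure) \<Rightarrow> bool" where
  "filtration_on M F \<longleftrightarrow> filtration (space M) F \<and> (\<forall>t. subalgebra M (F t))"

definition continuous_adapted ::
    "'a measure \<Rightarrow> (real \<Rightarrow> 'a measure) \<Rightarrow> (real \<Rightarrow> 'a \<Rightarrow> real) \<Rightarrow> bool" where
  "continuous_adapted M F X \<longleftrightarrow>
     (\<forall>t\<ge>0. X t \<in> borel_measurable (F t)) \<and>
     (AE \<omega> in M. continuous_on {0..} (\<lambda>t. X t \<omega>))"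

definition wiener_process ::
    "'a measure \<Rightarrow> (real \<Rightarrow> 'a measure) \<Rightarrow> (real \<Rightarrow> 'a \<Rightarrow> real) \<Rightarrow> bool" where
  "wiener_process M F W \<longleftrightarrow>
     continuous_adapted M F W \<and>
     (AE \<omega> in M. W 0 \<omega> = 0) \<and>
     (\<forall>s t. 0 \<le> s \<and> s < t \<longrightarrow>
        distributed M lborel (\<lambda>\<omega>. W t \<omega> - W s \<omega>) (normal_density 0 (sqrt (t - s))) \<and>
        prob_space.indep_set M (sets (F s))
          {(\<lambda>\<omega>. W t \<omega> - W s \<omega>) -` A \<inter> space M | A. A \<in> sets borel})"

definition independent_processes ::
    "'a measure \<Rightarrow> (real \<Rightarrow> 'a \<Rightarrow> real) \<Rightarrow> (real \<Rightarrow> 'a \<Rightarrow> real) \<Rightarrow> bool" where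
  "independent_processes M X Y \<longleftrightarrow>
     prob_space.indep_var M
       (\<Pi>\<^sub>M t\<in>{0..}. borel) (\<lambda>\<omega>. \<lambda>t\<in>{0..}. X t \<omega>)
       (\<Pi>\<^sub>M t\<in>{0..}. borel) (\<lambda>\<omega>. \<lambda>t\<in>{0..}. Y t \<omega>)"

definition converges_in_probability ::
    "'a measure \<Rightarrow> (nat \<Rightarrow> 'a \<Rightarrow> real) \<Rightarrow> ('a \<Rightarrow> real) \<Rightarrow> bool" where
  "converges_in_probability M X Y \<longleftrightarrow>
     (\<forall>\<epsilon>>0. (\<lambda>n. measure M {\<omega> \<in> space M. \<epsilon> < \<bar>X n \<omega> - Y \<omega>\<bar>}) \<longlonglongrightarrow> 0)"

text \<open>The \<open>n\<close>-th partition of \<open>{0..t}\<close> is \<open>0 = p n 0 \<le> p n 1 \<le> \<dots> \<le> p n (N n) = t\<close>, and the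
  mesh tends to zero.\<close>

definition partitions_to_zero :: "real \<Rightarrow> (nat \<Rightarrow> nat) \<Rightarrow> (nat \<Rightarrow> nat \<Rightarrow> real) \<Rightarrow> bool" where
  "partitions_to_zero t N p \<longleftrightarrow>
     (\<forall>n. p n 0 = 0 \<and> p n (N n) = t \<and> (\<forall>i<N n. p n i \<le> p n (Suc i))) \<and>
     (\<forall>\<delta>>0. \<forall>\<^sub>F n in sequentially. \<forall>i<N n. p n (Suc i) - p n i < \<delta>)"

text \<open>\<open>ito_integral M F H X I\<close> says that \<open>I t\<close> is the stochastic (Ito) integral of \<open>H\<close> against
  \<open>X\<close> over \<open>{0..t}\<close>, for all \<open>t \<ge> 0\<close>. The integrand is required to be adapted with
  continuous paths; for such \<open>H\<close> and a continuous semimartingale \<open>X\<close> the Ito integral is the limit in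
  probability of the non-anticipating (left-endpoint) sums, and this is taken as the definition.\<close>

definition ito_integral ::
    "'a measure \<Rightarrow> (real \<Rightarrow> 'a measure) \<Rightarrow> (real \<Rightarrow> 'a \<Rightarrow> real) \<Rightarrow> (real \<Rightarrow> 'a \<Rightarrow> real) \<Rightarrow>
     (real \<Rightarrow> 'a \<Rightarrow> real) \<Rightarrow> bool" where
  "ito_integral M F H X I \<longleftrightarrow>
     continuous_adapted M F H \<and> continuous_adapted M F X \<and> continuous_adapted M F I \<and>
     (\<forall>t\<ge>0. \<forall>N p. partitions_to_zero t N p \<longrightarrow>
        converges_in_probability M
          (\<lambda>n \<omega>. \<Sum>i<N n. H (p n i) \<omega> * (X (p n (Suc i)) \<omega> - X (p n i) \<omega>))
          (I t))"

end

theory Submission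
  imports Defs
begin

text \<open>
  The exponential average \<open>E\<close> satisfies \<open>\<tau> dE = - E dt + dR\<close>, so the partial summation
  \<open>E\<^sub>i (E\<^sub>i\<^sub>+\<^sub>1 - E\<^sub>i) = (E\<^sub>i\<^sub>+\<^sub>1\<^sup>2 - E\<^sub>i\<^sup>2 - (E\<^sub>i\<^sub>+\<^sub>1 - E\<^sub>i)\<^sup>2) / 2\<close> evaluates the gains of the strategy pathwise, in
  the manner of Foellmer's calculus: once left-endpoint sums and the quadratic variation of
  \<open>W\<^sub>S\<close> converge almost surely along one sequence of uniform grids, everything is
  deterministic, and
  \<open>ln (P\<^sub>t / P\<^sub>0) = m / \<sigma>\<^sub>S\<^sup>2 * (\<tau> / 2 * E\<^sub>t\<^sup>2 - \<sigma>\<^sub>S\<^sup>2 t / (2 \<tau>) + (1 - m / 2) * \<integral>\<^sub>0\<^sup>t E\<^sub>u\<^sup>2 du)\<close>.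
  The semimartingale property of \<open>P\<close> and \<open>S\<close> comes from the same sums: if
  \<open>\<Sum> (Y\<^sub>i\<^sub>+\<^sub>1 - Y\<^sub>i) / Y\<^sub>i\<close> converges to \<open>Z\<close>, then \<open>Z - ln Y\<close> is a limit of sums of the nonnegative terms
  \<open>x - ln (1 + x)\<close>, hence monotone, and equals half the quadratic variation of \<open>Z\<close>.
  It remains to compute the limit of the second moment of \<open>E\<^sub>t\<close>, which is a sum of two Wiener
  integrals of deterministic kernels against independent Wiener processes.
\<close>

section \<open>Pathwise quadratic variation\<close>

text \<open>The hypotheses give \<open>R\<close> and \<open>L\<close> only as limits in probability
  of left-endpoint sums at each fixed time, and say nothing about the quadratic variation of
  \<open>S\<close> or \<open>P\<close>. The one available from the start is that of
  \<open>W\<^sub>S\<close>, whose increments have known moments; all others are derived from it. A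
  subsequence yields almost sure limits at countably many times only, hence the rational end times.
  The process \<open>L\<close> plays a double role: as gains integral against \<open>S\<close> it
  can be evaluated, which reveals its quadratic variation; as return integral of \<open>P\<close> it
  then determines \<open>ln P\<close>. In the mean growth rate the term in
  \<open>E\<^sub>T\<^sup>2\<close> disappears because its expectation converges, so only the
  limiting second moment of the average matters:
  \<open>\<sigma>\<^sub>S\<^sup>2 / (2 * \<tau>)\<close> from the price noise plus
  \<open>\<sigma>\<^sub>\<mu>\<^sup>2 / (2 * lam * (lam * \<tau> + 1))\<close> from the trend
  noise.\<close>

text \<open>Every grid starts at 0 and only full cells count, so for fixed \<open>h\<close> a larger
  \<open>a\<close> merely appends cells: sums of nonnegative terms are monotone in \<open>a\<close>,
  and differences of grid sums are block sums. The incomplete last cell is left out and treated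
  separately.\<close>

definition grid_sum :: "real \<Rightarrow> (real \<Rightarrow> real \<Rightarrow> real) \<Rightarrow> real \<Rightarrow> real" where
  "grid_sum h f a = (\<Sum>i<nat \<lfloor>a / h\<rfloor>. f (real i * h) (real (Suc i) * h))"

lemma grid_point_bounds:
  assumes "0 < h" "i < nat \<lfloor>a / h\<rfloor>"
  shows "0 \<le> real i * h" "real i * h < real (Suc i) * h" "real (Suc i) * h \<le> a"
proof -
  show "0 \<le> real i * h" "real i * h < real (Suc i) * h" using assms by auto
  have "real (Suc i) \<le> a / h" using assms(2) by linarith
  then show "real (Suc i) * h \<le> a" using assms(1) by (simp add: pos_le_divide_eq)
qed

lemma grid_end_bounds:
  assumes "0 < h" "0 \<le> a"
  shows "real (nat \<lfloor>a / h\<rfloor>) * h \<le> a" "a - h < real (nat \<lfloor>a / h\<rfloor>) * h"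
proof -
  have "0 \<le> a / h" using assms by simp
  then have "real (nat \<lfloor>a / h\<rfloor>) \<le> a / h" "a / h - 1 < real (nat \<lfloor>a / h\<rfloor>)" by linarith+
  then show "real (nat \<lfloor>a / h\<rfloor>) * h \<le> a" "a - h < real (nat \<lfloor>a / h\<rfloor>) * h"
    using assms(1) by (simp_all add: field_simps)
qed

lemma grid_sum_add: "grid_sum h (\<lambda>s t. f s t + g s t) a = grid_sum h f a + grid_sum h g a"
  by (simp add: grid_sum_def sum.distrib)

lemma grid_sum_diff: "grid_sum h (\<lambda>s t. f s t - g s t) a = grid_sum h f a - grid_sum h g a"
  by (simp add: grid_sum_def sum_subtractf)

lemma grid_sum_cmult: "grid_sum h (\<lambda>s t. c * f s t) a = c * grid_sum h f a"
  by (simp add: grid_sum_def sum_distrib_left)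

lemma grid_sum_cong:
  assumes "0 < h" "\<And>s t. 0 \<le> s \<Longrightarrow> s < t \<Longrightarrow> t \<le> a \<Longrightarrow> f s t = g s t"
  shows "grid_sum h f a = grid_sum h g a"
  unfolding grid_sum_def
  by (intro sum.cong refl assms(2)) (use grid_point_bounds[OF assms(1)] in auto)

lemma grid_sum_mono:
  assumes "0 < h" "\<And>s t. 0 \<le> s \<Longrightarrow> s < t \<Longrightarrow> t \<le> a \<Longrightarrow> f s t \<le> g s t"
  shows "grid_sum h f a \<le> grid_sum h g a"
  unfolding grid_sum_def
  by (intro sum_mono assms(2)) (use grid_point_bounds[OF assms(1)] in auto)

lemma grid_sum_nonneg:
  assumes "0 < h" "\<And>s t. 0 \<le> s \<Longrightarrow> s < t \<Longrightarrow> t \<le> a \<Longrightarrow> 0 \<le> f s t"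
  shows "0 \<le> grid_sum h f a"
  using grid_sum_mono[of h a "\<lambda>_ _. 0" f] assms by (simp add: grid_sum_def)

lemma grid_sum_mono_end:
  assumes "0 < h" "a \<le> b" "\<And>s t. 0 \<le> s \<Longrightarrow> s < t \<Longrightarrow> t \<le> b \<Longrightarrow> 0 \<le> f s t"
  shows "grid_sum h f a \<le> grid_sum h f b"
proof -
  have "\<lfloor>a / h\<rfloor> \<le> \<lfloor>b / h\<rfloor>"
    using assms by (intro floor_mono divide_right_mono) auto
  then have "{..<nat \<lfloor>a / h\<rfloor>} \<subseteq> {..<nat \<lfloor>b / h\<rfloor>}" by auto
  then show ?thesis
    unfolding grid_sum_def
    by (intro sum_mono2 assms(3)) (use grid_point_bounds[OF assms(1)] in auto)
qed

lemma grid_sum_telescope: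
  "grid_sum h (\<lambda>s t. X t - X s) a = X (real (nat \<lfloor>a / h\<rfloor>) * h) - X 0"
  unfolding grid_sum_def by (subst sum_lessThan_telescope) simp

section \<open>Continuous functions on the half-line\<close>

lemma uniformly_continuous_increment:
  fixes X :: "real \<Rightarrow> real"
  assumes "continuous_on {0..} X" "0 < e"
  shows "\<exists>d>0. \<forall>s t. 0 \<le> s \<and> s \<le> t \<and> t \<le> a \<and> t - s < d \<longrightarrow> \<bar>X t - X s\<bar> < e"
proof -
  have "uniformly_continuous_on {0..a} X"
    by (intro compact_uniformly_continuous continuous_on_subset[OF assms(1)]) auto
  then obtain d where "d > 0" and d: "\<And>x y. x \<in> {0..a} \<Longrightarrow> y \<in> {0..a} \<Longrightarrow> dist y x < d \<Longrightarrow> dist (X y) (X x) < e"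
    using assms(2) unfolding uniformly_continuous_on_def by metis
  show ?thesis
    by (intro exI[of _ d]) (use \<open>d > 0\<close> d in \<open>auto simp: dist_real_def\<close>)
qed

lemma continuous_bounded_on_interval:
  fixes X :: "real \<Rightarrow> real"
  assumes "continuous_on {0..} X"
  shows "\<exists>K>0. \<forall>t. 0 \<le> t \<and> t \<le> a \<longrightarrow> \<bar>X t\<bar> \<le> K"
proof -
  have "compact (X ` {0..a})"
    by (intro compact_continuous_image continuous_on_subset[OF assms]) auto
  then have "bounded (X ` {0..a})" by (rule compact_imp_bounded)
  then show ?thesis unfolding bounded_pos by auto
qed

lemma integral_continuous_on_halfline:
  fixes f :: "real \<Rightarrow> real"
  assumes "continuous_on {0..} f"
  shows "continuous_on {0..} (\<lambda>t. integral {0..t} f)"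
    and "\<And>s t. 0 \<le> s \<Longrightarrow> s \<le> t \<Longrightarrow> f integrable_on {s..t}"
    and "\<And>s t. 0 \<le> s \<Longrightarrow> s \<le> t \<Longrightarrow> integral {0..t} f - integral {0..s} f = integral {s..t} f"
proof -
  show int: "f integrable_on {s..t}" if "0 \<le> s" "s \<le> t" for s t
    by (intro integrable_continuous_real continuous_on_subset[OF assms]) (use that in auto)
  show "integral {0..t} f - integral {0..s} f = integral {s..t} f" if "0 \<le> s" "s \<le> t" for s t
    using Henstock_Kurzweil_Integration.integral_combine[OF that int[of 0 t]] that by auto
  have "continuous_on {0..b} (\<lambda>t. integral {0..t} f)" if "0 \<le> b" for b
    by (intro indefinite_integral_continuous_1 int) (use that in auto)
  then show "continuous_on {0..} (\<lambda>t. integral {0..t} f)"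
    unfolding continuous_on_eq_continuous_within
  proof (intro ballI)
    fix x :: real assume x: "x \<in> {0..}"
    \<comment> \<open>Continuity is local: \<open>{0..x+1}\<close> contains a neighbourhood of
      \<open>x\<close> in the half-line, so the statement on compact intervals suffices.\<close>
    have "continuous (at x within {0..x+1}) (\<lambda>t. integral {0..t} f)"
      using \<open>\<And>b. 0 \<le> b \<Longrightarrow> continuous_on {0..b} _\<close>[of "x+1"] x
      by (auto simp: continuous_on_eq_continuous_within)
    moreover have "at x within {0..x+1} = at x within {0..}"
      by (rule at_within_nhd[of _ "{..<x+1}"]) (use x in auto)
    ultimately show "continuous (at x within {0..}) (\<lambda>t. integral {0..t} f)" by simp
  qed
qed

section \<open>Limits of grid sums along a shrinking mesh\<close>

text \<open>The mesh stays abstract because the almost sure limits will hold only along a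
  subsequence of the grids.\<close>

locale shrinking_mesh =
  fixes h :: "nat \<Rightarrow> real"
  assumes h_pos: "\<And>n. 0 < h n" and h_lim: "h \<longlonglongrightarrow> 0"
begin

lemma grid_end_tendsto:
  assumes "0 \<le> a"
  shows "(\<lambda>n. real (nat \<lfloor>a / h n\<rfloor>) * h n) \<longlonglongrightarrow> a"
proof (rule tendsto_sandwich)
  show "\<forall>\<^sub>F n in sequentially. a - h n \<le> real (nat \<lfloor>a / h n\<rfloor>) * h n"
    using grid_end_bounds(2)[OF h_pos assms] by (auto intro!: always_eventually less_imp_le)
  show "\<forall>\<^sub>F n in sequentially. real (nat \<lfloor>a / h n\<rfloor>) * h n \<le> a"
    using grid_end_bounds(1)[OF h_pos assms] by (auto intro!: always_eventually)
  show "(\<lambda>n. a - h n) \<longlonglongrightarrow> a"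
    using tendsto_diff[OF tendsto_const h_lim, of a] by simp
qed auto

lemma value_at_grid_end_tendsto:
  fixes X :: "real \<Rightarrow> real"
  assumes "continuous_on {0..} X" "0 \<le> a"
  shows "(\<lambda>n. X (real (nat \<lfloor>a / h n\<rfloor>) * h n)) \<longlonglongrightarrow> X a"
  by (rule continuous_on_tendsto_compose[OF assms(1) grid_end_tendsto[OF assms(2)]])
     (use assms h_pos in \<open>auto intro!: always_eventually mult_nonneg_nonneg simp: less_imp_le\<close>)

lemma grid_sum_increment_tendsto:
  fixes X :: "real \<Rightarrow> real"
  assumes "continuous_on {0..} X" "0 \<le> a"
  shows "(\<lambda>n. grid_sum (h n) (\<lambda>s t. X t - X s) a) \<longlonglongrightarrow> X a - X 0"
  unfolding grid_sum_telescope
  by (intro tendsto_diff tendsto_const value_at_grid_end_tendsto assms)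

text \<open>The function \<open>w\<close> acts as a control: if its sums stay bounded and each cell
  contributes an error of at most \<open>e * w s t\<close> once the mesh is fine, the total error is
  at most \<open>e\<close> times that bound. Typical controls below are \<open>t - s\<close>,
  increments of a continuous function, and squared increments.\<close>

lemma grid_sum_compare:
  assumes bdd: "Bseq (\<lambda>n. grid_sum (h n) w a)"
    and close: "\<And>e. 0 < e \<Longrightarrow> \<exists>d>0. \<forall>s t. 0 \<le> s \<and> s < t \<and> t \<le> a \<and> t - s < d \<longrightarrow> \<bar>f s t - g s t\<bar> \<le> e * w s t"
  shows "(\<lambda>n. grid_sum (h n) f a - grid_sum (h n) g a) \<longlonglongrightarrow> 0"
proof (rule LIMSEQ_I)
  fix e :: real assume "e > 0"
  obtain K where K: "K > 0" "\<And>n. norm (grid_sum (h n) w a) \<le> K"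
    using bdd by (auto simp: Bseq_def)
  obtain d where d: "d > 0" "\<And>s t. 0 \<le> s \<Longrightarrow> s < t \<Longrightarrow> t \<le> a \<Longrightarrow> t - s < d \<Longrightarrow> \<bar>f s t - g s t\<bar> \<le> e / (2 * K) * w s t"
    using close[of "e / (2 * K)"] K \<open>e > 0\<close> by auto
  obtain n0 where n0: "\<And>n. n \<ge> n0 \<Longrightarrow> h n < d"
    using LIMSEQ_D[OF h_lim d(1)] by (auto simp: abs_less_iff)
  have "norm (grid_sum (h n) f a - grid_sum (h n) g a - 0) < e" if "n \<ge> n0" for n
  proof -
    have "\<bar>grid_sum (h n) (\<lambda>s t. f s t - g s t) a\<bar> \<le> (\<Sum>i<nat \<lfloor>a / h n\<rfloor>. \<bar>f (real i * h n) (real (Suc i) * h n) - g (real i * h n) (real (Suc i) * h n)\<bar>)"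
      unfolding grid_sum_def by (rule sum_abs)
    also have "\<dots> \<le> (\<Sum>i<nat \<lfloor>a / h n\<rfloor>. e / (2 * K) * w (real i * h n) (real (Suc i) * h n))"
    proof (intro sum_mono d(2))
      fix i assume "i \<in> {..<nat \<lfloor>a / h n\<rfloor>}"
      then have "i < nat \<lfloor>a / h n\<rfloor>" by simp
      note b = grid_point_bounds[OF h_pos this]
      show "0 \<le> real i * h n" "real i * h n < real (Suc i) * h n" "real (Suc i) * h n \<le> a"
        by (fact b)+
      show "real (Suc i) * h n - real i * h n < d"
        using n0[OF that] by (simp add: algebra_simps)
    qed
    also have "\<dots> = e / (2 * K) * grid_sum (h n) w a"
      by (simp add: grid_sum_def sum_distrib_left)
    also have "\<dots> \<le> e / (2 * K) * K"
      using K(1) K(2)[of n] \<open>e > 0\<close> by (intro mult_left_mono) auto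
    also have "\<dots> < e" using K(1) \<open>e > 0\<close> by simp
    finally show ?thesis by (simp add: grid_sum_diff)
  qed
  then show "\<exists>no. \<forall>n\<ge>no. norm (grid_sum (h n) f a - grid_sum (h n) g a - 0) < e" by blast
qed

lemma grid_sum_compare_tendsto:
  assumes "(\<lambda>n. grid_sum (h n) g a) \<longlonglongrightarrow> l" "Bseq (\<lambda>n. grid_sum (h n) w a)"
    and "\<And>e. 0 < e \<Longrightarrow> \<exists>d>0. \<forall>s t. 0 \<le> s \<and> s < t \<and> t \<le> a \<and> t - s < d \<longrightarrow> \<bar>f s t - g s t\<bar> \<le> e * w s t"
  shows "(\<lambda>n. grid_sum (h n) f a) \<longlonglongrightarrow> l"
  using tendsto_add[OF grid_sum_compare[of w a f g, OF assms(2,3)] assms(1)] by simp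

lemma Bseq_grid_sum_increment:
  fixes X :: "real \<Rightarrow> real"
  assumes "continuous_on {0..} X" "0 \<le> a"
  shows "Bseq (\<lambda>n. grid_sum (h n) (\<lambda>s t. X t - X s) a)"
  using grid_sum_increment_tendsto[OF assms] by (intro convergent_imp_Bseq convergentI)

text \<open>The sum is compared with the increments of the indefinite integral of
  \<open>f * g\<close>, which telescope. On one cell the difference is the integral of
  \<open>(f s - f u) * g u\<close>, small relative to \<open>t - s\<close> by uniform continuity of
  \<open>f\<close> and boundedness of \<open>g\<close>.\<close>

lemma riemann_sum_tendsto:
  fixes f g :: "real \<Rightarrow> real"
  assumes f: "continuous_on {0..} f" and g: "continuous_on {0..} g" and "0 \<le> a"
  shows "(\<lambda>n. grid_sum (h n) (\<lambda>s t. f s * integral {s..t} g) a) \<longlonglongrightarrow> integral {0..a} (\<lambda>u. f u * g u)"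
proof -
  let ?G = "\<lambda>t. integral {0..t} (\<lambda>u. f u * g u)"
  have fg: "continuous_on {0..} (\<lambda>u. f u * g u)" by (intro continuous_intros f g)
  have G: "(\<lambda>n. grid_sum (h n) (\<lambda>s t. ?G t - ?G s) a) \<longlonglongrightarrow> ?G a"
    using grid_sum_increment_tendsto[OF integral_continuous_on_halfline(1)[OF fg] \<open>0 \<le> a\<close>] by simp
  obtain K where K: "K > 0" "\<And>t. 0 \<le> t \<Longrightarrow> t \<le> a \<Longrightarrow> \<bar>g t\<bar> \<le> K"
    using continuous_bounded_on_interval[OF g] by metis
  show ?thesis
  proof (rule grid_sum_compare_tendsto[OF G])
    show "Bseq (\<lambda>n. grid_sum (h n) (\<lambda>s t. t - s) a)"
      by (rule Bseq_grid_sum_increment[where X = "\<lambda>t. t"]) (use \<open>0 \<le> a\<close> in auto)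
    fix e :: real assume "e > 0"
    then obtain d where d: "d > 0" "\<And>s t. 0 \<le> s \<Longrightarrow> s \<le> t \<Longrightarrow> t \<le> a \<Longrightarrow> t - s < d \<Longrightarrow> \<bar>f t - f s\<bar> < e / K"
      using uniformly_continuous_increment[OF f, of "e / K"] K(1) by (metis divide_pos_pos)
    have "\<bar>f s * integral {s..t} g - (?G t - ?G s)\<bar> \<le> e * (t - s)"
      if st: "0 \<le> s" "s < t" "t \<le> a" "t - s < d" for s t
    proof -
      have cont: "continuous_on {s..t} g" "continuous_on {s..t} f"
        using st by (auto intro: continuous_on_subset[OF g] continuous_on_subset[OF f])
      have "f s * integral {s..t} g - (?G t - ?G s) = integral {s..t} (\<lambda>u. f s * g u) - integral {s..t} (\<lambda>u. f u * g u)"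
        using st by (subst integral_continuous_on_halfline(3)[OF fg]) auto
      also have "\<dots> = integral {s..t} (\<lambda>u. (f s - f u) * g u)"
        by (subst Henstock_Kurzweil_Integration.integral_diff[symmetric])
           (auto intro!: integrable_continuous_real continuous_intros cont simp: algebra_simps)
      finally have eq: "f s * integral {s..t} g - (?G t - ?G s) = integral {s..t} (\<lambda>u. (f s - f u) * g u)" .
      have "norm (integral {s..t} (\<lambda>u. (f s - f u) * g u)) \<le> e * (t - s)"
      proof (rule integral_bound)
        show "continuous_on {s..t} (\<lambda>u. (f s - f u) * g u)" by (intro continuous_intros cont)
        fix u assume u: "u \<in> {s..t}"
        have "\<bar>f s - f u\<bar> * \<bar>g u\<bar> \<le> e / K * K"
          using d(2)[of s u] K(2)[of u] u st
          by (intro mult_mono) (auto simp: abs_minus_commute less_imp_le \<open>e > 0\<close> K(1))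
        then show "norm ((f s - f u) * g u) \<le> e" using K(1) by (simp add: abs_mult)
      qed (use st in auto)
      then show ?thesis using eq by simp
    qed
    then show "\<exists>d>0. \<forall>s t. 0 \<le> s \<and> s < t \<and> t \<le> a \<and> t - s < d \<longrightarrow>
        \<bar>f s * integral {s..t} g - (?G t - ?G s)\<bar> \<le> e * (t - s)"
      using d(1) by blast
  qed
qed

text \<open>A squared increment is at most the largest increment of \<open>V\<close> times an
  increment of \<open>G\<close>; the first factor tends to 0 uniformly and the increments of
  \<open>G\<close> telescope.\<close>

lemma zero_quadratic_variation:
  fixes V G :: "real \<Rightarrow> real"
  assumes V: "continuous_on {0..} V" and G: "continuous_on {0..} G" and "0 \<le> a"
    and VG: "\<And>s t. 0 \<le> s \<Longrightarrow> s < t \<Longrightarrow> t \<le> a \<Longrightarrow> \<bar>V t - V s\<bar> \<le> G t - G s"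
  shows "(\<lambda>n. grid_sum (h n) (\<lambda>s t. (V t - V s)\<^sup>2) a) \<longlonglongrightarrow> 0"
proof (rule grid_sum_compare_tendsto[where g = "\<lambda>_ _. 0" and w = "\<lambda>s t. G t - G s"])
  show "Bseq (\<lambda>n. grid_sum (h n) (\<lambda>s t. G t - G s) a)"
    by (rule Bseq_grid_sum_increment[OF G \<open>0 \<le> a\<close>])
  fix e :: real assume "e > 0"
  then obtain d where d: "d > 0" "\<And>s t. 0 \<le> s \<Longrightarrow> s \<le> t \<Longrightarrow> t \<le> a \<Longrightarrow> t - s < d \<Longrightarrow> \<bar>V t - V s\<bar> < e"
    using uniformly_continuous_increment[OF V] by metis
  have "(V t - V s)\<^sup>2 \<le> e * (G t - G s)" if "0 \<le> s" "s < t" "t \<le> a" "t - s < d" for s t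
  proof -
    have "\<bar>V t - V s\<bar> * \<bar>V t - V s\<bar> \<le> e * (G t - G s)"
      using d(2)[of s t] VG[of s t] that by (intro mult_mono) auto
    then show ?thesis by (simp add: power2_eq_square)
  qed
  then show "\<exists>d>0. \<forall>s t. 0 \<le> s \<and> s < t \<and> t \<le> a \<and> t - s < d \<longrightarrow> \<bar>(V t - V s)\<^sup>2 - 0\<bar> \<le> e * (G t - G s)"
    using d(1) by (intro exI[of _ d]) auto
qed (simp add: grid_sum_def)

lemma zero_quadratic_variation_integral:
  fixes f :: "real \<Rightarrow> real"
  assumes f: "continuous_on {0..} f" and "0 \<le> a"
  shows "(\<lambda>n. grid_sum (h n) (\<lambda>s t. (integral {0..t} f - integral {0..s} f)\<^sup>2) a) \<longlonglongrightarrow> 0"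
proof (rule zero_quadratic_variation[OF integral_continuous_on_halfline(1) integral_continuous_on_halfline(1)])
  show f': "continuous_on {0..} (\<lambda>t. \<bar>f t\<bar>)" by (intro continuous_intros f)
  fix s t :: real assume st: "0 \<le> s" "s < t" "t \<le> a"
  have "norm (integral {s..t} f) \<le> integral {s..t} (\<lambda>t. \<bar>f t\<bar>)"
    by (rule integral_norm_bound_integral)
       (use st integral_continuous_on_halfline(2)[OF f] integral_continuous_on_halfline(2)[OF f'] in auto)
  then show "\<bar>integral {0..t} f - integral {0..s} f\<bar> \<le> integral {0..t} (\<lambda>t. \<bar>f t\<bar>) - integral {0..s} (\<lambda>t. \<bar>f t\<bar>)"
    using st by (simp add: integral_continuous_on_halfline(3)[OF f] integral_continuous_on_halfline(3)[OF f'])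
qed (use assms in auto)

text \<open>By the Cauchy-Schwarz inequality the cross term vanishes in the limit. This is how
  finite-variation parts are discarded from quadratic variations.\<close>

lemma quadratic_sum_perturb:
  assumes x: "(\<lambda>n. grid_sum (h n) (\<lambda>s t. (x s t)\<^sup>2) a) \<longlonglongrightarrow> c"
    and v: "(\<lambda>n. grid_sum (h n) (\<lambda>s t. (v s t)\<^sup>2) a) \<longlonglongrightarrow> 0"
  shows "(\<lambda>n. grid_sum (h n) (\<lambda>s t. (x s t + v s t)\<^sup>2) a) \<longlonglongrightarrow> c"
proof -
  have "(\<lambda>n. (grid_sum (h n) (\<lambda>s t. x s t * v s t) a)\<^sup>2) \<longlonglongrightarrow> 0"
  proof (rule tendsto_sandwich[OF _ _ tendsto_const])
    show "(\<lambda>n. grid_sum (h n) (\<lambda>s t. (x s t)\<^sup>2) a * grid_sum (h n) (\<lambda>s t. (v s t)\<^sup>2) a) \<longlonglongrightarrow> 0"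
      using tendsto_mult[OF x v] by simp
    show "\<forall>\<^sub>F n in sequentially. (grid_sum (h n) (\<lambda>s t. x s t * v s t) a)\<^sup>2
        \<le> grid_sum (h n) (\<lambda>s t. (x s t)\<^sup>2) a * grid_sum (h n) (\<lambda>s t. (v s t)\<^sup>2) a"
      unfolding grid_sum_def by (intro always_eventually allI Cauchy_Schwarz_ineq_sum)
  qed auto
  then have "(\<lambda>n. sqrt ((grid_sum (h n) (\<lambda>s t. x s t * v s t) a)\<^sup>2)) \<longlonglongrightarrow> sqrt 0"
    by (rule tendsto_real_sqrt)
  then have xv: "(\<lambda>n. grid_sum (h n) (\<lambda>s t. x s t * v s t) a) \<longlonglongrightarrow> 0"
    by (simp add: tendsto_rabs_zero_iff)
  have "(x s t + v s t)\<^sup>2 = (x s t)\<^sup>2 + 2 * (x s t * v s t) + (v s t)\<^sup>2" for s t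
    by (simp add: power2_sum)
  then have "(\<lambda>n. grid_sum (h n) (\<lambda>s t. (x s t + v s t)\<^sup>2) a) =
      (\<lambda>n. grid_sum (h n) (\<lambda>s t. (x s t)\<^sup>2) a + 2 * grid_sum (h n) (\<lambda>s t. x s t * v s t) a
        + grid_sum (h n) (\<lambda>s t. (v s t)\<^sup>2) a)"
    by (simp add: grid_sum_add grid_sum_cmult)
  then show ?thesis
    using tendsto_add[OF tendsto_add[OF x tendsto_mult_left[OF xv, of 2]] v] by simp
qed

text \<open>A weak convergence argument: \<open>f\<close> is frozen at finitely many rational
  breakpoints. Each block sum of \<open>c\<close> is a difference of two grid sums with rational end
  times and tends to 0, while the error of freezing is the oscillation of \<open>f\<close> times the
  bounded sum of \<open>\<bar>c s t\<bar>\<close>.\<close>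

lemma weighted_sum_tendsto_zero:
  fixes f :: "real \<Rightarrow> real"
  assumes f: "continuous_on {0..} f" and a: "a \<in> \<rat>" "0 \<le> a"
    and bdd: "Bseq (\<lambda>n. grid_sum (h n) (\<lambda>s t. \<bar>c s t\<bar>) a)"
    and c: "\<And>b. b \<in> \<rat> \<Longrightarrow> 0 \<le> b \<Longrightarrow> b \<le> a \<Longrightarrow> (\<lambda>n. grid_sum (h n) c b) \<longlonglongrightarrow> 0"
  shows "(\<lambda>n. grid_sum (h n) (\<lambda>s t. f s * c s t) a) \<longlonglongrightarrow> 0"
proof (rule LIMSEQ_I)
  fix e :: real assume "e > 0"
  obtain B where B: "B > 0" "\<And>n. norm (grid_sum (h n) (\<lambda>s t. \<bar>c s t\<bar>) a) \<le> B"
    using bdd by (auto simp: Bseq_def)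
  obtain d where d: "d > 0" "\<And>s t. 0 \<le> s \<Longrightarrow> s \<le> t \<Longrightarrow> t \<le> a \<Longrightarrow> t - s < d \<Longrightarrow> \<bar>f t - f s\<bar> < e / (2 * B)"
    using uniformly_continuous_increment[OF f, of "e / (2 * B)"] B \<open>e > 0\<close> by (metis divide_pos_pos mult_pos_pos zero_less_numeral)
  \<comment> \<open>With \<open>K\<close> blocks of length \<open>a / K < d\<close>, the function
    \<open>f\<close> varies by less than \<open>e / (2 * B)\<close> between points of one block. The
    breakpoints inherit rationality from \<open>a\<close>, which is what makes the hypothesis on
    \<open>c\<close> applicable to them.\<close>
  obtain K0 :: nat where "a / d < real K0" using reals_Archimedean2 by blast
  then have "a / d < real (Suc K0)" by simp
  then obtain K :: nat where K: "a / d < real K" "0 < K" by blast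
  define b where "b j = a * real j / real K" for j
  have bQ: "b j \<in> \<rat>" for j unfolding b_def by (intro Rats_divide Rats_mult a) auto
  have b0: "0 \<le> b j" for j unfolding b_def using a K by auto
  have bmono: "b i \<le> b j" if "i \<le> j" for i j
    unfolding b_def using that a K by (intro divide_right_mono mult_left_mono) auto
  have bK: "b K = a" "b 0 = 0" using K by (auto simp: b_def)
  have bstep: "b (Suc j) - b j < d" for j
  proof -
    have "b (Suc j) - b j = a / real K" by (simp add: b_def algebra_simps add_divide_distrib)
    also have "\<dots> < d" using K d(1) by (simp add: field_simps)
    finally show ?thesis .
  qed
  define N where "N n j = nat \<lfloor>b j / h n\<rfloor>" for n j
  have Nmono: "N n i \<le> N n j" if "i \<le> j" for n i j
    unfolding N_def by (intro nat_mono floor_mono divide_right_mono bmono that) (simp add: h_pos less_imp_le)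
  define C where "C n i = c (real i * h n) (real (Suc i) * h n)" for n i
  have block: "(\<Sum>i<N n J. u i) = (\<Sum>j<J. \<Sum>i=N n j..<N n (Suc j). u i)" for n J and u :: "nat \<Rightarrow> real"
  proof (induction J)
    case 0 then show ?case using bK by (simp add: N_def)
  next
    case (Suc J)
    have "(\<Sum>i<N n (Suc J). u i) = (\<Sum>i<N n J. u i) + (\<Sum>i=N n J..<N n (Suc J). u i)"
      using sum.atLeastLessThan_concat[of 0 "N n J" "N n (Suc J)" u] Nmono[of J "Suc J" n]
      by (simp add: lessThan_atLeast0)
    then show ?case using Suc by simp
  qed
  have blockC: "(\<lambda>n. \<Sum>i=N n j..<N n (Suc j). C n i) \<longlonglongrightarrow> 0" if "j < K" for j
  proof -
    have "(\<lambda>n. grid_sum (h n) c (b (Suc j)) - grid_sum (h n) c (b j)) \<longlonglongrightarrow> 0 - 0"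
      using that bmono[of "Suc j" K] bmono[of j K] bK
      by (intro tendsto_diff c bQ b0) auto
    moreover have "grid_sum (h n) c (b (Suc j)) - grid_sum (h n) c (b j) = (\<Sum>i=N n j..<N n (Suc j). C n i)" for n
      using sum.atLeastLessThan_concat[of 0 "N n j" "N n (Suc j)" "C n"] Nmono[of j "Suc j" n]
      by (simp add: lessThan_atLeast0 grid_sum_def C_def N_def)
    ultimately show ?thesis by simp
  qed
  have "(\<lambda>n. \<Sum>j<K. f (b j) * (\<Sum>i=N n j..<N n (Suc j). C n i)) \<longlonglongrightarrow> (\<Sum>j<K. f (b j) * 0)"
    by (intro tendsto_sum tendsto_mult tendsto_const blockC) auto
  then have step: "(\<lambda>n. \<Sum>j<K. f (b j) * (\<Sum>i=N n j..<N n (Suc j). C n i)) \<longlonglongrightarrow> 0" by simp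
  obtain n1 where n1: "\<And>n. n \<ge> n1 \<Longrightarrow> \<bar>\<Sum>j<K. f (b j) * (\<Sum>i=N n j..<N n (Suc j). C n i)\<bar> < e / 2"
    using LIMSEQ_D[OF step, of "e / 2"] \<open>e > 0\<close> by auto
  obtain n2 where n2: "\<And>n. n \<ge> n2 \<Longrightarrow> h n < d"
    using LIMSEQ_D[OF h_lim d(1)] by (auto simp: abs_less_iff)
  have "norm (grid_sum (h n) (\<lambda>s t. f s * c s t) a - 0) < e" if n: "n \<ge> max n1 n2" for n
  proof -
    \<comment> \<open>Since \<open>N n j\<close> is rounded down, the first cell of block
      \<open>j\<close> may begin before \<open>b j\<close>, but by less than one mesh width. Hence
      two cases: to the right of \<open>b j\<close> the block length bounds the distance, to the
      left \<open>h n < d\<close> does.\<close>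
    have near: "\<bar>f (real i * h n) - f (b j)\<bar> \<le> e / (2 * B)"
      if j: "j < K" and i: "i \<in> {N n j..<N n (Suc j)}" for i j
    proof -
      have i': "i < nat \<lfloor>b (Suc j) / h n\<rfloor>" using i by (simp add: N_def)
      have up: "real i * h n < b (Suc j)" "0 \<le> real i * h n"
        using grid_point_bounds[OF h_pos[of n] i'] by auto
      have "b j - h n < real (N n j) * h n"
        unfolding N_def by (rule grid_end_bounds(2)[OF h_pos b0])
      also have "\<dots> \<le> real i * h n" using i h_pos[of n] by (intro mult_right_mono) auto
      finally have lo: "b j - h n < real i * h n" .
      have le: "b j \<le> a" "b (Suc j) \<le> a" using bmono[of "Suc j" K] bmono[of j K] bK j by auto
      show ?thesis
      proof (cases "b j \<le> real i * h n")
        case True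
        then show ?thesis using d(2)[of "b j" "real i * h n"] up bstep[of j] b0[of j] le by auto
      next
        case False
        then show ?thesis using d(2)[of "real i * h n" "b j"] up lo n2[of n] n le
          by (auto simp: abs_minus_commute)
      qed
    qed
    have "grid_sum (h n) (\<lambda>s t. f s * c s t) a = (\<Sum>j<K. \<Sum>i=N n j..<N n (Suc j). f (real i * h n) * C n i)"
      using block[of "\<lambda>i. f (real i * h n) * C n i" n K] bK by (simp add: grid_sum_def C_def N_def)
    also have "\<dots> = (\<Sum>j<K. \<Sum>i=N n j..<N n (Suc j). (f (real i * h n) - f (b j)) * C n i)
        + (\<Sum>j<K. f (b j) * (\<Sum>i=N n j..<N n (Suc j). C n i))"
      by (simp add: sum.distrib[symmetric] sum_distrib_left algebra_simps)
    finally have split: "grid_sum (h n) (\<lambda>s t. f s * c s t) a = \<dots>" .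
    have "\<bar>\<Sum>j<K. \<Sum>i=N n j..<N n (Suc j). (f (real i * h n) - f (b j)) * C n i\<bar>
        \<le> (\<Sum>j<K. \<Sum>i=N n j..<N n (Suc j). \<bar>(f (real i * h n) - f (b j)) * C n i\<bar>)"
      by (intro order_trans[OF sum_abs] sum_mono sum_abs)
    also have "\<dots> \<le> (\<Sum>j<K. \<Sum>i=N n j..<N n (Suc j). e / (2 * B) * \<bar>C n i\<bar>)"
      unfolding abs_mult by (intro sum_mono mult_right_mono near) auto
    also have "\<dots> = e / (2 * B) * grid_sum (h n) (\<lambda>s t. \<bar>c s t\<bar>) a"
      using block[of "\<lambda>i. \<bar>C n i\<bar>" n K] bK by (simp add: grid_sum_def C_def N_def sum_distrib_left)
    also have "\<dots> \<le> e / (2 * B) * B"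
      using B(1) B(2)[of n] \<open>e > 0\<close> by (intro mult_left_mono) auto
    also have "\<dots> = e / 2" using B(1) by simp
    finally have "\<bar>\<Sum>j<K. \<Sum>i=N n j..<N n (Suc j). (f (real i * h n) - f (b j)) * C n i\<bar> \<le> e / 2" .
    with n1[of n] n show ?thesis unfolding split by auto
  qed
  then show "\<exists>no. \<forall>n\<ge>no. norm (grid_sum (h n) (\<lambda>s t. f s * c s t) a - 0) < e" by blast
qed

text \<open>Subtracting the compensator \<open>q * (t - s)\<close> leaves terms whose grid sums tend
  to 0 and whose absolute sums remain bounded, so the weights cannot create a limit. What remains is
  a Riemann sum.\<close>

lemma weighted_quadratic_variation:
  fixes f X :: "real \<Rightarrow> real"
  assumes f: "continuous_on {0..} f" and a: "a \<in> \<rat>" "0 \<le> a"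
    and qv: "\<And>b. b \<in> \<rat> \<Longrightarrow> 0 \<le> b \<Longrightarrow> (\<lambda>n. grid_sum (h n) (\<lambda>s t. (X t - X s)\<^sup>2) b) \<longlonglongrightarrow> q * b"
  shows "(\<lambda>n. grid_sum (h n) (\<lambda>s t. f s * (X t - X s)\<^sup>2) a) \<longlonglongrightarrow> q * integral {0..a} f"
proof -
  let ?c = "\<lambda>s t. (X t - X s)\<^sup>2 - q * (t - s)"
  have lin: "(\<lambda>n. grid_sum (h n) (\<lambda>s t. r * (t - s)) b) \<longlonglongrightarrow> r * b" if "0 \<le> b" for b r
    using tendsto_mult_left[OF grid_sum_increment_tendsto[of "\<lambda>t. t" b], of r] that
    by (simp add: grid_sum_cmult)
  have c: "(\<lambda>n. grid_sum (h n) ?c b) \<longlonglongrightarrow> 0" if "b \<in> \<rat>" "0 \<le> b" for b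
    using tendsto_diff[OF qv[OF that] lin[of b q]] that by (simp add: grid_sum_diff)
  have "Bseq (\<lambda>n. grid_sum (h n) (\<lambda>s t. (X t - X s)\<^sup>2 + \<bar>q\<bar> * (t - s)) a)"
    using tendsto_add[OF qv[OF a] lin[of a "\<bar>q\<bar>"]] a
    by (intro convergent_imp_Bseq convergentI) (auto simp: grid_sum_add)
  then have "Bseq (\<lambda>n. grid_sum (h n) (\<lambda>s t. \<bar>?c s t\<bar>) a)"
  proof (rule Bseq_eventually_mono[rotated], intro always_eventually allI)
    fix n
    have "grid_sum (h n) (\<lambda>s t. \<bar>?c s t\<bar>) a \<le> grid_sum (h n) (\<lambda>s t. (X t - X s)\<^sup>2 + \<bar>q\<bar> * (t - s)) a"
    proof (rule grid_sum_mono[OF h_pos])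
      fix s t :: real assume "s < t"
      have "\<bar>q * (t - s)\<bar> = \<bar>q\<bar> * (t - s)" using \<open>s < t\<close> by (simp add: abs_mult)
      then show "\<bar>?c s t\<bar> \<le> (X t - X s)\<^sup>2 + \<bar>q\<bar> * (t - s)"
        using abs_triangle_ineq4[of "(X t - X s)\<^sup>2" "q * (t - s)"] by simp
    qed
    moreover have "0 \<le> grid_sum (h n) (\<lambda>s t. \<bar>?c s t\<bar>) a"
      by (rule grid_sum_nonneg[OF h_pos]) auto
    ultimately show "norm (grid_sum (h n) (\<lambda>s t. \<bar>?c s t\<bar>) a) \<le> norm (grid_sum (h n) (\<lambda>s t. (X t - X s)\<^sup>2 + \<bar>q\<bar> * (t - s)) a)"
      by simp
  qed
  then have "(\<lambda>n. grid_sum (h n) (\<lambda>s t. f s * ?c s t) a) \<longlonglongrightarrow> 0"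
    by (rule weighted_sum_tendsto_zero[OF f a]) (use c in auto)
  \<comment> \<open>Here \<open>t - s\<close> is written as the integral of 1, so that the weighted
    compensator is literally a sum covered by the Riemann sum lemma.\<close>
  moreover have "(\<lambda>n. q * grid_sum (h n) (\<lambda>s t. f s * integral {s..t} (\<lambda>_. 1)) a) \<longlonglongrightarrow> q * integral {0..a} f"
    using tendsto_mult_left[OF riemann_sum_tendsto[OF f _ a(2), of "\<lambda>_. 1"], of q] by simp
  moreover have "grid_sum (h n) (\<lambda>s t. f s * (X t - X s)\<^sup>2) a =
      grid_sum (h n) (\<lambda>s t. f s * ?c s t) a + q * grid_sum (h n) (\<lambda>s t. f s * integral {s..t} (\<lambda>_. 1)) a" for n
    unfolding grid_sum_cmult[symmetric] grid_sum_add[symmetric]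
    by (rule grid_sum_cong[OF h_pos]) (simp add: algebra_simps)
  ultimately show ?thesis using tendsto_add by fastforce
qed

end

section \<open>Passage from rational times to all times\<close>

text \<open>Round \<open>t\<close> down to a multiple of \<open>1 / (n + 1)\<close>;
  \<open>nat\<close> sends negative times to 0. Monotonicity in \<open>t\<close> preserves the order
  of two times under approximation, as the transfer of inequalities requires.\<close>

lemma rational_approximation_from_below:
  obtains q :: "nat \<Rightarrow> real \<Rightarrow> real" where "\<And>n t. q n t \<in> \<rat>" "\<And>n t. 0 \<le> q n t"
    "\<And>n s t. s \<le> t \<Longrightarrow> q n s \<le> q n t" "\<And>t. 0 \<le> t \<Longrightarrow> (\<lambda>n. q n t) \<longlonglongrightarrow> t"
proof
  let ?h = "\<lambda>n. 1 / real (Suc n)"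
  let ?q = "\<lambda>n t. real (nat \<lfloor>t / ?h n\<rfloor>) * ?h n"
  interpret shrinking_mesh ?h
    by unfold_locales (simp, rule LIMSEQ_Suc[OF lim_1_over_n])
  show "?q n t \<in> \<rat>" "0 \<le> ?q n t" for n t by (auto intro!: Rats_mult Rats_divide)
  show "?q n s \<le> ?q n t" if "s \<le> t" for n s t
    by (intro mult_right_mono of_nat_mono nat_mono floor_mono divide_right_mono that) auto
  show "(\<lambda>n. ?q n t) \<longlonglongrightarrow> t" if "0 \<le> t" for t by (rule grid_end_tendsto[OF that])
qed

lemma continuous_eq_of_eq_on_rationals:
  fixes f g :: "real \<Rightarrow> real"
  assumes "continuous_on {0..} f" "continuous_on {0..} g"
    and "\<And>a. a \<in> \<rat> \<Longrightarrow> 0 \<le> a \<Longrightarrow> f a = g a" and "0 \<le> t"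
  shows "f t = g t"
proof -
  obtain q :: "nat \<Rightarrow> real \<Rightarrow> real" where q: "\<And>n t. q n t \<in> \<rat>" "\<And>n t. 0 \<le> q n t"
    "\<And>n s t. s \<le> t \<Longrightarrow> q n s \<le> q n t" "\<And>t. 0 \<le> t \<Longrightarrow> (\<lambda>n. q n t) \<longlonglongrightarrow> t"
    by (rule rational_approximation_from_below) blast
  have lim: "(\<lambda>n. u (q n t)) \<longlonglongrightarrow> u t" if "continuous_on {0..} u" for u :: "real \<Rightarrow> real"
    by (rule continuous_on_tendsto_compose[OF that q(4)]) (use \<open>0 \<le> t\<close> q(2) in auto)
  have "(\<lambda>n. f (q n t)) = (\<lambda>n. g (q n t))"
    by (intro ext assms(3) q(1,2))
  with lim[OF assms(1)] have "(\<lambda>n. g (q n t)) \<longlonglongrightarrow> f t" by (simp only:)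
  from LIMSEQ_unique[OF this lim[OF assms(2)]] show ?thesis .
qed

lemma continuous_mono_of_mono_on_rationals:
  fixes f :: "real \<Rightarrow> real"
  assumes "continuous_on {0..} f"
    and "\<And>a b. a \<in> \<rat> \<Longrightarrow> b \<in> \<rat> \<Longrightarrow> 0 \<le> a \<Longrightarrow> a \<le> b \<Longrightarrow> f a \<le> f b" and "0 \<le> s" "s \<le> t"
  shows "f s \<le> f t"
proof -
  obtain q :: "nat \<Rightarrow> real \<Rightarrow> real" where q: "\<And>n t. q n t \<in> \<rat>" "\<And>n t. 0 \<le> q n t"
    "\<And>n s t. s \<le> t \<Longrightarrow> q n s \<le> q n t" "\<And>t. 0 \<le> t \<Longrightarrow> (\<lambda>n. q n t) \<longlonglongrightarrow> t"
    by (rule rational_approximation_from_below) blast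
  have lim: "(\<lambda>n. f (q n u)) \<longlonglongrightarrow> f u" if "0 \<le> u" for u
    by (rule continuous_on_tendsto_compose[OF assms(1) q(4)]) (use that q(2) in auto)
  have "f (q n s) \<le> f (q n t)" for n
    by (rule assms(2)[OF q(1) q(1) q(2) q(3)[OF \<open>s \<le> t\<close>]])
  then show ?thesis
    using LIMSEQ_le[OF lim[of s] lim[of t]] assms(3,4) by auto
qed

section \<open>Return sums and the logarithm\<close>

text \<open>Lagrange remainder of order three: its factor \<open>exp t / 6\<close> is at most 1
  because e is at most 3. The cubic bound keeps the form \<open>\<bar>y\<bar> * y\<^sup>2\<close> so
  that a small factor multiplies the control function, the squared log increment.\<close>

lemma exp_second_order_bound:
  fixes y :: real
  assumes "\<bar>y\<bar> \<le> 1"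
  shows "\<bar>exp y - 1 - y - y\<^sup>2 / 2\<bar> \<le> \<bar>y\<bar> * y\<^sup>2"
proof -
  obtain t where t: "\<bar>t\<bar> \<le> \<bar>y\<bar>" "exp y = (\<Sum>m<3. y ^ m / fact m) + exp t / fact 3 * y ^ 3"
    using Maclaurin_exp_le[of y 3] by blast
  have "exp t \<le> exp 1" using t assms by simp
  also have "\<dots> \<le> 3" by (rule exp_le)
  finally have "exp t \<le> 6" by simp
  have "exp y - 1 - y - y\<^sup>2 / 2 = exp t / 6 * y ^ 3"
    using t(2) by (simp add: eval_nat_numeral)
  moreover have "\<bar>exp t / 6 * y ^ 3\<bar> = exp t / 6 * (\<bar>y\<bar> * y\<^sup>2)"
    by (simp add: abs_mult power3_eq_cube power2_eq_square)
  ultimately have "\<bar>exp y - 1 - y - y\<^sup>2 / 2\<bar> = exp t / 6 * (\<bar>y\<bar> * y\<^sup>2)" by (simp only:)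
  also have "\<dots> \<le> 1 * (\<bar>y\<bar> * y\<^sup>2)"
    using \<open>exp t \<le> 6\<close> by (intro mult_right_mono) auto
  finally show ?thesis by simp
qed

context shrinking_mesh
begin

text \<open>Expanding the return in the log increment needs bounded sums of squared log increments,
  which are not given. Monotonicity of \<open>A\<close> supplies them: a continuous monotone
  function has zero quadratic variation, so \<open>ln Y\<close> inherits the quadratic variation of
  \<open>Z\<close>. Only then does the second-order expansion identify \<open>A\<close> as
  \<open>C / 2\<close>.\<close>

lemma log_from_return_sums:
  fixes Y Z C :: "real \<Rightarrow> real"
  assumes Y: "continuous_on {0..} Y" and Ypos: "\<And>t. 0 \<le> t \<Longrightarrow> 0 < Y t"
    and Z: "continuous_on {0..} Z"
    and ret: "\<And>a. a \<in> \<rat> \<Longrightarrow> 0 \<le> a \<Longrightarrow> (\<lambda>n. grid_sum (h n) (\<lambda>s t. 1 / Y s * (Y t - Y s)) a) \<longlonglongrightarrow> Z a"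
    and qv: "\<And>a. a \<in> \<rat> \<Longrightarrow> 0 \<le> a \<Longrightarrow> (\<lambda>n. grid_sum (h n) (\<lambda>s t. (Z t - Z s)\<^sup>2) a) \<longlonglongrightarrow> C a"
  shows "\<And>a. a \<in> \<rat> \<Longrightarrow> 0 \<le> a \<Longrightarrow> ln (Y a / Y 0) = Z a - C a / 2"
    and "\<And>a. a \<in> \<rat> \<Longrightarrow> 0 \<le> a \<Longrightarrow> (\<lambda>n. grid_sum (h n) (\<lambda>s t. (ln (Y t) - ln (Y s))\<^sup>2) a) \<longlonglongrightarrow> C a"
proof -
  define A where "A t = Z t - (ln (Y t) - ln (Y 0))" for t
  have lnY: "continuous_on {0..} (\<lambda>t. ln (Y t))"
    by (intro continuous_on_ln Y) (use Ypos in force)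
  have A: "continuous_on {0..} A"
    unfolding A_def by (intro continuous_intros Z lnY)
  let ?f = "\<lambda>s t. 1 / Y s * (Y t - Y s) - (ln (Y t) - ln (Y s))"
  have fA: "(\<lambda>n. grid_sum (h n) ?f a) \<longlonglongrightarrow> A a" if "a \<in> \<rat>" "0 \<le> a" for a
    unfolding A_def grid_sum_diff[of _ "\<lambda>s t. 1 / Y s * (Y t - Y s)"]
    by (intro tendsto_diff ret that grid_sum_increment_tendsto lnY)
  have f0: "0 \<le> ?f s t" if "0 \<le> s" "s < t" for s t
  proof -
    have "ln (Y t / Y s) \<le> Y t / Y s - 1" using Ypos that by (intro ln_le_minus_one) auto
    moreover have "1 / Y s * (Y t - Y s) = Y t / Y s - 1" using Ypos[of s] that by (simp add: field_simps)
    ultimately show ?thesis using Ypos[of s] Ypos[of t] that by (simp add: ln_div)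
  qed
  have Amono: "A s \<le> A t" if "0 \<le> s" "s \<le> t" for s t
  proof (rule continuous_mono_of_mono_on_rationals[OF A _ that])
    fix a b :: real assume ab: "a \<in> \<rat>" "b \<in> \<rat>" "0 \<le> a" "a \<le> b"
    have "grid_sum (h n) ?f a \<le> grid_sum (h n) ?f b" for n
      by (rule grid_sum_mono_end[OF h_pos ab(4)]) (rule f0)
    then show "A a \<le> A b"
      using LIMSEQ_le[OF fA[of a] fA[of b]] ab by auto
  qed
  show lnqv: "(\<lambda>n. grid_sum (h n) (\<lambda>s t. (ln (Y t) - ln (Y s))\<^sup>2) a) \<longlonglongrightarrow> C a"
    if a: "a \<in> \<rat>" "0 \<le> a" for a
  proof -
    have "(\<lambda>n. grid_sum (h n) (\<lambda>s t. (A t - A s)\<^sup>2) a) \<longlonglongrightarrow> 0"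
      by (rule zero_quadratic_variation[OF A A a(2)]) (use Amono in auto)
    \<comment> \<open>Up to a constant \<open>ln Y\<close> is \<open>Z - A\<close>, so the
      perturbation of the increments of \<open>Z\<close> carries a minus sign.\<close>
    then have "(\<lambda>n. grid_sum (h n) (\<lambda>s t. (- (A t - A s))\<^sup>2) a) \<longlonglongrightarrow> 0"
      by (simp only: power2_minus)
    from quadratic_sum_perturb[OF qv[OF a] this] show ?thesis
      by (simp add: A_def algebra_simps)
  qed
  show "ln (Y a / Y 0) = Z a - C a / 2" if a: "a \<in> \<rat>" "0 \<le> a" for a
  proof -
    have half: "(\<lambda>n. grid_sum (h n) (\<lambda>s t. 1 / 2 * (ln (Y t) - ln (Y s))\<^sup>2) a) \<longlonglongrightarrow> 1 / 2 * C a"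
      unfolding grid_sum_cmult by (intro tendsto_mult_left lnqv a)
    have "(\<lambda>n. grid_sum (h n) ?f a) \<longlonglongrightarrow> 1 / 2 * C a"
    proof (rule grid_sum_compare_tendsto[OF half])
      show "Bseq (\<lambda>n. grid_sum (h n) (\<lambda>s t. (ln (Y t) - ln (Y s))\<^sup>2) a)"
        using lnqv[OF a] by (intro convergent_imp_Bseq convergentI)
      fix e :: real assume "e > 0"
      then obtain d where d: "d > 0" "\<And>s t. 0 \<le> s \<Longrightarrow> s \<le> t \<Longrightarrow> t \<le> a \<Longrightarrow> t - s < d \<Longrightarrow> \<bar>ln (Y t) - ln (Y s)\<bar> < min e 1"
        using uniformly_continuous_increment[OF lnY, of "min e 1" a] by auto
      have "\<bar>?f s t - 1 / 2 * (ln (Y t) - ln (Y s))\<^sup>2\<bar> \<le> e * (ln (Y t) - ln (Y s))\<^sup>2"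
        if st: "0 \<le> s" "s < t" "t \<le> a" "t - s < d" for s t
      proof -
        define y where "y = ln (Y t) - ln (Y s)"
        have y: "\<bar>y\<bar> < min e 1" unfolding y_def by (rule d(2)) (use st in auto)
        have "exp y = Y t / Y s" unfolding y_def using Ypos[of s] Ypos[of t] st by (simp add: exp_diff)
        then have "?f s t = exp y - 1 - y" using Ypos[of s] st by (simp add: y_def field_simps)
        moreover have "\<bar>exp y - 1 - y - y\<^sup>2 / 2\<bar> \<le> \<bar>y\<bar> * y\<^sup>2" using y by (intro exp_second_order_bound) auto
        moreover have "\<bar>y\<bar> * y\<^sup>2 \<le> e * y\<^sup>2" using y by (intro mult_right_mono) auto
        ultimately show ?thesis by (simp add: y_def)
      qed
      then show "\<exists>d>0. \<forall>s t. 0 \<le> s \<and> s < t \<and> t \<le> a \<and> t - s < d \<longrightarrow>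
          \<bar>?f s t - 1 / 2 * (ln (Y t) - ln (Y s))\<^sup>2\<bar> \<le> e * (ln (Y t) - ln (Y s))\<^sup>2"
        using d(1) by blast
    qed
    then have "A a = 1 / 2 * C a" using fA[OF a] LIMSEQ_unique by blast
    then show ?thesis using Ypos[of a] Ypos[of 0] a by (simp add: A_def ln_div)
  qed
qed

text \<open>With \<open>y\<close> the log increment, the return is \<open>exp y - 1\<close>, that is
  \<open>y + y\<^sup>2 / 2\<close> up to a cubic error, and \<open>y\<close> is the increment of
  \<open>Z\<close> minus \<open>q / 2 * (t - s)\<close>. The drift correction and the quadratic term
  have opposite limits, so weighted sums of returns and of increments of \<open>Z\<close> agree in
  the limit.\<close>

lemma return_sums_weighted:
  fixes Y Z f :: "real \<Rightarrow> real"
  assumes f: "continuous_on {0..} f" and Z: "continuous_on {0..} Z"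
    and Ypos: "\<And>t. 0 \<le> t \<Longrightarrow> 0 < Y t"
    and lnY: "\<And>t. 0 \<le> t \<Longrightarrow> ln (Y t / Y 0) = Z t - q * t / 2"
    and qv: "\<And>a. a \<in> \<rat> \<Longrightarrow> 0 \<le> a \<Longrightarrow> (\<lambda>n. grid_sum (h n) (\<lambda>s t. (ln (Y t) - ln (Y s))\<^sup>2) a) \<longlonglongrightarrow> q * a"
    and a: "a \<in> \<rat>" "0 \<le> a"
    and Zsum: "(\<lambda>n. grid_sum (h n) (\<lambda>s t. f s * (Z t - Z s)) a) \<longlonglongrightarrow> l"
  shows "(\<lambda>n. grid_sum (h n) (\<lambda>s t. f s * (1 / Y s * (Y t - Y s))) a) \<longlonglongrightarrow> l"
proof -
  define y where "y s t = ln (Y t) - ln (Y s)" for s t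
  have y: "y s t = Z t - Z s - q / 2 * (t - s)" if "0 \<le> s" "0 \<le> t" for s t
    using lnY[OF that(1)] lnY[OF that(2)] Ypos[OF that(1)] Ypos[OF that(2)] Ypos[of 0]
    by (simp add: y_def ln_div field_simps)
  let ?g = "\<lambda>s t. f s * (Z t - Z s) - q / 2 * (f s * integral {s..t} (\<lambda>_. 1)) + 1 / 2 * (f s * (y s t)\<^sup>2)"
  have "(\<lambda>n. grid_sum (h n) ?g a) \<longlonglongrightarrow> l - q / 2 * integral {0..a} (\<lambda>u. f u * 1) + 1 / 2 * (q * integral {0..a} f)"
    unfolding grid_sum_add grid_sum_diff grid_sum_cmult y_def
    by (intro tendsto_add tendsto_diff tendsto_mult_left Zsum riemann_sum_tendsto weighted_quadratic_variation f a qv)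
       auto
  then have g: "(\<lambda>n. grid_sum (h n) ?g a) \<longlonglongrightarrow> l" by simp
  obtain K where K: "K > 0" "\<And>t. 0 \<le> t \<Longrightarrow> t \<le> a \<Longrightarrow> \<bar>f t\<bar> \<le> K"
    using continuous_bounded_on_interval[OF f] by metis
  \<comment> \<open>By \<open>lnY\<close> this function is \<open>ln (Y t / Y 0)\<close>; its
    continuity makes the log increments uniformly small.\<close>
  have lnYc: "continuous_on {0..} (\<lambda>t. Z t - q * t / 2)" by (intro continuous_intros Z) auto
  show ?thesis
  proof (rule grid_sum_compare_tendsto[OF g])
    show "Bseq (\<lambda>n. grid_sum (h n) (\<lambda>s t. (y s t)\<^sup>2) a)"
      using qv[OF a] unfolding y_def by (intro convergent_imp_Bseq convergentI)
    fix e :: real assume "e > 0"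
    then have "min (e / K) 1 > 0" using K by auto
    from uniformly_continuous_increment[OF lnYc this, of a] obtain d where
      d: "d > 0" "\<And>s t. 0 \<le> s \<Longrightarrow> s \<le> t \<Longrightarrow> t \<le> a \<Longrightarrow> t - s < d \<Longrightarrow> \<bar>(Z t - q * t / 2) - (Z s - q * s / 2)\<bar> < min (e / K) 1"
      by blast
    have "\<bar>f s * (1 / Y s * (Y t - Y s)) - ?g s t\<bar> \<le> e * (y s t)\<^sup>2"
      if st: "0 \<le> s" "s < t" "t \<le> a" "t - s < d" for s t
    proof -
      have yst: "\<bar>y s t\<bar> < min (e / K) 1" using d(2)[of s t] st by (simp add: y algebra_simps diff_divide_distrib)
      have "exp (y s t) = Y t / Y s" unfolding y_def using Ypos[of s] Ypos[of t] st by (simp add: exp_diff)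
      then have 1: "1 / Y s * (Y t - Y s) = exp (y s t) - 1" using Ypos[of s] st by (simp add: field_simps)
      have "f s * (1 / Y s * (Y t - Y s)) - ?g s t = f s * (exp (y s t) - 1 - y s t - (y s t)\<^sup>2 / 2)"
        unfolding 1 using st by (simp add: y[of s t] algebra_simps diff_divide_distrib)
      then have "\<bar>f s * (1 / Y s * (Y t - Y s)) - ?g s t\<bar> = \<bar>f s\<bar> * \<bar>exp (y s t) - 1 - y s t - (y s t)\<^sup>2 / 2\<bar>"
        by (simp add: abs_mult)
      also have "\<dots> \<le> K * (\<bar>y s t\<bar> * (y s t)\<^sup>2)"
        using K st yst by (intro mult_mono exp_second_order_bound) auto
      also have "\<dots> \<le> K * (e / K * (y s t)\<^sup>2)"
        using K yst by (intro mult_left_mono mult_right_mono) auto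
      finally show ?thesis using K by simp
    qed
    then show "\<exists>d>0. \<forall>s t. 0 \<le> s \<and> s < t \<and> t \<le> a \<and> t - s < d \<longrightarrow>
        \<bar>f s * (1 / Y s * (Y t - Y s)) - ?g s t\<bar> \<le> e * (y s t)\<^sup>2"
      using d(1) by blast
  qed
qed

text \<open>The increment of the square is close to \<open>2 * X s\<close> times the increment of
  \<open>X\<close>. The exact difference of the squares carries the factor
  \<open>(X t - X s) * (3 * X s + X t)\<close>; the second factor is at most \<open>4 * K\<close>,
  whence the tolerance \<open>e / (4 * K)\<close>.\<close>

lemma quadratic_variation_square:
  fixes X :: "real \<Rightarrow> real"
  assumes X: "continuous_on {0..} X"
    and qv: "\<And>a. a \<in> \<rat> \<Longrightarrow> 0 \<le> a \<Longrightarrow> (\<lambda>n. grid_sum (h n) (\<lambda>s t. (X t - X s)\<^sup>2) a) \<longlonglongrightarrow> q * a"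
    and a: "a \<in> \<rat>" "0 \<le> a"
  shows "(\<lambda>n. grid_sum (h n) (\<lambda>s t. ((X t)\<^sup>2 - (X s)\<^sup>2)\<^sup>2) a) \<longlonglongrightarrow> 4 * q * integral {0..a} (\<lambda>u. (X u)\<^sup>2)"
proof -
  let ?g = "\<lambda>s t. 4 * ((X s)\<^sup>2 * (X t - X s)\<^sup>2)"
  have g: "(\<lambda>n. grid_sum (h n) ?g a) \<longlonglongrightarrow> 4 * (q * integral {0..a} (\<lambda>u. (X u)\<^sup>2))"
    unfolding grid_sum_cmult
    by (intro tendsto_mult_left weighted_quadratic_variation continuous_intros X qv a)
  obtain K where K: "K > 0" "\<And>t. 0 \<le> t \<Longrightarrow> t \<le> a \<Longrightarrow> \<bar>X t\<bar> \<le> K"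
    using continuous_bounded_on_interval[OF X] by metis
  have "(\<lambda>n. grid_sum (h n) (\<lambda>s t. ((X t)\<^sup>2 - (X s)\<^sup>2)\<^sup>2) a) \<longlonglongrightarrow> 4 * (q * integral {0..a} (\<lambda>u. (X u)\<^sup>2))"
  proof (rule grid_sum_compare_tendsto[OF g])
    show "Bseq (\<lambda>n. grid_sum (h n) (\<lambda>s t. (X t - X s)\<^sup>2) a)"
      using qv[OF a] by (intro convergent_imp_Bseq convergentI)
    fix e :: real assume "e > 0"
    then have "e / (4 * K) > 0" using K by auto
    from uniformly_continuous_increment[OF X this, of a] obtain d where
      d: "d > 0" "\<And>s t. 0 \<le> s \<Longrightarrow> s \<le> t \<Longrightarrow> t \<le> a \<Longrightarrow> t - s < d \<Longrightarrow> \<bar>X t - X s\<bar> < e / (4 * K)"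
      by blast
    have "\<bar>((X t)\<^sup>2 - (X s)\<^sup>2)\<^sup>2 - ?g s t\<bar> \<le> e * (X t - X s)\<^sup>2"
      if st: "0 \<le> s" "s < t" "t \<le> a" "t - s < d" for s t
    proof -
      have "((X t)\<^sup>2 - (X s)\<^sup>2)\<^sup>2 - ?g s t = (X t - X s) * (3 * X s + X t) * (X t - X s)\<^sup>2" by algebra
      then have "\<bar>((X t)\<^sup>2 - (X s)\<^sup>2)\<^sup>2 - ?g s t\<bar> = \<bar>X t - X s\<bar> * \<bar>3 * X s + X t\<bar> * (X t - X s)\<^sup>2"
        by (simp add: abs_mult)
      also have "\<dots> \<le> e / (4 * K) * (4 * K) * (X t - X s)\<^sup>2"
        using d(2)[of s t] K(2)[of s] K(2)[of t] st \<open>e > 0\<close> K(1)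
        by (intro mult_right_mono mult_mono) auto
      finally show ?thesis using K by simp
    qed
    then show "\<exists>d>0. \<forall>s t. 0 \<le> s \<and> s < t \<and> t \<le> a \<and> t - s < d \<longrightarrow>
        \<bar>((X t)\<^sup>2 - (X s)\<^sup>2)\<^sup>2 - ?g s t\<bar> \<le> e * (X t - X s)\<^sup>2"
      using d(1) by blast
  qed
  then show ?thesis by (simp add: algebra_simps)
qed

section \<open>The pathwise formula for the log wealth\<close>

text \<open>\<open>SL\<close> determines \<open>L\<close>, and the quadratic variation of
  \<open>L\<close> found from that expression feeds the logarithm lemma applied to
  \<open>PL\<close>. The factor \<open>1 - m / 2\<close> arises there: the gain contributes
  \<open>m / \<sigma>\<^sup>2\<close> times the integral of \<open>E\<^sup>2\<close>, and half the
  quadratic variation takes away \<open>m\<^sup>2 / (2 * \<sigma>\<^sup>2)\<close> times it.\<close>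

theorem log_wealth_formula:
  fixes W S mu E P R L :: "real \<Rightarrow> real"
  assumes W: "continuous_on {0..} W" and S: "continuous_on {0..} S" and mu: "continuous_on {0..} mu"
    and E: "continuous_on {0..} E" and P: "continuous_on {0..} P" and R: "continuous_on {0..} R"
    and L: "continuous_on {0..} L"
    and "W 0 = 0" and Spos: "\<And>t. 0 \<le> t \<Longrightarrow> 0 < S t" and Ppos: "\<And>t. 0 \<le> t \<Longrightarrow> 0 < P t"
    and "0 < \<sigma>" "0 < \<tau>"
    and Req: "\<And>t. 0 \<le> t \<Longrightarrow> R t = integral {0..t} mu + \<sigma> * W t"
    and Eeq: "\<And>t. 0 \<le> t \<Longrightarrow> E t = - (1 / \<tau>) * integral {0..t} E + (1 / \<tau>) * R t"
    and qvW: "\<And>a. a \<in> \<rat> \<Longrightarrow> 0 \<le> a \<Longrightarrow> (\<lambda>n. grid_sum (h n) (\<lambda>s t. (W t - W s)\<^sup>2) a) \<longlonglongrightarrow> a"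
    and SR: "\<And>a. a \<in> \<rat> \<Longrightarrow> 0 \<le> a \<Longrightarrow> (\<lambda>n. grid_sum (h n) (\<lambda>s t. 1 / S s * (S t - S s)) a) \<longlonglongrightarrow> R a"
    and SL: "\<And>a. a \<in> \<rat> \<Longrightarrow> 0 \<le> a \<Longrightarrow> (\<lambda>n. grid_sum (h n) (\<lambda>s t. m * (E s / \<sigma>\<^sup>2) * (1 / S s) * (S t - S s)) a) \<longlonglongrightarrow> L a"
    and PL: "\<And>a. a \<in> \<rat> \<Longrightarrow> 0 \<le> a \<Longrightarrow> (\<lambda>n. grid_sum (h n) (\<lambda>s t. 1 / P s * (P t - P s)) a) \<longlonglongrightarrow> L a"
    and "0 \<le> t"
  shows "ln (P t / P 0) = m / \<sigma>\<^sup>2 * (\<tau> / 2 * (E t)\<^sup>2 - \<sigma>\<^sup>2 / (2 * \<tau>) * t + (1 - m / 2) * integral {0..t} (\<lambda>u. (E u)\<^sup>2))"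
proof -
  have E2: "continuous_on {0..} (\<lambda>u. (E u)\<^sup>2)" by (intro continuous_intros E)
  have nz: "S u \<noteq> 0" "P u \<noteq> 0" if "0 \<le> u" for u using Spos[OF that] Ppos[OF that] by simp_all
  have qvR: "(\<lambda>n. grid_sum (h n) (\<lambda>s t. (R t - R s)\<^sup>2) a) \<longlonglongrightarrow> \<sigma>\<^sup>2 * a" if a: "a \<in> \<rat>" "0 \<le> a" for a
  proof -
    have "(\<lambda>n. grid_sum (h n) (\<lambda>s t. (\<sigma> * (W t - W s))\<^sup>2) a) \<longlonglongrightarrow> \<sigma>\<^sup>2 * a"
      unfolding power_mult_distrib grid_sum_cmult by (intro tendsto_mult_left qvW a)
    from quadratic_sum_perturb[OF this zero_quadratic_variation_integral[OF mu a(2)]]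
    have "(\<lambda>n. grid_sum (h n) (\<lambda>s t. (\<sigma> * (W t - W s) + (integral {0..t} mu - integral {0..s} mu))\<^sup>2) a) \<longlonglongrightarrow> \<sigma>\<^sup>2 * a" .
    moreover have "grid_sum (h n) (\<lambda>s t. (\<sigma> * (W t - W s) + (integral {0..t} mu - integral {0..s} mu))\<^sup>2) a
        = grid_sum (h n) (\<lambda>s t. (R t - R s)\<^sup>2) a" for n
      by (rule grid_sum_cong[OF h_pos]) (simp add: Req algebra_simps)
    ultimately show ?thesis by simp
  qed
  have qvE: "(\<lambda>n. grid_sum (h n) (\<lambda>s t. (E t - E s)\<^sup>2) a) \<longlonglongrightarrow> (\<sigma> / \<tau>)\<^sup>2 * a" if a: "a \<in> \<rat>" "0 \<le> a" for a
  proof -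
    have "(\<lambda>n. grid_sum (h n) (\<lambda>s t. (1 / \<tau> * (R t - R s))\<^sup>2) a) \<longlonglongrightarrow> (1 / \<tau>)\<^sup>2 * (\<sigma>\<^sup>2 * a)"
      unfolding power_mult_distrib grid_sum_cmult by (intro tendsto_mult_left qvR a)
    moreover have "(\<lambda>n. grid_sum (h n) (\<lambda>s t. (- (1 / \<tau>) * (integral {0..t} E - integral {0..s} E))\<^sup>2) a) \<longlonglongrightarrow> (- (1 / \<tau>))\<^sup>2 * 0"
      unfolding power_mult_distrib grid_sum_cmult by (intro tendsto_mult_left zero_quadratic_variation_integral E a)
    ultimately have "(\<lambda>n. grid_sum (h n) (\<lambda>s t. (1 / \<tau> * (R t - R s) + - (1 / \<tau>) * (integral {0..t} E - integral {0..s} E))\<^sup>2) a) \<longlonglongrightarrow> (1 / \<tau>)\<^sup>2 * (\<sigma>\<^sup>2 * a)"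
      by (intro quadratic_sum_perturb) auto
    moreover have "grid_sum (h n) (\<lambda>s t. (1 / \<tau> * (R t - R s) + - (1 / \<tau>) * (integral {0..t} E - integral {0..s} E))\<^sup>2) a
        = grid_sum (h n) (\<lambda>s t. (E t - E s)\<^sup>2) a" for n
    proof (rule grid_sum_cong[OF h_pos])
      fix s t :: real assume st: "0 \<le> s" "s < t"
      have "1 / \<tau> * (R t - R s) + - (1 / \<tau>) * (integral {0..t} E - integral {0..s} E) = E t - E s"
        unfolding right_diff_distrib using Eeq[of s] Eeq[of t] st by linarith
      then show "(1 / \<tau> * (R t - R s) + - (1 / \<tau>) * (integral {0..t} E - integral {0..s} E))\<^sup>2 = (E t - E s)\<^sup>2"
        by (simp only:)
    qed
    ultimately show ?thesis by (simp add: power_divide)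
  qed
  have "R 0 = 0" using Req[of 0] \<open>W 0 = 0\<close> by simp
  then have "E 0 = 0" using Eeq[of 0] by simp
  have lnS: "ln (S u / S 0) = R u - \<sigma>\<^sup>2 * u / 2" if "0 \<le> u" for u
  proof (rule continuous_eq_of_eq_on_rationals[OF _ _ _ that])
    show "continuous_on {0..} (\<lambda>u. ln (S u / S 0))"
      by (intro continuous_intros S) (auto simp: nz)
    show "continuous_on {0..} (\<lambda>u. R u - \<sigma>\<^sup>2 * u / 2)" by (intro continuous_intros R) auto
  qed (rule log_from_return_sums(1)[OF S Spos R SR qvR])
  \<comment> \<open>\<open>X\<close> is the value of the integral of \<open>E\<close> against
    \<open>R\<close>. The term linear in \<open>u\<close> is \<open>\<tau> / 2\<close> times the
    quadratic variation \<open>(\<sigma> / \<tau>)\<^sup>2 * u\<close> of \<open>E\<close>.\<close>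
  define X where "X u = \<tau> / 2 * (E u)\<^sup>2 - \<sigma>\<^sup>2 / (2 * \<tau>) * u + integral {0..u} (\<lambda>u. (E u)\<^sup>2)" for u
  have X: "continuous_on {0..} X"
    unfolding X_def by (intro continuous_intros E integral_continuous_on_halfline(1))
  have ER: "(\<lambda>n. grid_sum (h n) (\<lambda>s t. E s * (R t - R s)) a) \<longlonglongrightarrow> X a" if a: "a \<in> \<rat>" "0 \<le> a" for a
  proof -
    have "(\<lambda>n. grid_sum (h n) (\<lambda>s t. \<tau> / 2 * ((E t)\<^sup>2 - (E s)\<^sup>2) - \<tau> / 2 * (E t - E s)\<^sup>2 + E s * integral {s..t} E) a)
        \<longlonglongrightarrow> \<tau> / 2 * ((E a)\<^sup>2 - (E 0)\<^sup>2) - \<tau> / 2 * ((\<sigma> / \<tau>)\<^sup>2 * a) + integral {0..a} (\<lambda>u. E u * E u)"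
      unfolding grid_sum_add grid_sum_diff[where g = "\<lambda>s t. \<tau> / 2 * (E t - E s)\<^sup>2"] grid_sum_cmult
      by (intro tendsto_add tendsto_diff tendsto_mult_left riemann_sum_tendsto qvE a E
          grid_sum_increment_tendsto[where X = "\<lambda>u. (E u)\<^sup>2"] E2)
    moreover have "grid_sum (h n) (\<lambda>s t. \<tau> / 2 * ((E t)\<^sup>2 - (E s)\<^sup>2) - \<tau> / 2 * (E t - E s)\<^sup>2 + E s * integral {s..t} E) a
        = grid_sum (h n) (\<lambda>s t. E s * (R t - R s)) a" for n
    proof (rule grid_sum_cong[OF h_pos])
      fix s t :: real assume st: "0 \<le> s" "s < t" "t \<le> a"
      have "R t - R s = \<tau> * (E t - E s) + integral {s..t} E"
        using Eeq[of s] Eeq[of t] st \<open>0 < \<tau>\<close> integral_continuous_on_halfline(3)[OF E, of s t]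
        by (simp add: field_simps)
      show "\<tau> / 2 * ((E t)\<^sup>2 - (E s)\<^sup>2) - \<tau> / 2 * (E t - E s)\<^sup>2 + E s * integral {s..t} E = E s * (R t - R s)"
        unfolding \<open>R t - R s = _\<close> by (simp add: power2_eq_square field_simps)
    qed
    ultimately show ?thesis
      using \<open>E 0 = 0\<close> \<open>0 < \<tau>\<close> by (simp add: X_def power2_eq_square mult.assoc)
  qed
  have Lrat: "L a = m / \<sigma>\<^sup>2 * X a" if a: "a \<in> \<rat>" "0 \<le> a" for a
  proof -
    have "(\<lambda>n. grid_sum (h n) (\<lambda>s t. E s * (1 / S s * (S t - S s))) a) \<longlonglongrightarrow> X a"
      by (rule return_sums_weighted[OF E R Spos lnS log_from_return_sums(2)[OF S Spos R SR qvR] a ER[OF a]])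
    then have "(\<lambda>n. m / \<sigma>\<^sup>2 * grid_sum (h n) (\<lambda>s t. E s * (1 / S s * (S t - S s))) a) \<longlonglongrightarrow> m / \<sigma>\<^sup>2 * X a"
      by (rule tendsto_mult_left)
    then have "(\<lambda>n. grid_sum (h n) (\<lambda>s t. m * (E s / \<sigma>\<^sup>2) * (1 / S s) * (S t - S s)) a) \<longlonglongrightarrow> m / \<sigma>\<^sup>2 * X a"
      unfolding grid_sum_cmult[symmetric] by (simp add: mult.assoc)
    then show ?thesis using SL[OF a] LIMSEQ_unique by blast
  qed
  have Leq: "L u = m / \<sigma>\<^sup>2 * X u" if "0 \<le> u" for u
    by (rule continuous_eq_of_eq_on_rationals[OF L _ Lrat that]) (intro continuous_intros X)
  have qvL: "(\<lambda>n. grid_sum (h n) (\<lambda>s t. (L t - L s)\<^sup>2) a) \<longlonglongrightarrow> m\<^sup>2 / \<sigma>\<^sup>2 * integral {0..a} (\<lambda>u. (E u)\<^sup>2)"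
    if a: "a \<in> \<rat>" "0 \<le> a" for a
  proof -
    \<comment> \<open>\<open>?V\<close> collects the finite-variation part of \<open>X\<close>; the
      quadratic variation of \<open>L\<close> comes from the term in \<open>E\<^sup>2\<close>
      alone.\<close>
    let ?V = "\<lambda>u. integral {0..u} (\<lambda>u. (E u)\<^sup>2 - \<sigma>\<^sup>2 / (2 * \<tau>))"
    have V: "?V u = integral {0..u} (\<lambda>u. (E u)\<^sup>2) - \<sigma>\<^sup>2 / (2 * \<tau>) * u" if "0 \<le> u" for u
      using that by (subst Henstock_Kurzweil_Integration.integral_diff)
        (auto intro: integral_continuous_on_halfline(2)[OF E2])
    have "(\<lambda>n. grid_sum (h n) (\<lambda>s t. (\<tau> / 2 * ((E t)\<^sup>2 - (E s)\<^sup>2))\<^sup>2) a) \<longlonglongrightarrow> (\<tau> / 2)\<^sup>2 * (4 * (\<sigma> / \<tau>)\<^sup>2 * integral {0..a} (\<lambda>u. (E u)\<^sup>2))"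
      unfolding power_mult_distrib[of "\<tau> / 2"] grid_sum_cmult
      by (intro tendsto_mult_left quadratic_variation_square E qvE a)
    moreover have "(\<lambda>n. grid_sum (h n) (\<lambda>s t. (?V t - ?V s)\<^sup>2) a) \<longlonglongrightarrow> 0"
      by (intro zero_quadratic_variation_integral continuous_intros E a)
    ultimately have "(\<lambda>n. grid_sum (h n) (\<lambda>s t. (\<tau> / 2 * ((E t)\<^sup>2 - (E s)\<^sup>2) + (?V t - ?V s))\<^sup>2) a)
        \<longlonglongrightarrow> (\<tau> / 2)\<^sup>2 * (4 * (\<sigma> / \<tau>)\<^sup>2 * integral {0..a} (\<lambda>u. (E u)\<^sup>2))"
      by (rule quadratic_sum_perturb)
    then have "(\<lambda>n. (m / \<sigma>\<^sup>2)\<^sup>2 * grid_sum (h n) (\<lambda>s t. (\<tau> / 2 * ((E t)\<^sup>2 - (E s)\<^sup>2) + (?V t - ?V s))\<^sup>2) a)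
        \<longlonglongrightarrow> (m / \<sigma>\<^sup>2)\<^sup>2 * ((\<tau> / 2)\<^sup>2 * (4 * (\<sigma> / \<tau>)\<^sup>2 * integral {0..a} (\<lambda>u. (E u)\<^sup>2)))"
      by (rule tendsto_mult_left)
    moreover have "(m / \<sigma>\<^sup>2)\<^sup>2 * grid_sum (h n) (\<lambda>s t. (\<tau> / 2 * ((E t)\<^sup>2 - (E s)\<^sup>2) + (?V t - ?V s))\<^sup>2) a
        = grid_sum (h n) (\<lambda>s t. (L t - L s)\<^sup>2) a" for n
      unfolding grid_sum_cmult[symmetric]
    proof (rule grid_sum_cong[OF h_pos])
      fix s t :: real assume st: "0 \<le> s" "s < t"
      then have st': "0 \<le> s" "0 \<le> t" by auto
      have "L t - L s = m / \<sigma>\<^sup>2 * (\<tau> / 2 * ((E t)\<^sup>2 - (E s)\<^sup>2) + (?V t - ?V s))"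
        unfolding V[OF st'(1)] V[OF st'(2)] Leq[OF st'(1)] Leq[OF st'(2)] X_def by (simp add: algebra_simps)
      then show "(m / \<sigma>\<^sup>2)\<^sup>2 * (\<tau> / 2 * ((E t)\<^sup>2 - (E s)\<^sup>2) + (?V t - ?V s))\<^sup>2 = (L t - L s)\<^sup>2"
        by (simp only: power_mult_distrib)
    qed
    moreover have "(m / \<sigma>\<^sup>2)\<^sup>2 * ((\<tau> / 2)\<^sup>2 * (4 * (\<sigma> / \<tau>)\<^sup>2 * integral {0..a} (\<lambda>u. (E u)\<^sup>2)))
        = m\<^sup>2 / \<sigma>\<^sup>2 * integral {0..a} (\<lambda>u. (E u)\<^sup>2)"
      using \<open>0 < \<sigma>\<close> \<open>0 < \<tau>\<close> by (simp add: power2_eq_square field_simps)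
    ultimately show ?thesis by simp
  qed
  have "ln (P t / P 0) = L t - m\<^sup>2 / \<sigma>\<^sup>2 * integral {0..t} (\<lambda>u. (E u)\<^sup>2) / 2"
  proof (rule continuous_eq_of_eq_on_rationals[OF _ _ _ \<open>0 \<le> t\<close>])
    show "continuous_on {0..} (\<lambda>u. ln (P u / P 0))"
      by (intro continuous_intros P) (auto simp: nz)
    show "continuous_on {0..} (\<lambda>t. L t - m\<^sup>2 / \<sigma>\<^sup>2 * integral {0..t} (\<lambda>u. (E u)\<^sup>2) / 2)"
      by (intro continuous_intros L integral_continuous_on_halfline(1) E) auto
  qed (rule log_from_return_sums(1)[OF P Ppos L PL qvL])
  then show ?thesis
    unfolding Leq[OF \<open>0 \<le> t\<close>] X_def by (simp add: algebra_simps power2_eq_square)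
qed

end

section \<open>Quadratic variation of the Wiener process\<close>

context prob_space
begin

text \<open>A diagonal choice: \<open>r n\<close> handles the first \<open>n\<close> indices at
  once, making a deviation beyond \<open>1 / (n + 1)\<close> less probable than
  \<open>(1 / 2) ^ n\<close> for each of them. For a given index only finitely many \<open>n\<close>
  escape this bound, so the Borel-Cantelli lemma applies to every index along the same sequence. The
  sequence need not be strictly increasing; it only has to tend to infinity.\<close>

lemma common_subsequence_AE:
  fixes X :: "'i::countable \<Rightarrow> nat \<Rightarrow> 'a \<Rightarrow> real"
  assumes X[measurable]: "\<And>i n. X i n \<in> borel_measurable M" and Y[measurable]: "\<And>i. Y i \<in> borel_measurable M"
    and conv: "\<And>i. converges_in_probability M (X i) (Y i)"
  obtains r :: "nat \<Rightarrow> nat" where "filterlim r at_top sequentially"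
    "AE \<omega> in M. \<forall>i. (\<lambda>n. X i (r n) \<omega>) \<longlonglongrightarrow> Y i \<omega>"
proof -
  let ?B = "\<lambda>i n k. {\<omega> \<in> space M. 1 / real (Suc n) < \<bar>X i k \<omega> - Y i \<omega>\<bar>}"
  have "\<exists>k\<ge>n. \<forall>i\<in>{i. to_nat i \<le> n}. measure M (?B i n k) < (1 / 2) ^ n" for n :: nat
  proof -
    have fin: "finite {i::'i. to_nat i \<le> n}"
      by (rule finite_imageD[of to_nat]) (auto intro: finite_subset[of _ "{..n}"] inj_onI)
    have "\<forall>\<^sub>F k in sequentially. \<forall>i\<in>{i::'i. to_nat i \<le> n}. measure M (?B i n k) < (1 / 2) ^ n"
    proof (rule eventually_ball_finite[OF fin], intro ballI)
      fix i :: 'i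
      have "(\<lambda>k. measure M (?B i n k)) \<longlonglongrightarrow> 0"
        using conv[of i] unfolding converges_in_probability_def by simp
      then show "\<forall>\<^sub>F k in sequentially. measure M (?B i n k) < (1 / 2) ^ n"
        by (rule order_tendstoD) simp
    qed
    then show ?thesis
      using eventually_conj[OF eventually_ge_at_top[of n]] eventually_happens'[OF sequentially_bot] by fastforce
  qed
  then have "\<exists>r. \<forall>n. n \<le> r n \<and> (\<forall>i\<in>{i. to_nat i \<le> n}. measure M (?B i n (r n)) < (1 / 2) ^ n)"
    by (intro choice allI) blast
  then obtain r where r: "\<And>n. n \<le> r n" "\<And>n i. to_nat (i::'i) \<le> n \<Longrightarrow> measure M (?B i n (r n)) < (1 / 2) ^ n"
    by auto
  have "AE \<omega> in M. (\<lambda>n. X i (r n) \<omega>) \<longlonglongrightarrow> Y i \<omega>" for i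
  proof -
    have "AE \<omega> in M. \<forall>\<^sub>F n in sequentially. \<omega> \<in> space M - ?B i n (r n)"
    proof (rule borel_cantelli_AE1)
      show "summable (\<lambda>n. measure M (?B i n (r n)))"
      proof (rule summable_comparison_test_ev)
        show "\<forall>\<^sub>F n in sequentially. norm (measure M (?B i n (r n))) \<le> (1 / 2) ^ n"
          using eventually_ge_at_top[of "to_nat i"] by eventually_elim (use r(2) in \<open>auto intro: less_imp_le\<close>)
      qed (rule summable_geometric, simp)
    qed (auto simp: emeasure_eq_measure)
    then show ?thesis
    proof eventually_elim
      case (elim \<omega>)
      have "(\<lambda>n. X i (r n) \<omega> - Y i \<omega>) \<longlonglongrightarrow> 0"
      proof (rule Lim_null_comparison)
        show "\<forall>\<^sub>F n in sequentially. norm (X i (r n) \<omega> - Y i \<omega>) \<le> 1 / real (Suc n)"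
          using elim by eventually_elim auto
        show "(\<lambda>n. 1 / real (Suc n)) \<longlonglongrightarrow> 0" by (rule LIMSEQ_Suc[OF lim_1_over_n])
      qed
      then show ?case by (simp add: LIM_zero_iff)
    qed
  qed
  then have "AE \<omega> in M. \<forall>i. (\<lambda>n. X i (r n) \<omega>) \<longlonglongrightarrow> Y i \<omega>" by (simp add: AE_all_countable)
  moreover have "filterlim r at_top sequentially"
    by (rule filterlim_at_top_mono[OF filterlim_ident]) (use r(1) in auto)
  ultimately show ?thesis using that by blast
qed

lemma converges_in_probability_if_L2:
  assumes int: "\<And>n. integrable M (\<lambda>\<omega>. (X n \<omega> - c)\<^sup>2)" and lim: "(\<lambda>n. expectation (\<lambda>\<omega>. (X n \<omega> - c)\<^sup>2)) \<longlonglongrightarrow> 0"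
    and X: "\<And>n. X n \<in> borel_measurable M"
  shows "converges_in_probability M X (\<lambda>_. c)"
  unfolding converges_in_probability_def
proof (intro allI impI)
  fix e :: real assume "e > 0"
  show "(\<lambda>n. measure M {\<omega> \<in> space M. e < \<bar>X n \<omega> - c\<bar>}) \<longlonglongrightarrow> 0"
  proof (rule tendsto_sandwich[OF _ _ tendsto_const])
    show "\<forall>\<^sub>F n in sequentially. measure M {\<omega> \<in> space M. e < \<bar>X n \<omega> - c\<bar>} \<le> expectation (\<lambda>\<omega>. (X n \<omega> - c)\<^sup>2) / e\<^sup>2"
    proof (intro always_eventually allI)
      fix n
      have [measurable]: "X n \<in> borel_measurable M" by (rule X)
      have "measure M {\<omega> \<in> space M. e < \<bar>X n \<omega> - c\<bar>} \<le> measure M {\<omega> \<in> space M. e\<^sup>2 \<le> (X n \<omega> - c)\<^sup>2}"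
      proof (intro finite_measure_mono subsetI)
        fix \<omega> assume "\<omega> \<in> {\<omega> \<in> space M. e < \<bar>X n \<omega> - c\<bar>}"
        then have "\<omega> \<in> space M" "e \<le> \<bar>X n \<omega> - c\<bar>" by auto
        then have "\<omega> \<in> space M" "e\<^sup>2 \<le> (X n \<omega> - c)\<^sup>2" using \<open>e > 0\<close> abs_le_square_iff[of e "X n \<omega> - c"] by auto
        then show "\<omega> \<in> {\<omega> \<in> space M. e\<^sup>2 \<le> (X n \<omega> - c)\<^sup>2}" by simp
      qed measurable
      also have "\<dots> \<le> expectation (\<lambda>\<omega>. (X n \<omega> - c)\<^sup>2) / e\<^sup>2"
        by (rule integral_Markov_inequality_measure[where A = "{}"]) (use int \<open>e > 0\<close> in auto)
      finally show "measure M {\<omega> \<in> space M. e < \<bar>X n \<omega> - c\<bar>} \<le> expectation (\<lambda>\<omega>. (X n \<omega> - c)\<^sup>2) / e\<^sup>2" .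
    qed
    show "(\<lambda>n. expectation (\<lambda>\<omega>. (X n \<omega> - c)\<^sup>2) / e\<^sup>2) \<longlonglongrightarrow> 0"
      using tendsto_divide[OF lim tendsto_const, of "e\<^sup>2"] \<open>e > 0\<close> by simp
  qed auto
qed

end

section \<open>Moments and independence of Wiener increments\<close>

locale wiener = prob_space M for M :: "'a measure" +
  fixes F :: "real \<Rightarrow> 'a measure" and W :: "real \<Rightarrow> 'a \<Rightarrow> real"
  assumes filtration: "filtration_on M F" and wiener: "wiener_process M F W"
begin

lemma adapted: "0 \<le> t \<Longrightarrow> W t \<in> borel_measurable (F t)"
  using wiener by (simp add: wiener_process_def continuous_adapted_def)

lemma adapted_mono:
  assumes "X \<in> borel_measurable (F s)" "s \<le> t"
  shows "X \<in> borel_measurable (F t)"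
proof -
  interpret filtration "space M" F using filtration by (simp add: filtration_on_def)
  have "subalgebra (F t) (F s)" using assms(2) by (simp add: subalgebra_def space_F sets_F_mono)
  then show ?thesis using assms(1) by (rule measurable_from_subalg)
qed

lemma adapted_measurable: "X \<in> borel_measurable (F t) \<Longrightarrow> X \<in> borel_measurable M"
  using filtration by (auto simp: filtration_on_def intro: measurable_from_subalg)

lemma W_measurable: "0 \<le> t \<Longrightarrow> W t \<in> borel_measurable M"
  by (rule adapted_measurable[OF adapted])

lemma increment_distributed:
  "0 \<le> s \<Longrightarrow> s < t \<Longrightarrow> distributed M lborel (\<lambda>\<omega>. W t \<omega> - W s \<omega>) (normal_density 0 (sqrt (t - s)))"
  using wiener by (simp add: wiener_process_def)

text \<open>The fourth moment enters through the squared increments: their variance is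
  \<open>3 * (t - s)\<^sup>2 - (t - s)\<^sup>2\<close>.\<close>

lemma increment_moments:
  assumes "0 \<le> s" "s < t"
  shows "integrable M (\<lambda>\<omega>. (W t \<omega> - W s \<omega>) ^ k)"
    and "expectation (\<lambda>\<omega>. W t \<omega> - W s \<omega>) = 0"
    and "expectation (\<lambda>\<omega>. (W t \<omega> - W s \<omega>)\<^sup>2) = t - s"
    and "expectation (\<lambda>\<omega>. (W t \<omega> - W s \<omega>) ^ 4) = 3 * (t - s)\<^sup>2"
proof -
  note d = increment_distributed[OF assms]
  have pos: "0 < sqrt (t - s)" using assms by simp
  show int: "integrable M (\<lambda>\<omega>. (W t \<omega> - W s \<omega>) ^ k)" for k
    using integrable_normal_moment[OF pos, of 0 k] by (subst distributed_integrable[OF d, symmetric]) auto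
  have E: "expectation (\<lambda>\<omega>. (W t \<omega> - W s \<omega>) ^ k) = (\<integral>x. normal_density 0 (sqrt (t - s)) x * (x - 0) ^ k \<partial>lborel)" for k
    by (subst distributed_integral[OF d]) auto
  show "expectation (\<lambda>\<omega>. W t \<omega> - W s \<omega>) = 0"
    using E[of 1] integral_normal_moment_odd[OF pos, of 0 0] by simp
  show "expectation (\<lambda>\<omega>. (W t \<omega> - W s \<omega>)\<^sup>2) = t - s"
    using E[of 2] integral_normal_moment_even[OF pos, of 0 1] assms by simp
  have "(fact 4 :: real) = 24" by (simp add: fact_numeral)
  then show "expectation (\<lambda>\<omega>. (W t \<omega> - W s \<omega>) ^ 4) = 3 * (t - s)\<^sup>2"
    using E[of 4] integral_normal_moment_even[OF pos, of 0 2] assms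
    by (simp add: power_divide)
qed

text \<open>The definition of a Wiener process gives independence of two families of events. Both
  are closed under intersection, so independence extends to the generated sigma-algebras and
  restricts to the one generated by \<open>X\<close>.\<close>

lemma increment_indep:
  assumes "X \<in> borel_measurable (F s)" "0 \<le> s" "s < t"
  shows "indep_var borel X borel (\<lambda>\<omega>. W t \<omega> - W s \<omega>)"
proof -
  let ?D = "\<lambda>\<omega>. W t \<omega> - W s \<omega>"
  let ?V = "{?D -` A \<inter> space M | A. A \<in> sets borel}"
  have ind: "indep_set (sets (F s)) ?V"
    using wiener assms by (auto simp: wiener_process_def)
  have F: "space (F s) = space M" "sets (F s) \<subseteq> sets M"
    using filtration by (auto simp: filtration_on_def subalgebra_def)
  have "Int_stable ?V"
    unfolding Int_stable_def
  proof safe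
    fix A B :: "real set" assume "A \<in> sets borel" "B \<in> sets borel"
    then show "\<exists>C. ?D -` A \<inter> space M \<inter> (?D -` B \<inter> space M) = ?D -` C \<inter> space M \<and> C \<in> sets borel"
      by (intro exI[of _ "A \<inter> B"]) auto
  qed
  then have ind': "indep_set (sigma_sets (space M) (sets (F s))) (sigma_sets (space M) ?V)"
    by (intro indep_set_sigma_sets[OF ind] sets.Int_stable)
  have "indep_set (sigma_sets (space M) {X -` A \<inter> space M | A. A \<in> sets borel}) (sigma_sets (space M) ?V)"
    unfolding indep_set_def
  proof (rule indep_sets_mono_sets[OF ind'[unfolded indep_set_def]])
    fix b :: bool
    have "{X -` A \<inter> space M | A. A \<in> sets borel} \<subseteq> sets (F s)"
      using measurable_sets[OF assms(1)] F by auto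
    then show "(case b of True \<Rightarrow> sigma_sets (space M) {X -` A \<inter> space M | A. A \<in> sets borel} | False \<Rightarrow> sigma_sets (space M) ?V)
        \<subseteq> (case b of True \<Rightarrow> sigma_sets (space M) (sets (F s)) | False \<Rightarrow> sigma_sets (space M) ?V)"
      by (auto split: bool.split intro: sigma_sets_mono' [THEN subsetD])
  qed
  moreover have "?D \<in> borel_measurable M"
    using assms by (intro borel_measurable_diff W_measurable) auto
  ultimately show ?thesis
    unfolding indep_var_eq using adapted_measurable[OF assms(1)] by auto
qed

text \<open>The earlier centred square is measurable at time \<open>u\<close>, hence independent of
  the later one, whose mean is 0.\<close>

lemma increment_square_orthogonal:
  assumes "0 \<le> s" "s < t" "t \<le> u" "u < v"
  shows "expectation (\<lambda>\<omega>. ((W t \<omega> - W s \<omega>)\<^sup>2 - (t - s)) * ((W v \<omega> - W u \<omega>)\<^sup>2 - (v - u))) = 0"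
    and "integrable M (\<lambda>\<omega>. ((W t \<omega> - W s \<omega>)\<^sup>2 - (t - s)) * ((W v \<omega> - W u \<omega>)\<^sup>2 - (v - u)))"
proof -
  have "(\<lambda>\<omega>. (W t \<omega> - W s \<omega>)\<^sup>2 - (t - s)) \<in> borel_measurable (F u)"
    using assms by (intro borel_measurable_diff borel_measurable_power borel_measurable_const
        adapted_mono[OF adapted, of t u] adapted_mono[OF adapted, of s u]) auto
  then have "indep_var borel (\<lambda>\<omega>. (W t \<omega> - W s \<omega>)\<^sup>2 - (t - s)) borel (\<lambda>\<omega>. W v \<omega> - W u \<omega>)"
    using assms by (intro increment_indep) auto
  from indep_var_compose[OF this, of "\<lambda>x. x" borel "\<lambda>x. x\<^sup>2 - (v - u)" borel]
  have ind: "indep_var borel (\<lambda>\<omega>. (W t \<omega> - W s \<omega>)\<^sup>2 - (t - s)) borel (\<lambda>\<omega>. (W v \<omega> - W u \<omega>)\<^sup>2 - (v - u))"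
    by (simp add: comp_def)
  have int: "integrable M (\<lambda>\<omega>. (W t \<omega> - W s \<omega>)\<^sup>2 - (t - s))" "integrable M (\<lambda>\<omega>. (W v \<omega> - W u \<omega>)\<^sup>2 - (v - u))"
    using assms by (auto intro!: Bochner_Integration.integrable_diff increment_moments(1))
  show "integrable M (\<lambda>\<omega>. ((W t \<omega> - W s \<omega>)\<^sup>2 - (t - s)) * ((W v \<omega> - W u \<omega>)\<^sup>2 - (v - u)))"
    by (rule indep_var_integrable[OF ind int])
  have "expectation (\<lambda>\<omega>. (W v \<omega> - W u \<omega>)\<^sup>2 - (v - u)) = 0"
    using assms increment_moments[of u v] by (subst Bochner_Integration.integral_diff) (auto simp: prob_space)
  then show "expectation (\<lambda>\<omega>. ((W t \<omega> - W s \<omega>)\<^sup>2 - (t - s)) * ((W v \<omega> - W u \<omega>)\<^sup>2 - (v - u))) = 0"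
    by (simp add: indep_var_lebesgue_integral[OF ind int])
qed

text \<open>The cross terms vanish by orthogonality, and each diagonal term is
  \<open>3 * h\<^sup>2 - 2 * h * h + h\<^sup>2\<close>.\<close>

lemma centered_quadratic_sum_second_moment:
  assumes "0 < h"
  defines "D \<equiv> \<lambda>i \<omega>. (W (real (Suc i) * h) \<omega> - W (real i * h) \<omega>)\<^sup>2 - h"
  shows "integrable M (\<lambda>\<omega>. (\<Sum>i<n. D i \<omega>)\<^sup>2)" "expectation (\<lambda>\<omega>. (\<Sum>i<n. D i \<omega>)\<^sup>2) = real n * (2 * h\<^sup>2)"
proof -
  have st: "0 \<le> real i * h" "real i * h < real (Suc i) * h" "real (Suc i) * h - real i * h = h" for i
    using assms(1) by (auto simp: algebra_simps)
  have D4: "(D i \<omega>)\<^sup>2 = (W (real (Suc i) * h) \<omega> - W (real i * h) \<omega>) ^ 4 - 2 * h * (W (real (Suc i) * h) \<omega> - W (real i * h) \<omega>)\<^sup>2 + h\<^sup>2" for i \<omega>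
    unfolding D_def by algebra
  note mom = increment_moments[OF st(1,2), unfolded st(3)]
  have D: "integrable M (\<lambda>\<omega>. (D i \<omega>)\<^sup>2)" "expectation (\<lambda>\<omega>. (D i \<omega>)\<^sup>2) = 2 * h\<^sup>2" for i
  proof -
    show "integrable M (\<lambda>\<omega>. (D i \<omega>)\<^sup>2)"
      unfolding D4 by (intro Bochner_Integration.integrable_add Bochner_Integration.integrable_diff integrable_mult_right mom) auto
    show "expectation (\<lambda>\<omega>. (D i \<omega>)\<^sup>2) = 2 * h\<^sup>2"
      unfolding D4 using mom by (simp add: prob_space) (simp add: power2_eq_square)
  qed
  have orth: "expectation (\<lambda>\<omega>. D i \<omega> * D j \<omega>) = 0" "integrable M (\<lambda>\<omega>. D i \<omega> * D j \<omega>)" if "i < j" for i j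
  proof -
    have "real (Suc i) * h \<le> real j * h" using that assms(1) by (intro mult_right_mono) auto
    note * = increment_square_orthogonal[OF st(1,2) this st(2), unfolded st(3)]
    show "expectation (\<lambda>\<omega>. D i \<omega> * D j \<omega>) = 0" "integrable M (\<lambda>\<omega>. D i \<omega> * D j \<omega>)"
      unfolding D_def by (fact *)+
  qed
  have "integrable M (\<lambda>\<omega>. (\<Sum>i<n. D i \<omega>)\<^sup>2) \<and> expectation (\<lambda>\<omega>. (\<Sum>i<n. D i \<omega>)\<^sup>2) = real n * (2 * h\<^sup>2)"
  proof (induction n)
    case (Suc n)
    have eq: "(\<Sum>i<Suc n. D i \<omega>)\<^sup>2 = (\<Sum>i<n. D i \<omega>)\<^sup>2 + 2 * (\<Sum>i<n. D i \<omega> * D n \<omega>) + (D n \<omega>)\<^sup>2" for \<omega>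
      by (simp add: power2_sum sum_distrib_right)
    have "integrable M (\<lambda>\<omega>. \<Sum>i<n. D i \<omega> * D n \<omega>)"
      by (intro Bochner_Integration.integrable_sum orth) auto
    moreover have "expectation (\<lambda>\<omega>. \<Sum>i<n. D i \<omega> * D n \<omega>) = 0"
      using orth by (subst Bochner_Integration.integral_sum) auto
    ultimately show ?case
      unfolding eq using Suc D by (simp add: algebra_simps)
  qed simp
  then show "integrable M (\<lambda>\<omega>. (\<Sum>i<n. D i \<omega>)\<^sup>2)" "expectation (\<lambda>\<omega>. (\<Sum>i<n. D i \<omega>)\<^sup>2) = real n * (2 * h\<^sup>2)"
    by auto
qed

text \<open>The error is the centred sum plus the missing end piece, which is shorter than
  \<open>h n\<close>. Their mean squares are at most \<open>2 * a * h n\<close> and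
  \<open>(h n)\<^sup>2\<close>; the inequality
  \<open>(x + y)\<^sup>2 \<le> 2 * x\<^sup>2 + 2 * y\<^sup>2\<close> doubles both.\<close>

lemma quadratic_variation_in_probability:
  assumes "shrinking_mesh h" "0 \<le> a"
  shows "converges_in_probability M (\<lambda>n \<omega>. grid_sum (h n) (\<lambda>s t. (W t \<omega> - W s \<omega>)\<^sup>2) a) (\<lambda>_. a)"
proof -
  interpret shrinking_mesh h by fact
  have meas[measurable]: "(\<lambda>\<omega>. grid_sum (h n) (\<lambda>s t. (W t \<omega> - W s \<omega>)\<^sup>2) a) \<in> borel_measurable M" for n
    unfolding grid_sum_def
    using h_pos[of n] by (intro borel_measurable_sum borel_measurable_power borel_measurable_diff W_measurable)
      (auto simp: less_imp_le)
  define N where "N n = nat \<lfloor>a / h n\<rfloor>" for n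
  define D where "D n \<omega> = (\<Sum>i<N n. (W (real (Suc i) * h n) \<omega> - W (real i * h n) \<omega>)\<^sup>2 - h n)" for n \<omega>
  have D: "integrable M (\<lambda>\<omega>. (D n \<omega>)\<^sup>2)" "expectation (\<lambda>\<omega>. (D n \<omega>)\<^sup>2) = real (N n) * (2 * (h n)\<^sup>2)" for n
    unfolding D_def by (rule centered_quadratic_sum_second_moment[OF h_pos])+
  have bound: "(grid_sum (h n) (\<lambda>s t. (W t \<omega> - W s \<omega>)\<^sup>2) a - a)\<^sup>2 \<le> 2 * (D n \<omega>)\<^sup>2 + 2 * (h n)\<^sup>2" for n \<omega>
  proof -
    have "grid_sum (h n) (\<lambda>s t. (W t \<omega> - W s \<omega>)\<^sup>2) a = D n \<omega> + real (N n) * h n"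
      by (simp add: grid_sum_def D_def N_def sum_subtractf)
    then have "(grid_sum (h n) (\<lambda>s t. (W t \<omega> - W s \<omega>)\<^sup>2) a - a)\<^sup>2 = (D n \<omega> + (real (N n) * h n - a))\<^sup>2"
      by (simp add: algebra_simps)
    also have "\<dots> \<le> 2 * (D n \<omega>)\<^sup>2 + 2 * (real (N n) * h n - a)\<^sup>2"
      using sum_squares_bound[of "D n \<omega>" "real (N n) * h n - a"] by (simp add: power2_sum)
    also have "(real (N n) * h n - a)\<^sup>2 \<le> (h n)\<^sup>2"
      using grid_end_bounds[OF h_pos[of n] assms(2)] h_pos[of n]
      unfolding N_def by (intro power2_le_iff_abs_le[THEN iffD2]) auto
    finally show ?thesis by simp
  qed
  have int: "integrable M (\<lambda>\<omega>. (grid_sum (h n) (\<lambda>s t. (W t \<omega> - W s \<omega>)\<^sup>2) a - a)\<^sup>2)" for n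
    by (rule Bochner_Integration.integrable_bound[of M "\<lambda>\<omega>. 2 * (D n \<omega>)\<^sup>2 + 2 * (h n)\<^sup>2"])
       (use bound D in auto)
  show ?thesis
  proof (rule converges_in_probability_if_L2[OF int _ meas], rule tendsto_sandwich[OF _ _ tendsto_const])
    show "\<forall>\<^sub>F n in sequentially. expectation (\<lambda>\<omega>. (grid_sum (h n) (\<lambda>s t. (W t \<omega> - W s \<omega>)\<^sup>2) a - a)\<^sup>2)
        \<le> 4 * a * h n + 2 * (h n)\<^sup>2"
    proof (intro always_eventually allI)
      fix n
      have "expectation (\<lambda>\<omega>. (grid_sum (h n) (\<lambda>s t. (W t \<omega> - W s \<omega>)\<^sup>2) a - a)\<^sup>2) \<le> expectation (\<lambda>\<omega>. 2 * (D n \<omega>)\<^sup>2 + 2 * (h n)\<^sup>2)"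
        by (intro integral_mono int bound Bochner_Integration.integrable_add integrable_mult_right D) auto
      also have "\<dots> = 4 * (real (N n) * h n) * h n + 2 * (h n)\<^sup>2"
        using D[of n] by (simp add: prob_space power2_eq_square)
      also have "\<dots> \<le> 4 * a * h n + 2 * (h n)\<^sup>2"
        using grid_end_bounds(1)[OF h_pos[of n] assms(2)] h_pos[of n]
        unfolding N_def by (intro add_right_mono mult_right_mono mult_left_mono) auto
      finally show "expectation (\<lambda>\<omega>. (grid_sum (h n) (\<lambda>s t. (W t \<omega> - W s \<omega>)\<^sup>2) a - a)\<^sup>2) \<le> 4 * a * h n + 2 * (h n)\<^sup>2" .
    qed
    have "(\<lambda>n. 4 * a * h n + 2 * (h n)\<^sup>2) \<longlonglongrightarrow> 4 * a * 0 + 2 * 0\<^sup>2"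
      by (intro tendsto_intros h_lim)
    then show "(\<lambda>n. 4 * a * h n + 2 * (h n)\<^sup>2) \<longlonglongrightarrow> 0" by simp
  qed auto
qed

lemma W_zero: "AE \<omega> in M. W 0 \<omega> = 0"
  using wiener by (simp add: wiener_process_def)

lemma second_moment:
  assumes "0 \<le> t"
  shows "integrable M (\<lambda>\<omega>. (W t \<omega>)\<^sup>2)" "expectation (\<lambda>\<omega>. (W t \<omega>)\<^sup>2) = t"
    "integrable M (W t)" "expectation (W t) = 0"
proof -
  have W0: "W 0 \<in> borel_measurable M" and Wt: "W t \<in> borel_measurable M"
    using W_measurable assms by auto
  have eq: "AE \<omega> in M. W t \<omega> = W t \<omega> - W 0 \<omega>" using W_zero by eventually_elim simp
  have eq2: "AE \<omega> in M. (W t \<omega>)\<^sup>2 = (W t \<omega> - W 0 \<omega>)\<^sup>2" using W_zero by eventually_elim simp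
  have "integrable M (\<lambda>\<omega>. (W t \<omega> - W 0 \<omega>)\<^sup>2) \<and> expectation (\<lambda>\<omega>. (W t \<omega> - W 0 \<omega>)\<^sup>2) = t \<and>
     integrable M (\<lambda>\<omega>. W t \<omega> - W 0 \<omega>) \<and> expectation (\<lambda>\<omega>. W t \<omega> - W 0 \<omega>) = 0"
  proof (cases "t = 0")
    case False
    then show ?thesis
      using increment_moments[of 0 t] increment_moments(1)[of 0 t 1] assms by auto
  qed simp
  then show "integrable M (\<lambda>\<omega>. (W t \<omega>)\<^sup>2)" "expectation (\<lambda>\<omega>. (W t \<omega>)\<^sup>2) = t"
    "integrable M (W t)" "expectation (W t) = 0"
    using integrable_cong_AE[OF _ _ eq2] integral_cong_AE[OF _ _ eq2]
      integrable_cong_AE[OF _ _ eq] integral_cong_AE[OF _ _ eq] W0 Wt by auto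
qed

text \<open>Polarisation reduces the covariance to the second moments of the two values and of their
  increment.\<close>

lemma covariance:
  assumes "0 \<le> s" "0 \<le> t"
  shows "integrable M (\<lambda>\<omega>. W s \<omega> * W t \<omega>)" "expectation (\<lambda>\<omega>. W s \<omega> * W t \<omega>) = min s t"
proof -
  have *: "integrable M (\<lambda>\<omega>. W s \<omega> * W t \<omega>) \<and> expectation (\<lambda>\<omega>. W s \<omega> * W t \<omega>) = s" if "0 \<le> s" "s < t" for s t
  proof -
    have eq: "W s \<omega> * W t \<omega> = ((W s \<omega>)\<^sup>2 + (W t \<omega>)\<^sup>2 - (W t \<omega> - W s \<omega>)\<^sup>2) / 2" for \<omega>
      by (simp add: power2_eq_square algebra_simps)
    show ?thesis
      unfolding eq using second_moment[of s] second_moment[of t] increment_moments[of s t] that by simp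
  qed
  have "integrable M (\<lambda>\<omega>. W s \<omega> * W t \<omega>) \<and> expectation (\<lambda>\<omega>. W s \<omega> * W t \<omega>) = min s t"
    using *[of s t] *[of t s] second_moment[of s] assms
    by (cases s t rule: linorder_cases) (auto simp: mult.commute power2_eq_square)
  then show "integrable M (\<lambda>\<omega>. W s \<omega> * W t \<omega>)" "expectation (\<lambda>\<omega>. W s \<omega> * W t \<omega>) = min s t" by auto
qed

end

section \<open>Wiener integrals of differentiable kernels\<close>

text \<open>Expand the nonnegative integral of \<open>(f u - c)\<^sup>2\<close> with
  \<open>c\<close> the mean value of \<open>f\<close>.\<close>

lemma integral_square_le:
  fixes f :: "real \<Rightarrow> real"
  assumes f: "continuous_on {0..t} f" and "0 \<le> t"
  shows "(integral {0..t} f)\<^sup>2 \<le> t * integral {0..t} (\<lambda>u. (f u)\<^sup>2)"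
proof (cases "t = 0")
  case False
  then have "t > 0" using assms by simp
  define c where "c = integral {0..t} f / t"
  have int: "f integrable_on {0..t}" "(\<lambda>u. (f u)\<^sup>2) integrable_on {0..t}"
    by (auto intro!: integrable_continuous_real continuous_intros f)
  have "((\<lambda>u. (f u)\<^sup>2 - 2 * c * f u + c\<^sup>2) has_integral
      (integral {0..t} (\<lambda>u. (f u)\<^sup>2) - 2 * c * integral {0..t} f + c\<^sup>2 * t)) {0..t}"
    using has_integral_add[OF has_integral_diff[OF integrable_integral[OF int(2)]
          has_integral_mult_right[OF integrable_integral[OF int(1)], of "2 * c"]]
        has_integral_const_real[of "c\<^sup>2" 0 t]] \<open>0 \<le> t\<close> by (simp add: mult.commute)
  moreover have "0 \<le> (f u)\<^sup>2 - 2 * c * f u + c\<^sup>2" for u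
    using zero_le_power2[of "f u - c"] by (simp add: power2_diff algebra_simps)
  ultimately have "0 \<le> integral {0..t} (\<lambda>u. (f u)\<^sup>2) - 2 * c * integral {0..t} f + c\<^sup>2 * t"
    by (rule has_integral_nonneg)
  then show ?thesis using \<open>t > 0\<close> by (simp add: c_def power2_eq_square field_simps)
qed simp

section \<open>Exchanging expectation and time integral\<close>

context prob_space
begin

text \<open>By path continuity the process is the limit of its values at the last grid point before
  \<open>u\<close>. These step processes are jointly measurable, since countably many random
  variables are selected by a measurable index. Negative times are mapped to 0 by
  \<open>max\<close>, to have a function on the whole line.\<close>

lemma continuous_process_jointly_measurable:
  fixes Y :: "real \<Rightarrow> 'a \<Rightarrow> real"
  assumes Y: "\<And>u. 0 \<le> u \<Longrightarrow> Y u \<in> borel_measurable M"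
    and cont: "\<And>\<omega>. \<omega> \<in> space M \<Longrightarrow> continuous_on {0..} (\<lambda>u. Y u \<omega>)"
  shows "(\<lambda>(u, \<omega>). Y (max 0 u) \<omega>) \<in> borel_measurable (lborel \<Otimes>\<^sub>M M)"
proof -
  let ?h = "\<lambda>n. 1 / real (Suc n)"
  interpret shrinking_mesh ?h
    by unfold_locales (simp, rule LIMSEQ_Suc[OF lim_1_over_n])
  let ?A = "\<lambda>n p. Y (real (nat \<lfloor>fst p / ?h n\<rfloor>) * ?h n) (snd p)"
  have "?A n \<in> borel_measurable (lborel \<Otimes>\<^sub>M M)" for n
  proof (rule measurable_compose_countable[of "\<lambda>i p. Y (real i * ?h n) (snd p)" _ _ "\<lambda>p. nat \<lfloor>fst p / ?h n\<rfloor>"])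
    show "(\<lambda>p. Y (real i * ?h n) (snd p)) \<in> borel_measurable (lborel \<Otimes>\<^sub>M M)" for i :: nat
      by (rule measurable_compose[OF measurable_snd Y]) simp
    show "(\<lambda>p. nat \<lfloor>fst p / ?h n\<rfloor>) \<in> measurable (lborel \<Otimes>\<^sub>M M) (count_space UNIV)"
      by measurable
  qed
  moreover have "(\<lambda>n. ?A n p) \<longlonglongrightarrow> Y (max 0 (fst p)) (snd p)" if "p \<in> space (lborel \<Otimes>\<^sub>M M)" for p
  proof (cases "0 \<le> fst p")
    case True
    then show ?thesis
      using value_at_grid_end_tendsto[OF cont[of "snd p"] True] that by (simp add: space_pair_measure mem_Times_iff)
  next
    case False
    then have "fst p * (1 + real n) \<le> 0" for n by (simp add: mult_nonpos_nonneg)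
    then have "nat \<lfloor>fst p / ?h n\<rfloor> = 0" for n by (smt (verit) divide_divide_eq_right div_by_1 floor_less_one nat_le_0 of_nat_Suc zle_iff_zadd floor_le_zero floor_mono)
    then show ?thesis using False by simp
  qed
  ultimately have "(\<lambda>p. Y (max 0 (fst p)) (snd p)) \<in> borel_measurable (lborel \<Otimes>\<^sub>M M)"
    by (rule borel_measurable_LIMSEQ_real[rotated]) auto
  then show ?thesis by (simp add: case_prod_beta')
qed

text \<open>Fubini's theorem on the product with Lebesgue measure. The constant \<open>K\<close>
  bounds the inner integrals of the absolute value uniformly in time, so integrability over the
  bounded interval follows.\<close>

lemma expectation_integral:
  fixes Y :: "real \<Rightarrow> 'a \<Rightarrow> real"
  assumes Y: "\<And>u. 0 \<le> u \<Longrightarrow> Y u \<in> borel_measurable M"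
    and cont: "\<And>\<omega>. \<omega> \<in> space M \<Longrightarrow> continuous_on {0..} (\<lambda>u. Y u \<omega>)"
    and int: "\<And>u. 0 \<le> u \<Longrightarrow> u \<le> T \<Longrightarrow> integrable M (Y u)"
    and bound: "\<And>u. 0 \<le> u \<Longrightarrow> u \<le> T \<Longrightarrow> expectation (\<lambda>\<omega>. \<bar>Y u \<omega>\<bar>) \<le> K"
  shows "integrable M (\<lambda>\<omega>. integral {0..T} (\<lambda>u. Y u \<omega>))"
    and "expectation (\<lambda>\<omega>. integral {0..T} (\<lambda>u. Y u \<omega>)) = integral {0..T} (\<lambda>u. expectation (Y u))"
    and "(\<lambda>u. expectation (Y u)) integrable_on {0..T}"
proof -
  interpret P: pair_sigma_finite lborel M ..
  let ?f = "\<lambda>u \<omega>. indicator {0..T} u *\<^sub>R Y (max 0 u) \<omega>"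
  have Ym: "(\<lambda>p. Y (max 0 (fst p)) (snd p)) \<in> borel_measurable (lborel \<Otimes>\<^sub>M M)"
    using continuous_process_jointly_measurable[OF Y cont] by (simp add: case_prod_beta')
  have fm: "case_prod ?f \<in> borel_measurable (lborel \<Otimes>\<^sub>M M)"
    unfolding case_prod_beta' by (intro borel_measurable_scaleR Ym) measurable
  have f_in: "integrable M (?f u)" for u
    using int[of u] by (cases "u \<in> {0..T}") auto
  have "integrable (lborel \<Otimes>\<^sub>M M) (case_prod ?f)"
  proof (rule P.Fubini_integrable[OF fm])
    show "AE u in lborel. integrable M (\<lambda>\<omega>. case_prod ?f (u, \<omega>))" using f_in by simp
    have m: "(\<lambda>u. \<integral>\<omega>. norm (case_prod ?f (u, \<omega>)) \<partial>M) \<in> borel_measurable lborel"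
      using fm by (intro borel_measurable_lebesgue_integral) simp
    show "integrable lborel (\<lambda>u. \<integral>\<omega>. norm (case_prod ?f (u, \<omega>)) \<partial>M)"
    proof (rule Bochner_Integration.integrable_bound[OF _ m])
      show "integrable lborel (\<lambda>u. indicator {0..T} u *\<^sub>R K)"
        using borel_integrable_atLeastAtMost'[of 0 T "\<lambda>_. K"] by (simp add: set_integrable_def)
      show "AE u in lborel. norm (\<integral>\<omega>. norm (case_prod ?f (u, \<omega>)) \<partial>M) \<le> norm (indicator {0..T} u *\<^sub>R K)"
      proof (intro AE_I2)
        fix u :: real
        show "norm (\<integral>\<omega>. norm (case_prod ?f (u, \<omega>)) \<partial>M) \<le> norm (indicator {0..T} u *\<^sub>R K)"
        proof (cases "u \<in> {0..T}")
          case True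
          then have "0 \<le> expectation (\<lambda>\<omega>. \<bar>Y u \<omega>\<bar>)" by simp
          then show ?thesis using True bound[of u] by (simp del: integral_nonneg)
        qed simp
      qed
    qed
  qed
  note F = this
  have inner: "(\<integral>u. ?f u \<omega> \<partial>lborel) = integral {0..T} (\<lambda>u. Y u \<omega>)" if "\<omega> \<in> space M" for \<omega>
  proof -
    have "(\<integral>u. ?f u \<omega> \<partial>lborel) = (LINT u:{0..T}|lborel. Y u \<omega>)"
      unfolding set_lebesgue_integral_def by (intro Bochner_Integration.integral_cong) (auto split: split_indicator)
    also have "\<dots> = integral {0..T} (\<lambda>u. Y u \<omega>)"
      by (intro set_borel_integral_eq_integral borel_integrable_atLeastAtMost' continuous_on_subset[OF cont[OF that]]) auto
    finally show ?thesis .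
  qed
  have outer: "(\<integral>\<omega>. ?f u \<omega> \<partial>M) = indicator {0..T} u *\<^sub>R expectation (Y u)" for u
    by (cases "u \<in> {0..T}") auto
  have set_int: "set_integrable lborel {0..T} (\<lambda>u. expectation (Y u))"
    using P.integrable_fst[OF F] unfolding outer by (simp add: set_integrable_def)
  show "(\<lambda>u. expectation (Y u)) integrable_on {0..T}"
    by (rule set_borel_integral_eq_integral(1)[OF set_int])
  show "integrable M (\<lambda>\<omega>. integral {0..T} (\<lambda>u. Y u \<omega>))"
  proof -
    have "integrable M (\<lambda>\<omega>. \<integral>u. ?f u \<omega> \<partial>lborel) \<longleftrightarrow> integrable M (\<lambda>\<omega>. integral {0..T} (\<lambda>u. Y u \<omega>))"
      by (intro Bochner_Integration.integrable_cong refl inner)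
    then show ?thesis using P.integrable_snd[OF F] by simp
  qed
  have "expectation (\<lambda>\<omega>. integral {0..T} (\<lambda>u. Y u \<omega>)) = (\<integral>\<omega>. (\<integral>u. ?f u \<omega> \<partial>lborel) \<partial>M)"
    by (rule Bochner_Integration.integral_cong[OF refl inner[symmetric]])
  also have "\<dots> = (\<integral>u. (\<integral>\<omega>. ?f u \<omega> \<partial>M) \<partial>lborel)"
    by (rule P.Fubini_integral[OF F])
  also have "\<dots> = (LINT u:{0..T}|lborel. expectation (Y u))"
    unfolding outer set_lebesgue_integral_def ..
  also have "\<dots> = integral {0..T} (\<lambda>u. expectation (Y u))"
    by (rule set_borel_integral_eq_integral(2)[OF set_int])
  finally show "expectation (\<lambda>\<omega>. integral {0..T} (\<lambda>u. Y u \<omega>)) = integral {0..T} (\<lambda>u. expectation (Y u))" .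
qed

lemma integrable_product_if_L2:
  fixes X Y :: "'a \<Rightarrow> real"
  assumes "X \<in> borel_measurable M" "Y \<in> borel_measurable M"
    and "integrable M (\<lambda>\<omega>. (X \<omega>)\<^sup>2)" "integrable M (\<lambda>\<omega>. (Y \<omega>)\<^sup>2)"
  shows "integrable M (\<lambda>\<omega>. X \<omega> * Y \<omega>)"
    and "expectation (\<lambda>\<omega>. \<bar>X \<omega> * Y \<omega>\<bar>) \<le> expectation (\<lambda>\<omega>. (X \<omega>)\<^sup>2) + expectation (\<lambda>\<omega>. (Y \<omega>)\<^sup>2)"
proof -
  have b: "\<bar>X \<omega> * Y \<omega>\<bar> \<le> (X \<omega>)\<^sup>2 + (Y \<omega>)\<^sup>2" for \<omega>
    using sum_squares_bound[of "\<bar>X \<omega>\<bar>" "\<bar>Y \<omega>\<bar>"] by (simp add: abs_mult) (use zero_le_mult_iff[of "\<bar>X \<omega>\<bar>" "\<bar>Y \<omega>\<bar>"] in linarith)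
  show int: "integrable M (\<lambda>\<omega>. X \<omega> * Y \<omega>)"
    by (rule Bochner_Integration.integrable_bound[of M "\<lambda>\<omega>. (X \<omega>)\<^sup>2 + (Y \<omega>)\<^sup>2"]) (use assms b in auto)
  have "expectation (\<lambda>\<omega>. \<bar>X \<omega> * Y \<omega>\<bar>) \<le> expectation (\<lambda>\<omega>. (X \<omega>)\<^sup>2 + (Y \<omega>)\<^sup>2)"
    by (intro integral_mono integrable_abs int Bochner_Integration.integrable_add assms b)
  then show "expectation (\<lambda>\<omega>. \<bar>X \<omega> * Y \<omega>\<bar>) \<le> expectation (\<lambda>\<omega>. (X \<omega>)\<^sup>2) + expectation (\<lambda>\<omega>. (Y \<omega>)\<^sup>2)"
    using assms by simp
qed

end

section \<open>Wiener integrals and their isometry\<close>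

text \<open>Second moments of Wiener integrals depend only on the covariance. Continuity of every
  path, not just almost every one, makes the pathwise time integrals meaningful everywhere; a
  modification on a null set provides it.\<close>

locale wiener_covariance = prob_space M for M :: "'a measure" +
  fixes W :: "real \<Rightarrow> 'a \<Rightarrow> real"
  assumes W_meas: "\<And>u. 0 \<le> u \<Longrightarrow> W u \<in> borel_measurable M"
    and W_cont: "\<And>\<omega>. \<omega> \<in> space M \<Longrightarrow> continuous_on {0..} (\<lambda>u. W u \<omega>)"
    and W_int: "\<And>s t. 0 \<le> s \<Longrightarrow> 0 \<le> t \<Longrightarrow> integrable M (\<lambda>\<omega>. W s \<omega> * W t \<omega>)"
    and W_cov: "\<And>s t. 0 \<le> s \<Longrightarrow> 0 \<le> t \<Longrightarrow> expectation (\<lambda>\<omega>. W s \<omega> * W t \<omega>) = min s t"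
begin

lemma W_square: "0 \<le> u \<Longrightarrow> integrable M (\<lambda>\<omega>. (W u \<omega>)\<^sup>2)" "0 \<le> u \<Longrightarrow> expectation (\<lambda>\<omega>. (W u \<omega>)\<^sup>2) = u"
  using W_int[of u u] W_cov[of u u] by (simp_all add: power2_eq_square)

text \<open>Integration by parts turns the Wiener integral of a differentiable deterministic \<open>g\<close> with
  derivative \<open>g'\<close> into this pathwise expression.\<close>

definition wiener_integral :: "(real \<Rightarrow> real) \<Rightarrow> (real \<Rightarrow> real) \<Rightarrow> real \<Rightarrow> 'a \<Rightarrow> real" where
  "wiener_integral g g' t \<omega> = g t * W t \<omega> - integral {0..t} (\<lambda>u. g' u * W u \<omega>)"

context
  fixes g g' :: "real \<Rightarrow> real" and t :: real
  assumes g': "continuous_on {0..} g'" and t: "0 \<le> t"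
begin

lemma W_integral_pairing:
  assumes Z: "Z \<in> borel_measurable M" "integrable M (\<lambda>\<omega>. (Z \<omega>)\<^sup>2)"
  shows "integrable M (\<lambda>\<omega>. Z \<omega> * integral {0..t} (\<lambda>u. g' u * W u \<omega>))"
    and "expectation (\<lambda>\<omega>. Z \<omega> * integral {0..t} (\<lambda>u. g' u * W u \<omega>)) = integral {0..t} (\<lambda>u. g' u * expectation (\<lambda>\<omega>. Z \<omega> * W u \<omega>))"
proof -
  obtain K where K: "K > 0" "\<And>u. 0 \<le> u \<Longrightarrow> u \<le> t \<Longrightarrow> \<bar>g' u\<bar> \<le> K"
    using continuous_bounded_on_interval[OF g'] by metis
  let ?Y = "\<lambda>u \<omega>. g' u * (Z \<omega> * W u \<omega>)"
  have eq: "Z \<omega> * integral {0..t} (\<lambda>u. g' u * W u \<omega>) = integral {0..t} (\<lambda>u. ?Y u \<omega>)" for \<omega>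
    by (simp add: mult.left_commute flip: Henstock_Kurzweil_Integration.integral_mult_right)
  have meas: "?Y u \<in> borel_measurable M" if "0 \<le> u" for u
    using W_meas[OF that] Z(1) by (intro borel_measurable_times borel_measurable_const)
  have cont: "continuous_on {0..} (\<lambda>u. ?Y u \<omega>)" if "\<omega> \<in> space M" for \<omega>
    by (intro continuous_intros g' W_cont that)
  have int: "integrable M (?Y u)" if "0 \<le> u" "u \<le> t" for u
    by (intro integrable_mult_right integrable_product_if_L2 Z W_meas W_square that)
  have bound: "expectation (\<lambda>\<omega>. \<bar>?Y u \<omega>\<bar>) \<le> K * (expectation (\<lambda>\<omega>. (Z \<omega>)\<^sup>2) + t)" if "0 \<le> u" "u \<le> t" for u
  proof -
    have "expectation (\<lambda>\<omega>. \<bar>Z \<omega> * W u \<omega>\<bar>) \<le> expectation (\<lambda>\<omega>. (Z \<omega>)\<^sup>2) + t"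
      using integrable_product_if_L2(2)[OF Z(1) W_meas[OF that(1)] Z(2) W_square(1)[OF that(1)]] W_square(2)[OF that(1)] that
      by simp
    then show ?thesis
      unfolding abs_mult[of "g' u"] using K(1) K(2)[OF that]
      by (simp del: abs_mult_self) (intro mult_mono, auto)
  qed
  show "integrable M (\<lambda>\<omega>. Z \<omega> * integral {0..t} (\<lambda>u. g' u * W u \<omega>))"
    unfolding eq by (rule expectation_integral(1)[OF meas cont int bound])
  show "expectation (\<lambda>\<omega>. Z \<omega> * integral {0..t} (\<lambda>u. g' u * W u \<omega>)) = integral {0..t} (\<lambda>u. g' u * expectation (\<lambda>\<omega>. Z \<omega> * W u \<omega>))"
    unfolding eq by (subst expectation_integral(2)[OF meas cont int bound]) simp_all
qed

lemma W_integral_measurable: "(\<lambda>\<omega>. integral {0..t} (\<lambda>u. g' u * W u \<omega>)) \<in> borel_measurable M"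
  using W_integral_pairing(1)[of "\<lambda>_. 1"] by (simp add: borel_measurable_integrable)

lemma W_integral_square: "integrable M (\<lambda>\<omega>. (integral {0..t} (\<lambda>u. g' u * W u \<omega>))\<^sup>2)"
proof -
  obtain K where K: "K > 0" "\<And>u. 0 \<le> u \<Longrightarrow> u \<le> t \<Longrightarrow> \<bar>g' u\<bar> \<le> K"
    using continuous_bounded_on_interval[OF g'] by metis
  let ?Y = "\<lambda>u \<omega>. (g' u * W u \<omega>)\<^sup>2"
  have meas: "?Y u \<in> borel_measurable M" if "0 \<le> u" for u
    using W_meas[OF that] by (intro borel_measurable_power borel_measurable_times borel_measurable_const)
  have cont: "continuous_on {0..} (\<lambda>u. ?Y u \<omega>)" if "\<omega> \<in> space M" for \<omega>
    by (intro continuous_intros g' W_cont that)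
  have int: "integrable M (?Y u)" if "0 \<le> u" "u \<le> t" for u
    unfolding power_mult_distrib by (intro integrable_mult_right W_square that)
  have bound: "expectation (\<lambda>\<omega>. \<bar>?Y u \<omega>\<bar>) \<le> K\<^sup>2 * t" if "0 \<le> u" "u \<le> t" for u
  proof -
    have "(g' u)\<^sup>2 \<le> K\<^sup>2" using K(1) K(2)[OF that] abs_le_square_iff[of "g' u" K] by simp
    then show ?thesis
      using W_square[OF that(1)] that K(1) by (simp add: power_mult_distrib mult_mono)
  qed
  have "integrable M (\<lambda>\<omega>. t * integral {0..t} (\<lambda>u. ?Y u \<omega>))"
    by (intro integrable_mult_right expectation_integral(1)[OF meas cont int bound])
  then show ?thesis
  proof (rule Bochner_Integration.integrable_bound)
    show "(\<lambda>\<omega>. (integral {0..t} (\<lambda>u. g' u * W u \<omega>))\<^sup>2) \<in> borel_measurable M"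
      by (intro borel_measurable_power W_integral_measurable)
    show "AE \<omega> in M. norm ((integral {0..t} (\<lambda>u. g' u * W u \<omega>))\<^sup>2) \<le> norm (t * integral {0..t} (\<lambda>u. ?Y u \<omega>))"
    proof (rule AE_I2)
      fix \<omega> assume "\<omega> \<in> space M"
      then have "continuous_on {0..} (\<lambda>u. g' u * W u \<omega>)" by (intro continuous_intros g' W_cont)
      then have "continuous_on {0..t} (\<lambda>u. g' u * W u \<omega>)" by (rule continuous_on_subset) auto
      from integral_square_le[OF this t]
      show "norm ((integral {0..t} (\<lambda>u. g' u * W u \<omega>))\<^sup>2) \<le> norm (t * integral {0..t} (\<lambda>u. ?Y u \<omega>))"
        by simp
    qed
  qed
qed

lemma wiener_integral_measurable: "wiener_integral g g' t \<in> borel_measurable M"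
  unfolding wiener_integral_def
  using t by (intro borel_measurable_diff borel_measurable_times borel_measurable_const W_meas W_integral_measurable)

lemma wiener_integral_square: "integrable M (\<lambda>\<omega>. (wiener_integral g g' t \<omega>)\<^sup>2)"
proof -
  have [measurable]: "(\<lambda>\<omega>. integral {0..t} (\<lambda>u. g' u * W u \<omega>)) \<in> borel_measurable M" "W t \<in> borel_measurable M"
    using W_integral_measurable W_meas[OF t] by auto
  have "integrable M (\<lambda>\<omega>. W t \<omega> * integral {0..t} (\<lambda>u. g' u * W u \<omega>))"
    by (intro integrable_product_if_L2 W_meas W_square t W_integral_measurable W_integral_square)
  then have "integrable M (\<lambda>\<omega>. (g t)\<^sup>2 * (W t \<omega>)\<^sup>2 + (integral {0..t} (\<lambda>u. g' u * W u \<omega>))\<^sup>2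
      - 2 * g t * (W t \<omega> * integral {0..t} (\<lambda>u. g' u * W u \<omega>)))"
    by (intro Bochner_Integration.integrable_diff Bochner_Integration.integrable_add integrable_mult_right W_square W_integral_square t)
  then show ?thesis by (simp add: wiener_integral_def power2_diff power_mult_distrib mult.assoc)
qed

text \<open>The pairing depends on \<open>Z\<close> only through the function
  \<open>u \<mapsto> E[Z W u]\<close>, and the right-hand side is the integral of \<open>g\<close>
  against that function after integration by parts. Choosing \<open>Z\<close> suitably gives all the
  second moments needed.\<close>

lemma wiener_integral_pairing:
  assumes Z: "Z \<in> borel_measurable M" "integrable M (\<lambda>\<omega>. (Z \<omega>)\<^sup>2)"
  shows "expectation (\<lambda>\<omega>. Z \<omega> * wiener_integral g g' t \<omega>) =
      g t * expectation (\<lambda>\<omega>. Z \<omega> * W t \<omega>) - integral {0..t} (\<lambda>u. g' u * expectation (\<lambda>\<omega>. Z \<omega> * W u \<omega>))"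
proof -
  have 1: "integrable M (\<lambda>\<omega>. Z \<omega> * W t \<omega>)"
    by (intro integrable_product_if_L2 Z W_meas W_square t)
  have "expectation (\<lambda>\<omega>. Z \<omega> * wiener_integral g g' t \<omega>) =
      expectation (\<lambda>\<omega>. g t * (Z \<omega> * W t \<omega>) - Z \<omega> * integral {0..t} (\<lambda>u. g' u * W u \<omega>))"
    by (simp add: wiener_integral_def algebra_simps)
  also have "\<dots> = g t * expectation (\<lambda>\<omega>. Z \<omega> * W t \<omega>) - expectation (\<lambda>\<omega>. Z \<omega> * integral {0..t} (\<lambda>u. g' u * W u \<omega>))"
    using 1 W_integral_pairing(1)[OF Z] by simp
  finally show ?thesis by (simp add: W_integral_pairing(2)[OF Z])
qed

text \<open>The pairing is used twice. With \<open>Z\<close> a value of \<open>W\<close> it gives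
  the covariance of the integral with \<open>W v\<close> as \<open>G v\<close>; with
  \<open>Z\<close> the integral itself it gives \<open>g t * G t\<close> minus the integral of
  \<open>g' * G\<close>, which is the integral of \<open>g\<^sup>2\<close> by parts.\<close>

lemma wiener_isometry:
  assumes deriv: "\<And>u. (g has_real_derivative g' u) (at u)"
  shows "expectation (\<lambda>\<omega>. (wiener_integral g g' t \<omega>)\<^sup>2) = integral {0..t} (\<lambda>u. (g u)\<^sup>2)"
proof -
  let ?X = "wiener_integral g g' t"
  define G where "G u = integral {0..u} g" for u
  have g: "continuous_on {0..} g"
    using deriv by (meson DERIV_continuous continuous_at_imp_continuous_on)
  have G: "(G has_real_derivative g u) (at u within {0..t})" if "u \<in> {0..t}" for u
    unfolding G_def by (rule integral_has_real_derivative[OF continuous_on_subset[OF g] that]) auto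
  have gd: "(g has_real_derivative g' u) (at u within A)" for u A
    by (rule has_field_derivative_at_within[OF deriv])
  have idd: "((\<lambda>u. u) has_real_derivative 1) (at u within A)" for u :: real and A
    by (rule DERIV_ident)
  have XW: "expectation (\<lambda>\<omega>. ?X \<omega> * W v \<omega>) = G v" if v: "0 \<le> v" "v \<le> t" for v
  proof -
    \<comment> \<open>The covariance \<open>min v u\<close> has a kink at \<open>v\<close>, so the
      integral is split there: \<open>u\<close> on the left piece, the constant \<open>v\<close> on
      the right one.\<close>
    have "((\<lambda>u. g' u * u) has_integral ((v * g v - G v) - (0 * g 0 - G 0))) {0..v}"
    proof (rule fundamental_theorem_of_calculus[OF v(1)])
      fix u assume u: "u \<in> {0..v}"
      have "((\<lambda>u. u * g u - G u) has_real_derivative (1 * g u + g' u * u - g u)) (at u within {0..v})"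
        by (intro DERIV_diff DERIV_mult idd gd DERIV_subset[OF G]) (use u v in auto)
      then show "((\<lambda>u. u * g u - G u) has_vector_derivative g' u * u) (at u within {0..v})"
        by (simp add: has_real_derivative_iff_has_vector_derivative)
    qed
    then have 1: "((\<lambda>u. g' u * min v u) has_integral (v * g v - G v)) {0..v}"
      by (rule has_integral_eq_rhs[OF has_integral_eq[rotated]]) (auto simp: G_def)
    have "((\<lambda>u. g' u * v) has_integral (g t * v - g v * v)) {v..t}"
    proof (rule fundamental_theorem_of_calculus[OF v(2)])
      fix u assume u: "u \<in> {v..t}"
      have "((\<lambda>u. g u * v) has_real_derivative (g' u * v)) (at u within {v..t})"
        by (intro DERIV_cmult_right gd)
      then show "((\<lambda>u. g u * v) has_vector_derivative g' u * v) (at u within {v..t})"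
        by (simp add: has_real_derivative_iff_has_vector_derivative)
    qed
    then have 2: "((\<lambda>u. g' u * min v u) has_integral (g t * v - g v * v)) {v..t}"
      by (rule has_integral_eq[rotated]) auto
    have "integral {0..t} (\<lambda>u. g' u * min v u) = g t * v - G v"
      using has_integral_combine[OF v 1 2] by (simp add: integral_unique algebra_simps)
    moreover have "integral {0..t} (\<lambda>u. g' u * expectation (\<lambda>\<omega>. W v \<omega> * W u \<omega>)) = integral {0..t} (\<lambda>u. g' u * min v u)"
      by (rule Henstock_Kurzweil_Integration.integral_cong) (use v in \<open>auto simp: W_cov\<close>)
    ultimately show ?thesis
      using wiener_integral_pairing[OF W_meas[OF v(1)] W_square(1)[OF v(1)]] v t
      by (simp add: W_cov mult.commute)
  qed
  have "((\<lambda>u. g' u * G u + (g u)\<^sup>2) has_integral (g t * G t - g 0 * G 0)) {0..t}"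
  proof (rule fundamental_theorem_of_calculus[OF t])
    fix u assume u: "u \<in> {0..t}"
    have "((\<lambda>u. g u * G u) has_real_derivative (g' u * G u + g u * g u)) (at u within {0..t})"
      using DERIV_mult[OF gd G[OF u]] by (simp add: add.commute mult.commute)
    then show "((\<lambda>u. g u * G u) has_vector_derivative g' u * G u + (g u)\<^sup>2) (at u within {0..t})"
      by (simp add: has_real_derivative_iff_has_vector_derivative power2_eq_square)
  qed
  then have ibp: "((\<lambda>u. g' u * G u + (g u)\<^sup>2) has_integral (g t * G t)) {0..t}" by (simp add: G_def)
  have g2: "((\<lambda>u. (g u)\<^sup>2) has_integral integral {0..t} (\<lambda>u. (g u)\<^sup>2)) {0..t}"
    by (intro integrable_integral integrable_continuous_real continuous_intros continuous_on_subset[OF g]) auto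
  have ibp': "integral {0..t} (\<lambda>u. g' u * G u) = g t * G t - integral {0..t} (\<lambda>u. (g u)\<^sup>2)"
    using has_integral_diff[OF ibp g2] by (simp add: integral_unique)
  have "expectation (\<lambda>\<omega>. (?X \<omega>)\<^sup>2) = g t * expectation (\<lambda>\<omega>. ?X \<omega> * W t \<omega>) - integral {0..t} (\<lambda>u. g' u * expectation (\<lambda>\<omega>. ?X \<omega> * W u \<omega>))"
    using wiener_integral_pairing[OF wiener_integral_measurable wiener_integral_square] by (simp add: power2_eq_square)
  also have "integral {0..t} (\<lambda>u. g' u * expectation (\<lambda>\<omega>. ?X \<omega> * W u \<omega>)) = integral {0..t} (\<lambda>u. g' u * G u)"
    by (rule Henstock_Kurzweil_Integration.integral_cong) (auto simp: XW)
  finally show ?thesis using XW[OF t] ibp' by simp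
qed

end

end

text \<open>Two applications of the pairing: first the integral against \<open>V\<close> is
  uncorrelated with every value of \<open>W\<close>, then with the integral against
  \<open>W\<close>.\<close>

lemma wiener_integrals_uncorrelated:
  assumes "wiener_covariance M V" "wiener_covariance M W"
    and cross: "\<And>s t. 0 \<le> s \<Longrightarrow> 0 \<le> t \<Longrightarrow> (\<integral>\<omega>. V s \<omega> * W t \<omega> \<partial>M) = 0"
    and f': "continuous_on {0..} f'" and g': "continuous_on {0..} g'" and "0 \<le> t"
  shows "(\<integral>\<omega>. wiener_covariance.wiener_integral V f f' t \<omega> * wiener_covariance.wiener_integral W g g' t \<omega> \<partial>M) = 0"
proof -
  interpret V: wiener_covariance M V by fact
  interpret W: wiener_covariance M W by fact
  have XW: "(\<integral>\<omega>. V.wiener_integral f f' t \<omega> * W u \<omega> \<partial>M) = 0" if "0 \<le> u" for u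
  proof -
    have "integral {0..t} (\<lambda>s. f' s * (\<integral>\<omega>. W u \<omega> * V s \<omega> \<partial>M)) = integral {0..t} (\<lambda>s. 0)"
      by (rule Henstock_Kurzweil_Integration.integral_cong) (use cross that in \<open>auto simp: mult.commute\<close>)
    then show ?thesis
      using V.wiener_integral_pairing[OF f' \<open>0 \<le> t\<close> W.W_meas[OF that] W.W_square(1)[OF that], of f]
        cross[OF \<open>0 \<le> t\<close> that] by (simp add: mult.commute)
  qed
  have "integral {0..t} (\<lambda>s. g' s * (\<integral>\<omega>. V.wiener_integral f f' t \<omega> * W s \<omega> \<partial>M)) = integral {0..t} (\<lambda>s. 0)"
    by (rule Henstock_Kurzweil_Integration.integral_cong) (use XW in auto)
  then show ?thesis
    using W.wiener_integral_pairing[OF g' \<open>0 \<le> t\<close> V.wiener_integral_measurable[OF f' \<open>0 \<le> t\<close>, of f]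
        V.wiener_integral_square[OF f' \<open>0 \<le> t\<close>, of f], of g]
      XW[OF \<open>0 \<le> t\<close>] by simp
qed

section \<open>The filtered trend\<close>

lemma exp_decay_at_top:
  fixes c :: real
  assumes "0 < c"
  shows "((\<lambda>s. exp (- c * s)) \<longlongrightarrow> 0) at_top"
proof -
  have "filterlim (\<lambda>s. c * s) at_top at_top"
    by (rule filterlim_tendsto_pos_mult_at_top[OF tendsto_const assms filterlim_ident])
  then have "filterlim (\<lambda>s. - c * s) at_bot at_top" by (simp add: filterlim_uminus_at_top)
  then show ?thesis by (rule filterlim_compose[OF exp_at_bot])
qed

text \<open>\<open>k\<close> is the convolution of the two exponentials, with
  \<open>s * exp (- a * s)\<close> in the resonant case of equal rates. The third property says that
  its derivative is symmetric in the two rates. Working with these properties confines the case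
  distinction to this proof.\<close>

lemma convolution_kernel_exists:
  fixes a b :: real
  assumes "0 < a" "0 < b"
  obtains k :: "real \<Rightarrow> real" where "k 0 = 0"
    "\<And>s. (k has_real_derivative (exp (- b * s) - a * k s)) (at s)"
    "\<And>s. exp (- b * s) - a * k s = exp (- a * s) - b * k s" "(k \<longlongrightarrow> 0) at_top"
proof (cases "a = b")
  case True
  show ?thesis
  proof
    let ?k = "\<lambda>s. s * exp (- a * s)"
    show "(?k has_real_derivative (exp (- b * s) - a * ?k s)) (at s)" for s
      using True by (auto intro!: derivative_eq_intros)
    have "filterlim (\<lambda>s. a * s) at_top at_top"
      by (rule filterlim_tendsto_pos_mult_at_top[OF tendsto_const \<open>0 < a\<close> filterlim_ident])
    from filterlim_compose[OF tendsto_power_div_exp_0[of 1] this]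
    have "((\<lambda>s. 1 / a * ((a * s) ^ 1 / exp (a * s))) \<longlongrightarrow> 1 / a * 0) at_top"
      by (rule tendsto_mult_left)
    moreover have "1 / a * ((a * s) ^ 1 / exp (a * s)) = ?k s" for s
      using \<open>0 < a\<close> by (simp add: exp_minus field_simps)
    ultimately show "(?k \<longlongrightarrow> 0) at_top" by simp
  qed (use True in auto)
next
  case False
  show ?thesis
  proof
    let ?k = "\<lambda>s. (exp (- b * s) - exp (- a * s)) / (a - b)"
    show 1: "exp (- b * s) - a * ?k s = exp (- a * s) - b * ?k s" for s
      using False by (simp add: field_simps)
    show "(?k has_real_derivative (exp (- b * s) - a * ?k s)) (at s)" for s
    proof -
      have "(?k has_real_derivative ((- b * exp (- b * s) - - a * exp (- a * s)) / (a - b))) (at s)"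
        using False by (auto intro!: derivative_eq_intros)
      moreover have "(- b * exp (- b * s) - - a * exp (- a * s)) / (a - b) = exp (- b * s) - a * ?k s"
        using False by (simp add: field_simps)
      ultimately show ?thesis by (simp only:)
    qed
    have "(?k \<longlongrightarrow> (0 - 0) / (a - b)) at_top"
      using False by (intro tendsto_intros exp_decay_at_top assms) auto
    then show "(?k \<longlongrightarrow> 0) at_top" by simp
  qed simp
qed

text \<open>L'Hospital's rule, in the form where only the denominator has to tend to infinity; the
  quotient of derivatives is \<open>v\<close> itself.\<close>

lemma time_average_tendsto:
  fixes v :: "real \<Rightarrow> real"
  assumes v: "continuous_on {0..} v" and lim: "(v \<longlongrightarrow> l) at_top"
  shows "((\<lambda>T. integral {0..T} v / T) \<longlongrightarrow> l) at_top"
proof (rule lhospital_at_top_at_top[where f' = v and g' = "\<lambda>_. 1"])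
  show "LIM x at_top. x :> at_top" by (rule filterlim_ident)
  show "\<forall>\<^sub>F x in at_top. ((\<lambda>T. integral {0..T} v) has_real_derivative v x) (at x)"
    using eventually_gt_at_top[of 0]
  proof eventually_elim
    case (elim x)
    have "((\<lambda>T. integral {0..T} v) has_real_derivative v x) (at x within {0..x + 1})"
      by (rule integral_has_real_derivative[OF continuous_on_subset[OF v]]) (use elim in auto)
    moreover have "at x within {0..x + 1} = at x"
      by (rule at_within_interior) (use elim in auto)
    ultimately show ?case by simp
  qed
  show "((\<lambda>x. v x / 1) \<longlongrightarrow> l) at_top" using lim by simp
qed auto

text \<open>For fixed \<open>t\<close>, differentiating the adjoint expression
  \<open>exp (- \<kappa> (t - u)) * \<integral>\<^sub>0\<^sup>u E + \<kappa> * k (t - u) * \<integral>\<^sub>0\<^sup>u \<mu>\<close> in \<open>u\<close> leaves only the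
  driving paths, which solves the linear system without convolutions of integrals.\<close>

lemma linear_filter_representation:
  fixes V W mu R E k :: "real \<Rightarrow> real"
  assumes V: "continuous_on {0..} V" and W: "continuous_on {0..} W"
    and mu: "continuous_on {0..} mu" and E: "continuous_on {0..} E"
    and mueq: "\<And>t. 0 \<le> t \<Longrightarrow> mu t = - lam * integral {0..t} mu + b * W t"
    and Req: "\<And>t. 0 \<le> t \<Longrightarrow> R t = integral {0..t} mu + a * V t"
    and Eeq: "\<And>t. 0 \<le> t \<Longrightarrow> E t = - \<kappa> * integral {0..t} E + \<kappa> * R t"
    and k: "k 0 = 0" "\<And>s. (k has_real_derivative (exp (- lam * s) - \<kappa> * k s)) (at s)"
      "\<And>s. exp (- lam * s) - \<kappa> * k s = exp (- \<kappa> * s) - lam * k s"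
    and t: "0 \<le> t"
  shows "E t = (\<kappa> * a * V t - integral {0..t} (\<lambda>u. \<kappa> * \<kappa> * a * exp (- \<kappa> * (t - u)) * V u))
    - integral {0..t} (\<lambda>u. - (\<kappa> * b * (exp (- lam * (t - u)) - \<kappa> * k (t - u))) * W u)"
proof -
  define m e where "m u = integral {0..u} mu" and "e u = integral {0..u} E" for u
  have m: "(m has_real_derivative (- lam * m u + b * W u)) (at u within {0..t})" if "u \<in> {0..t}" for u
  proof -
    have "(m has_real_derivative mu u) (at u within {0..t})"
      unfolding m_def by (rule integral_has_real_derivative[OF continuous_on_subset[OF mu] that]) auto
    then show ?thesis using mueq[of u] that by (simp add: m_def)
  qed
  have e: "(e has_real_derivative (- \<kappa> * e u + \<kappa> * (m u + a * V u))) (at u within {0..t})" if "u \<in> {0..t}" for u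
  proof -
    have "(e has_real_derivative E u) (at u within {0..t})"
      unfolding e_def by (rule integral_has_real_derivative[OF continuous_on_subset[OF E] that]) auto
    then show ?thesis using Eeq[of u] Req[of u] that by (simp add: e_def m_def)
  qed
  have ex: "((\<lambda>u. exp (- c * (t - u))) has_real_derivative c * exp (- c * (t - u))) (at u within {0..t})" for c u
    by (auto intro!: derivative_eq_intros)
  have ktu: "((\<lambda>u. k (t - u)) has_real_derivative - (exp (- lam * (t - u)) - \<kappa> * k (t - u))) (at u within {0..t})" for u
  proof -
    have "((\<lambda>u. t - u) has_real_derivative - 1) (at u within {0..t})"
      by (auto intro!: derivative_eq_intros)
    from DERIV_chain2[OF k(2) this] show ?thesis by simp
  qed
  have 1: "((\<lambda>u. b * exp (- lam * (t - u)) * W u) has_integral (m t - 0)) {0..t}"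
  proof -
    have "((\<lambda>u. b * exp (- lam * (t - u)) * W u) has_integral (exp (- lam * (t - t)) * m t - exp (- lam * (t - 0)) * m 0)) {0..t}"
    proof (rule fundamental_theorem_of_calculus[OF t])
      fix u assume u: "u \<in> {0..t}"
      show "((\<lambda>u. exp (- lam * (t - u)) * m u) has_vector_derivative b * exp (- lam * (t - u)) * W u) (at u within {0..t})"
        using DERIV_mult[OF ex[of lam u] m[OF u]]
        by (simp add: has_real_derivative_iff_has_vector_derivative[symmetric] algebra_simps)
    qed
    then show ?thesis by (simp add: m_def)
  qed
  have 2: "((\<lambda>u. \<kappa> * a * exp (- \<kappa> * (t - u)) * V u + \<kappa> * b * k (t - u) * W u) has_integral (e t - 0)) {0..t}"
  proof -
    have "((\<lambda>u. \<kappa> * a * exp (- \<kappa> * (t - u)) * V u + \<kappa> * b * k (t - u) * W u) has_integral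
       ((exp (- \<kappa> * (t - t)) * e t + \<kappa> * (k (t - t) * m t)) - (exp (- \<kappa> * (t - 0)) * e 0 + \<kappa> * (k (t - 0) * m 0)))) {0..t}"
    proof (rule fundamental_theorem_of_calculus[OF t])
      fix u assume u: "u \<in> {0..t}"
      have "((\<lambda>u. exp (- \<kappa> * (t - u)) * e u + \<kappa> * (k (t - u) * m u)) has_real_derivative
        (\<kappa> * exp (- \<kappa> * (t - u)) * e u + (- \<kappa> * e u + \<kappa> * (m u + a * V u)) * exp (- \<kappa> * (t - u))
         + \<kappa> * (- (exp (- lam * (t - u)) - \<kappa> * k (t - u)) * m u + (- lam * m u + b * W u) * k (t - u)))) (at u within {0..t})"
        by (intro DERIV_add DERIV_mult DERIV_cmult ex e[OF u] m[OF u] ktu)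
      \<comment> \<open>The terms in \<open>e\<close> cancel at once. Those in \<open>m\<close>
        cancel after the symmetry \<open>k(3)\<close> rewrites the derivative of \<open>k\<close>
        with the rates exchanged.\<close>
      moreover have "\<kappa> * exp (- \<kappa> * (t - u)) * e u + (- \<kappa> * e u + \<kappa> * (m u + a * V u)) * exp (- \<kappa> * (t - u))
         + \<kappa> * (- (exp (- lam * (t - u)) - \<kappa> * k (t - u)) * m u + (- lam * m u + b * W u) * k (t - u))
         = \<kappa> * a * exp (- \<kappa> * (t - u)) * V u + \<kappa> * b * k (t - u) * W u"
        unfolding k(3)[of "t - u"] by (simp add: algebra_simps)
      ultimately show "((\<lambda>u. exp (- \<kappa> * (t - u)) * e u + \<kappa> * (k (t - u) * m u)) has_vector_derivative
          \<kappa> * a * exp (- \<kappa> * (t - u)) * V u + \<kappa> * b * k (t - u) * W u) (at u within {0..t})"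
        by (simp add: has_real_derivative_iff_has_vector_derivative[symmetric])
    qed
    then show ?thesis by (simp add: m_def e_def k(1))
  qed
  have kc: "continuous_on A (\<lambda>u. k (t - u))" for A
  proof -
    have "continuous_on UNIV k"
      using k(2) by (meson DERIV_isCont continuous_at_imp_continuous_on)
    then show ?thesis
      by (rule continuous_on_compose2[OF _ _ subset_UNIV]) (intro continuous_intros)
  qed
  have VW: "continuous_on {0..t} V" "continuous_on {0..t} W"
    by (auto intro: continuous_on_subset[OF V] continuous_on_subset[OF W])
  have int: "(\<lambda>u. \<kappa> * a * exp (- \<kappa> * (t - u)) * V u) integrable_on {0..t}"
    "(\<lambda>u. \<kappa> * b * k (t - u) * W u) integrable_on {0..t}"
    "(\<lambda>u. b * exp (- lam * (t - u)) * W u) integrable_on {0..t}"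
    by (auto intro!: integrable_continuous_real continuous_intros VW kc)
  define A where "A = integral {0..t} (\<lambda>u. \<kappa> * a * exp (- \<kappa> * (t - u)) * V u)"
  define B where "B = integral {0..t} (\<lambda>u. \<kappa> * b * k (t - u) * W u)"
  define C where "C = integral {0..t} (\<lambda>u. b * exp (- lam * (t - u)) * W u)"
  note A = integrable_integral[OF int(1), folded A_def]
  note B = integrable_integral[OF int(2), folded B_def]
  note C = integrable_integral[OF int(3), folded C_def]
  have mt: "m t = C" using has_integral_unique[OF 1 C] by simp
  have et: "e t = A + B" using has_integral_unique[OF 2 has_integral_add[OF A B]] by simp
  have I1: "integral {0..t} (\<lambda>u. \<kappa> * \<kappa> * a * exp (- \<kappa> * (t - u)) * V u) = \<kappa> * A"
    by (rule integral_unique) (use has_integral_mult_right[OF A, of \<kappa>] in \<open>simp add: mult.assoc\<close>)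
  have I2: "integral {0..t} (\<lambda>u. - (\<kappa> * b * (exp (- lam * (t - u)) - \<kappa> * k (t - u))) * W u) = \<kappa> * (B - C)"
    by (rule integral_unique)
       (use has_integral_mult_right[OF has_integral_diff[OF B C], of \<kappa>] in \<open>simp add: algebra_simps\<close>)
  have "E t = - \<kappa> * (A + B) + \<kappa> * (C + a * V t)"
    using Eeq[OF t] Req[OF t] mt et by (simp add: m_def e_def)
  then show ?thesis unfolding I1 I2 by (simp add: algebra_simps)
qed

text \<open>The two kernels decay, so their square integrals converge; the limits are the stationary
  variances contributed by the two noises.\<close>

lemma kernel_second_moment:
  fixes a b :: real
  assumes "0 < \<kappa>" "0 < lam"
    and k: "k 0 = 0" "\<And>s. (k has_real_derivative (exp (- lam * s) - \<kappa> * k s)) (at s)" "(k \<longlongrightarrow> 0) at_top"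
  obtains v :: "real \<Rightarrow> real" where "continuous_on {0..} v"
    "\<And>t. 0 \<le> t \<Longrightarrow> integral {0..t} (\<lambda>u. (\<kappa> * a * exp (- \<kappa> * (t - u)))\<^sup>2) + integral {0..t} (\<lambda>u. (\<kappa> * b * k (t - u))\<^sup>2) = v t"
    "(v \<longlongrightarrow> \<kappa> * a\<^sup>2 / 2 + \<kappa> * b\<^sup>2 / (2 * lam * (\<kappa> + lam))) at_top"
proof
  \<comment> \<open>This antiderivative of \<open>k\<^sup>2\<close> comes from the equation of
    \<open>k\<close>: with \<open>x = exp (- lam * s)\<close>, the derivative of
    \<open>k * x\<close> is \<open>x\<^sup>2 - (\<kappa> + lam) * k * x\<close>, and that of
    \<open>k\<^sup>2\<close> is \<open>2 * k * x - 2 * \<kappa> * k\<^sup>2\<close>. Solving the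
    first for the integral of \<open>k * x\<close> and inserting it in the second yields
    \<open>Q\<close>.\<close>
  define Q where "Q s = (2 / (\<kappa> + lam) * ((1 - exp (- (2 * lam) * s)) / (2 * lam) - k s * exp (- lam * s)) - (k s)\<^sup>2) / (2 * \<kappa>)" for s
  define v where "v t = (\<kappa> * a)\<^sup>2 * (1 - exp (- (2 * \<kappa>) * t)) / (2 * \<kappa>) + (\<kappa> * b)\<^sup>2 * Q t" for t
  have Q: "(Q has_real_derivative (k s)\<^sup>2) (at s)" for s
  proof -
    define K where "K = exp (- lam * s) - \<kappa> * k s"
    have Kd: "(k has_real_derivative K) (at s)" using k(2) by (simp add: K_def)
    have e: "((\<lambda>s. exp (- lam * s)) has_real_derivative - lam * exp (- lam * s)) (at s)"
      by (auto intro!: derivative_eq_intros)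
    have e2: "((\<lambda>s. (1 - exp (- (2 * lam) * s)) / (2 * lam)) has_real_derivative exp (- (2 * lam) * s)) (at s)"
      using assms(2) by (auto intro!: derivative_eq_intros)
    have k2: "((\<lambda>s. (k s)\<^sup>2) has_real_derivative 2 * k s * K) (at s)"
      using DERIV_power[OF Kd, of 2] by (simp add: ac_simps)
    have "(Q has_real_derivative (2 / (\<kappa> + lam) * (exp (- (2 * lam) * s) - (K * exp (- lam * s) + - lam * exp (- lam * s) * k s)) - 2 * k s * K) / (2 * \<kappa>)) (at s)"
      unfolding Q_def
      by (rule DERIV_cdivide[OF DERIV_diff[OF DERIV_cmult[OF DERIV_diff[OF e2 DERIV_mult[OF Kd e]]] k2]])
    moreover have "exp (- (2 * lam) * s) = exp (- lam * s) * exp (- lam * s)"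
      by (simp flip: exp_add)
    then have "2 / (\<kappa> + lam) * (exp (- (2 * lam) * s) - (K * exp (- lam * s) + - lam * exp (- lam * s) * k s)) - 2 * k s * K
        = 2 / (\<kappa> + lam) * ((\<kappa> + lam) * (k s * exp (- lam * s))) - 2 * k s * K"
      by (simp add: K_def algebra_simps)
    moreover have "\<dots> = 2 * \<kappa> * (k s)\<^sup>2"
    proof -
      have "2 / (\<kappa> + lam) * ((\<kappa> + lam) * z) = 2 * z" for z
        using assms(1,2) by simp
      from this[of "k s * exp (- lam * s)"] show ?thesis
        unfolding K_def power2_eq_square by (simp only:) (simp add: algebra_simps)
    qed
    ultimately show ?thesis using assms(1) by simp
  qed
  have "continuous_on {0..} Q"
    using Q by (meson DERIV_isCont continuous_at_imp_continuous_on)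
  then show "continuous_on {0..} v"
    unfolding v_def using assms(1) by (intro continuous_intros) auto
  show "integral {0..t} (\<lambda>u. (\<kappa> * a * exp (- \<kappa> * (t - u)))\<^sup>2) + integral {0..t} (\<lambda>u. (\<kappa> * b * k (t - u))\<^sup>2) = v t"
    if t: "0 \<le> t" for t
  proof -
    have "((\<lambda>u. (\<kappa> * a * exp (- \<kappa> * (t - u)))\<^sup>2) has_integral
        ((\<kappa> * a)\<^sup>2 * exp (- (2 * \<kappa>) * (t - t)) / (2 * \<kappa>) - (\<kappa> * a)\<^sup>2 * exp (- (2 * \<kappa>) * (t - 0)) / (2 * \<kappa>))) {0..t}"
    proof (rule fundamental_theorem_of_calculus[OF t])
      fix u assume "u \<in> {0..t}"
      have "(exp (- \<kappa> * (t - u)))\<^sup>2 = exp (- (2 * \<kappa>) * (t - u))"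
        by (simp add: power2_eq_square algebra_simps flip: exp_add)
      moreover have "((\<lambda>u. (\<kappa> * a)\<^sup>2 * exp (- (2 * \<kappa>) * (t - u)) / (2 * \<kappa>)) has_real_derivative (\<kappa> * a)\<^sup>2 * exp (- (2 * \<kappa>) * (t - u))) (at u within {0..t})"
        using assms(1) by (auto intro!: derivative_eq_intros)
      ultimately show "((\<lambda>u. (\<kappa> * a)\<^sup>2 * exp (- (2 * \<kappa>) * (t - u)) / (2 * \<kappa>)) has_vector_derivative (\<kappa> * a * exp (- \<kappa> * (t - u)))\<^sup>2) (at u within {0..t})"
        by (simp add: has_real_derivative_iff_has_vector_derivative power_mult_distrib)
    qed
    moreover have "((\<lambda>u. (\<kappa> * b * k (t - u))\<^sup>2) has_integral
        (- ((\<kappa> * b)\<^sup>2 * Q (t - t)) - - ((\<kappa> * b)\<^sup>2 * Q (t - 0)))) {0..t}"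
    proof (rule fundamental_theorem_of_calculus[OF t])
      fix u assume "u \<in> {0..t}"
      have "((\<lambda>u. t - u) has_real_derivative - 1) (at u within {0..t})"
        by (auto intro!: derivative_eq_intros)
      from DERIV_minus[OF DERIV_cmult[OF DERIV_chain2[OF Q this]], of "(\<kappa> * b)\<^sup>2"]
      show "((\<lambda>u. - ((\<kappa> * b)\<^sup>2 * Q (t - u))) has_vector_derivative (\<kappa> * b * k (t - u))\<^sup>2) (at u within {0..t})"
        by (simp add: has_real_derivative_iff_has_vector_derivative power_mult_distrib)
    qed
    ultimately show ?thesis
      by (simp add: integral_unique v_def Q_def k(1) diff_divide_distrib right_diff_distrib)
  qed
  have "(Q \<longlongrightarrow> (2 / (\<kappa> + lam) * ((1 - 0) / (2 * lam) - 0 * 0) - 0\<^sup>2) / (2 * \<kappa>)) at_top"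
    unfolding Q_def using assms(1,2) by (intro tendsto_intros exp_decay_at_top k(3)) auto
  then have "(v \<longlongrightarrow> (\<kappa> * a)\<^sup>2 * (1 - 0) / (2 * \<kappa>) + (\<kappa> * b)\<^sup>2 * ((2 / (\<kappa> + lam) * ((1 - 0) / (2 * lam) - 0 * 0) - 0\<^sup>2) / (2 * \<kappa>))) at_top"
    unfolding v_def using assms(1,2) by (intro tendsto_intros exp_decay_at_top) auto
  moreover have "(\<kappa> * a)\<^sup>2 * (1 - 0) / (2 * \<kappa>) + (\<kappa> * b)\<^sup>2 * ((2 / (\<kappa> + lam) * ((1 - 0) / (2 * lam) - 0 * 0) - 0\<^sup>2) / (2 * \<kappa>))
      = \<kappa> * a\<^sup>2 / 2 + \<kappa> * b\<^sup>2 / (2 * lam * (\<kappa> + lam))"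
  proof -
    have "(\<kappa> * a)\<^sup>2 * (1 - 0) / (2 * \<kappa>) = \<kappa> * a\<^sup>2 / 2"
      using assms(1) by (simp add: power2_eq_square)
    moreover have "(\<kappa> * b)\<^sup>2 * ((2 / (\<kappa> + lam) * ((1 - 0) / (2 * lam) - 0 * 0) - 0\<^sup>2) / (2 * \<kappa>)) = \<kappa> * b\<^sup>2 / (2 * lam * (\<kappa> + lam))"
      using assms(1,2) by (simp add: power2_eq_square ac_simps)
    ultimately show ?thesis by (simp only:)
  qed
  ultimately show "(v \<longlongrightarrow> \<kappa> * a\<^sup>2 / 2 + \<kappa> * b\<^sup>2 / (2 * lam * (\<kappa> + lam))) at_top" by (simp only:)
qed

section \<open>The logarithm of the portfolio value\<close>

text \<open>A partition of the interval must end at \<open>a\<close>, while the grid sum stops at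
  the last full cell. Capping the grid points at \<open>a\<close> adds one cell, possibly of length
  0, whose contribution is the extra summand.\<close>

lemma ito_integral_grid_sums:
  assumes "shrinking_mesh h" "0 \<le> a" "ito_integral M F H X I"
  defines "e \<equiv> \<lambda>n. real (nat \<lfloor>a / h n\<rfloor>) * h n"
  shows "converges_in_probability M
    (\<lambda>n \<omega>. grid_sum (h n) (\<lambda>s t. H s \<omega> * (X t \<omega> - X s \<omega>)) a + H (e n) \<omega> * (X a \<omega> - X (e n) \<omega>)) (I a)"
proof -
  interpret shrinking_mesh h by fact
  define N where "N n = nat \<lfloor>a / h n\<rfloor>" for n
  define p where "p n i = min (real i * h n) a" for n i
  have pN: "p n (N n) = e n" "p n (Suc (N n)) = a" for n
    using grid_end_bounds[OF h_pos[of n] assms(2)] by (auto simp: p_def N_def e_def algebra_simps)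
  have pi: "p n i = real i * h n" "p n (Suc i) = real (Suc i) * h n" if "i < N n" for n i
    using grid_point_bounds[OF h_pos[of n] that[unfolded N_def]] by (auto simp: p_def)
  have "partitions_to_zero a (\<lambda>n. Suc (N n)) p"
    unfolding partitions_to_zero_def
  proof (intro conjI allI impI)
    fix n i
    show "p n 0 = 0" using assms(2) by (simp add: p_def)
    show "p n (Suc (N n)) = a" by (rule pN)
    show "p n i \<le> p n (Suc i)"
      using h_pos[of n] unfolding p_def by (intro min.mono mult_right_mono) auto
  next
    fix d :: real assume "0 < d"
    with h_lim have "\<forall>\<^sub>F n in sequentially. h n < d" by (rule order_tendstoD)
    then show "\<forall>\<^sub>F n in sequentially. \<forall>i<Suc (N n). p n (Suc i) - p n i < d"
    proof eventually_elim
      case (elim n)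
      have "p n (Suc i) - p n i \<le> h n" for i
        using h_pos[of n] by (auto simp: p_def min_def algebra_simps)
      then show ?case using elim by (meson order_le_less_trans)
    qed
  qed
  then have "converges_in_probability M
      (\<lambda>n \<omega>. \<Sum>i<Suc (N n). H (p n i) \<omega> * (X (p n (Suc i)) \<omega> - X (p n i) \<omega>)) (I a)"
    using assms(2,3) unfolding ito_integral_def by blast
  moreover have "(\<Sum>i<Suc (N n). H (p n i) \<omega> * (X (p n (Suc i)) \<omega> - X (p n i) \<omega>)) =
      grid_sum (h n) (\<lambda>s t. H s \<omega> * (X t \<omega> - X s \<omega>)) a + H (e n) \<omega> * (X a \<omega> - X (e n) \<omega>)" for n \<omega>
    using pi[of _ n] pN[of n] by (simp add: grid_sum_def N_def)
  ultimately show ?thesis by simp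
qed

lemma continuous_adapted_measurable:
  assumes "filtration_on M F" "continuous_adapted M F X" "0 \<le> t"
  shows "X t \<in> borel_measurable M"
  using assms by (auto simp: filtration_on_def continuous_adapted_def intro: measurable_from_subalg)

text \<open>One mesh must serve the quadratic variation, all the integrals and all rational times,
  since the pathwise argument combines their limits for a fixed path. These are countably many
  convergences in probability.\<close>

lemma ito_integral_AE_limits:
  assumes "prob_space M" "filtration_on M F" "wiener_process M F W"
    and ito: "\<And>i::nat. ito_integral M F (H i) (X i) (I i)"
  obtains h where "shrinking_mesh h"
    "AE \<omega> in M. \<forall>a\<in>\<rat>. 0 \<le> a \<longrightarrow> (\<lambda>n. grid_sum (h n) (\<lambda>s t. (W t \<omega> - W s \<omega>)\<^sup>2) a) \<longlonglongrightarrow> a"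
    "AE \<omega> in M. \<forall>i. \<forall>a\<in>\<rat>. 0 \<le> a \<longrightarrow> (\<lambda>n. grid_sum (h n) (\<lambda>s t. H i s \<omega> * (X i t \<omega> - X i s \<omega>)) a) \<longlonglongrightarrow> I i a \<omega>"
proof -
  interpret wiener M F W
    using assms by (simp add: wiener_def wiener_axioms_def)
  define h0 where "h0 n = 1 / real (Suc n)" for n
  interpret m0: shrinking_mesh h0
    unfolding h0_def by unfold_locales (simp, rule LIMSEQ_Suc[OF lim_1_over_n])
  define e where "e a n = real (nat \<lfloor>a / h0 n\<rfloor>) * h0 n" for a n
  have e: "0 \<le> e a n" for a n using m0.h_pos[of n] by (simp add: e_def)
  \<comment> \<open>The absolute value makes every rational index a nonnegative time.\<close>
  define r :: "rat \<Rightarrow> real" where "r q = of_rat \<bar>q\<bar>" for q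
  have r: "0 \<le> r q" for q by (simp add: r_def)
  have ca: "continuous_adapted M F (H i)" "continuous_adapted M F (X i)" "continuous_adapted M F (I i)" for i
    using ito[of i] by (auto simp: ito_integral_def)
  have gridt: "0 \<le> real i * h0 n" for i n using m0.h_pos[of n] by simp
  note meas = continuous_adapted_measurable[OF assms(2) ca(1)] continuous_adapted_measurable[OF assms(2) ca(2)]
    continuous_adapted_measurable[OF assms(2) ca(3)]
  \<comment> \<open>The countable index type is \<open>nat option\<close> paired with
    \<open>rat\<close>: \<open>None\<close> stands for the quadratic variation of \<open>W\<close>,
    \<open>Some i\<close> for the \<open>i\<close>-th integral together with its last incomplete
    cell.\<close>
  define A where "A j n \<omega> = (case j of
      (None, q) \<Rightarrow> grid_sum (h0 n) (\<lambda>s t. (W t \<omega> - W s \<omega>)\<^sup>2) (r q)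
    | (Some i, q) \<Rightarrow> grid_sum (h0 n) (\<lambda>s t. H i s \<omega> * (X i t \<omega> - X i s \<omega>)) (r q)
        + H i (e (r q) n) \<omega> * (X i (r q) \<omega> - X i (e (r q) n) \<omega>))" for j n \<omega>
  define B where "B j \<omega> = (case j of (None, q) \<Rightarrow> r q | (Some i, q) \<Rightarrow> I i (r q) \<omega>)" for j \<omega>
  have Am: "A j n \<in> borel_measurable M" for j n
  proof (cases j)
    case (Pair i q)
    show ?thesis
    proof (cases i)
      case None
      then have "A j n = (\<lambda>\<omega>. \<Sum>i<nat \<lfloor>r q / h0 n\<rfloor>. (W (real (Suc i) * h0 n) \<omega> - W (real i * h0 n) \<omega>)\<^sup>2)"
        by (simp add: Pair A_def[abs_def] grid_sum_def)
      then show ?thesis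
        by (auto intro!: borel_measurable_sum borel_measurable_power borel_measurable_diff W_measurable gridt simp del: of_nat_Suc)
    next
      case (Some i')
      then have "A j n = (\<lambda>\<omega>. (\<Sum>i<nat \<lfloor>r q / h0 n\<rfloor>. H i' (real i * h0 n) \<omega> * (X i' (real (Suc i) * h0 n) \<omega> - X i' (real i * h0 n) \<omega>))
         + H i' (e (r q) n) \<omega> * (X i' (r q) \<omega> - X i' (e (r q) n) \<omega>))"
        by (simp add: Pair A_def[abs_def] grid_sum_def)
      then show ?thesis
        by (auto intro!: borel_measurable_sum borel_measurable_add borel_measurable_times borel_measurable_diff meas gridt e r simp del: of_nat_Suc)
    qed
  qed
  have Bm: "B j \<in> borel_measurable M" for j
    using meas(3)[OF r] by (cases j; cases "fst j") (auto simp: B_def[abs_def])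
  have AB: "converges_in_probability M (A j) (B j)" for j
  proof (cases j)
    case (Pair i q)
    show ?thesis
    proof (cases i)
      case None
      then show ?thesis
        using quadratic_variation_in_probability[OF m0.shrinking_mesh_axioms r[of q]]
        by (simp add: Pair A_def[abs_def] B_def[abs_def])
    next
      case (Some i')
      then show ?thesis
        using ito_integral_grid_sums[OF m0.shrinking_mesh_axioms r[of q] ito[of i']]
        by (simp add: Pair A_def[abs_def] B_def[abs_def] e_def[abs_def])
    qed
  qed
  obtain \<rho> :: "nat \<Rightarrow> nat" where \<rho>: "filterlim \<rho> at_top sequentially" "AE \<omega> in M. \<forall>j. (\<lambda>n. A j (\<rho> n) \<omega>) \<longlonglongrightarrow> B j \<omega>"
    by (rule common_subsequence_AE[OF Am Bm AB])
  have sub: "(\<lambda>n. f (\<rho> n)) \<longlonglongrightarrow> l" if "f \<longlonglongrightarrow> l" for f :: "nat \<Rightarrow> real" and l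
    by (rule filterlim_compose[OF that \<rho>(1)])
  have rat: "\<exists>q. a = r q" if "a \<in> \<rat>" "0 \<le> a" for a
    using that by (auto simp: r_def Rats_def) (metis abs_of_nonneg)
  show ?thesis
  proof
    show "shrinking_mesh (\<lambda>n. h0 (\<rho> n))"
      by unfold_locales (auto intro: m0.h_pos sub m0.h_lim)
    show "AE \<omega> in M. \<forall>a\<in>\<rat>. 0 \<le> a \<longrightarrow> (\<lambda>n. grid_sum (h0 (\<rho> n)) (\<lambda>s t. (W t \<omega> - W s \<omega>)\<^sup>2) a) \<longlonglongrightarrow> a"
      using \<rho>(2)
    proof eventually_elim
      case (elim \<omega>)
      show ?case
      proof (intro ballI impI)
        fix a :: real assume "a \<in> \<rat>" "0 \<le> a"
        then obtain q where "a = r q" using rat by blast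
        then show "(\<lambda>n. grid_sum (h0 (\<rho> n)) (\<lambda>s t. (W t \<omega> - W s \<omega>)\<^sup>2) a) \<longlonglongrightarrow> a"
          using elim[rule_format, of "(None, q)"] by (simp add: A_def B_def)
      qed
    qed
    have "AE \<omega> in M. \<forall>i. continuous_on {0..} (\<lambda>t. H i t \<omega>) \<and> continuous_on {0..} (\<lambda>t. X i t \<omega>)"
      unfolding AE_all_countable using ca by (auto simp: continuous_adapted_def)
    then show "AE \<omega> in M. \<forall>i. \<forall>a\<in>\<rat>. 0 \<le> a \<longrightarrow> (\<lambda>n. grid_sum (h0 (\<rho> n)) (\<lambda>s t. H i s \<omega> * (X i t \<omega> - X i s \<omega>)) a) \<longlonglongrightarrow> I i a \<omega>"
      using \<rho>(2)
    proof eventually_elim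
      case (elim \<omega>)
      show ?case
      proof (intro allI ballI impI)
        fix i and a :: real assume a: "a \<in> \<rat>" "0 \<le> a"
        then obtain q where q: "a = r q" using rat by blast
        have "(\<lambda>n. H i (e a n) \<omega>) \<longlonglongrightarrow> H i a \<omega>" "(\<lambda>n. X i (e a n) \<omega>) \<longlonglongrightarrow> X i a \<omega>"
          using m0.value_at_grid_end_tendsto[of "\<lambda>t. H i t \<omega>" a] m0.value_at_grid_end_tendsto[of "\<lambda>t. X i t \<omega>" a] elim(1) a
          by (auto simp: e_def)
        \<comment> \<open>The last incomplete cell disappears by continuity of the paths, which
          leaves pure grid sums.\<close>
        then have "(\<lambda>n. H i (e a n) \<omega> * (X i a \<omega> - X i (e a n) \<omega>)) \<longlonglongrightarrow> H i a \<omega> * (X i a \<omega> - X i a \<omega>)"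
          by (intro tendsto_intros)
        then have "(\<lambda>n. H i (e a (\<rho> n)) \<omega> * (X i a \<omega> - X i (e a (\<rho> n)) \<omega>)) \<longlonglongrightarrow> 0"
          using sub by simp
        moreover have "(\<lambda>n. A (Some i, q) (\<rho> n) \<omega>) \<longlonglongrightarrow> I i a \<omega>"
          using elim(2)[rule_format, of "(Some i, q)"] by (simp add: B_def q)
        ultimately have "(\<lambda>n. A (Some i, q) (\<rho> n) \<omega> - H i (e a (\<rho> n)) \<omega> * (X i a \<omega> - X i (e a (\<rho> n)) \<omega>)) \<longlonglongrightarrow> I i a \<omega> - 0"
          by (intro tendsto_diff)
        then show "(\<lambda>n. grid_sum (h0 (\<rho> n)) (\<lambda>s t. H i s \<omega> * (X i t \<omega> - X i s \<omega>)) a) \<longlonglongrightarrow> I i a \<omega>"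
          by (simp add: A_def q)
      qed
    qed
  qed
qed

lemma AE_log_wealth_formula:
  assumes "prob_space M" and "filtration_on M F" and pos: "0 < \<sigma>" "0 < \<tau>"
    and W: "wiener_process M F W"
    and mu: "continuous_adapted M F mu" and E: "continuous_adapted M F E"
    and Spos: "AE \<omega> in M. \<forall>t\<ge>0. S t \<omega> > 0"
    and SR: "ito_integral M F (\<lambda>t \<omega>. 1 / S t \<omega>) S R"
    and Req: "AE \<omega> in M. \<forall>t\<ge>0. R t \<omega> = integral {0..t} (\<lambda>s. mu s \<omega>) + \<sigma> * W t \<omega>"
    and Eeq: "AE \<omega> in M. \<forall>t\<ge>0. E t \<omega> = - (1 / \<tau>) * integral {0..t} (\<lambda>s. E s \<omega>) + (1 / \<tau>) * R t \<omega>"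
    and Ppos: "AE \<omega> in M. \<forall>t\<ge>0. P t \<omega> > 0"
    and PL: "ito_integral M F (\<lambda>t \<omega>. 1 / P t \<omega>) P L"
    and SL: "ito_integral M F (\<lambda>t \<omega>. m * (E t \<omega> / \<sigma>\<^sup>2) * (1 / S t \<omega>)) S L"
  shows "AE \<omega> in M. \<forall>t\<ge>0. ln (P t \<omega> / P 0 \<omega>) = m / \<sigma>\<^sup>2 * (\<tau> / 2 * (E t \<omega>)\<^sup>2 - \<sigma>\<^sup>2 / (2 * \<tau>) * t
      + (1 - m / 2) * integral {0..t} (\<lambda>u. (E u \<omega>)\<^sup>2))"
proof -
  \<comment> \<open>The three integrals are packed into one sequence: 0 for the returns of
    \<open>S\<close>, 1 for those of \<open>P\<close>, and every index from 2 on for the gains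
    integral.\<close>
  define H where "H i = (if i = 0 then (\<lambda>t \<omega>. 1 / S t \<omega>) else if i = 1 then (\<lambda>t \<omega>. 1 / P t \<omega>)
      else (\<lambda>t \<omega>. m * (E t \<omega> / \<sigma>\<^sup>2) * (1 / S t \<omega>)))" for i :: nat
  define X where "X i = (if i = 1 then P else S)" for i :: nat
  define I where "I i = (if i = 0 then R else L)" for i :: nat
  have ito: "ito_integral M F (H i) (X i) (I i)" for i
    using SR PL SL by (simp add: H_def X_def I_def)
  obtain h where h: "shrinking_mesh h"
    "AE \<omega> in M. \<forall>a\<in>\<rat>. 0 \<le> a \<longrightarrow> (\<lambda>n. grid_sum (h n) (\<lambda>s t. (W t \<omega> - W s \<omega>)\<^sup>2) a) \<longlonglongrightarrow> a"
    "AE \<omega> in M. \<forall>i. \<forall>a\<in>\<rat>. 0 \<le> a \<longrightarrow> (\<lambda>n. grid_sum (h n) (\<lambda>s t. H i s \<omega> * (X i t \<omega> - X i s \<omega>)) a) \<longlonglongrightarrow> I i a \<omega>"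
    by (rule ito_integral_AE_limits[OF assms(1,2) W ito])
  have cont: "AE \<omega> in M. continuous_on {0..} (\<lambda>t. Y t \<omega>)" if "continuous_adapted M F Y" for Y
    using that by (simp add: continuous_adapted_def)
  have W0: "AE \<omega> in M. W 0 \<omega> = 0" and Wc: "continuous_adapted M F W"
    using W by (auto simp: wiener_process_def)
  have Sc: "continuous_adapted M F S" and Rc: "continuous_adapted M F R" and Pc: "continuous_adapted M F P"
    and Lc: "continuous_adapted M F L"
    using SR PL by (auto simp: ito_integral_def)
  show ?thesis
    using h(2,3) W0 cont[OF Wc] cont[OF Sc] cont[OF mu] cont[OF E] cont[OF Pc] cont[OF Rc] cont[OF Lc] Spos Ppos Req Eeq
  proof eventually_elim
    case (elim \<omega>)
    show ?case
    proof (intro allI impI)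
      fix t :: real assume "0 \<le> t"
      interpret shrinking_mesh h by (rule h(1))
      show "ln (P t \<omega> / P 0 \<omega>) = m / \<sigma>\<^sup>2 * (\<tau> / 2 * (E t \<omega>)\<^sup>2 - \<sigma>\<^sup>2 / (2 * \<tau>) * t
          + (1 - m / 2) * integral {0..t} (\<lambda>u. (E u \<omega>)\<^sup>2))"
        by (rule log_wealth_formula[of "\<lambda>t. W t \<omega>" "\<lambda>t. S t \<omega>" "\<lambda>t. mu t \<omega>" "\<lambda>t. E t \<omega>" "\<lambda>t. P t \<omega>"
              "\<lambda>t. R t \<omega>" "\<lambda>t. L t \<omega>" \<sigma> \<tau> m t])
           (use elim(3-) pos elim(1)[rule_format] elim(2)[rule_format, of _ 0] elim(2)[rule_format, of _ 1]
              elim(2)[rule_format, of _ 2] \<open>0 \<le> t\<close> in \<open>simp_all add: H_def X_def I_def\<close>)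
    qed
  qed
qed

section \<open>Second moments and the growth rate\<close>

text \<open>Setting the paths to \<open>0\<close> on a null set keeps measurability with respect to \<open>M\<close> and makes
  every path continuous, as the pathwise integrals require.\<close>

lemma wiener_covariance_off_null_set:
  assumes "prob_space M" "filtration_on M F" "wiener_process M F W"
    and N: "N \<in> null_sets M" and cont: "\<And>\<omega>. \<omega> \<in> space M - N \<Longrightarrow> continuous_on {0..} (\<lambda>t. W t \<omega>)"
  shows "wiener_covariance M (\<lambda>t \<omega>. if \<omega> \<in> N then 0 else W t \<omega>)"
proof -
  interpret wiener M F W
    using assms by (simp add: wiener_def wiener_axioms_def)
  let ?W = "\<lambda>t \<omega>. if \<omega> \<in> N then 0 else W t \<omega>"
  have meas: "?W t \<in> borel_measurable M" if "0 \<le> t" for t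
    using N by (intro measurable_If_set W_measurable that) auto
  have eq: "AE \<omega> in M. W s \<omega> * W t \<omega> = ?W s \<omega> * ?W t \<omega>" for s t
    using AE_not_in[OF N] by eventually_elim simp
  show ?thesis
  proof
    fix s t :: real assume st: "0 \<le> s" "0 \<le> t"
    have m: "(\<lambda>\<omega>. W s \<omega> * W t \<omega>) \<in> borel_measurable M" "(\<lambda>\<omega>. ?W s \<omega> * ?W t \<omega>) \<in> borel_measurable M"
      by (intro borel_measurable_times W_measurable meas st)+
    show "integrable M (\<lambda>\<omega>. ?W s \<omega> * ?W t \<omega>)"
      using integrable_cong_AE[OF m eq] covariance[OF st] by simp
    show "expectation (\<lambda>\<omega>. ?W s \<omega> * ?W t \<omega>) = min s t"
      using integral_cong_AE[OF m eq] covariance[OF st] by simp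
  next
    show "continuous_on {0..} (\<lambda>t. ?W t \<omega>)" if "\<omega> \<in> space M" for \<omega>
      using cont[of \<omega>] that by (cases "\<omega> \<in> N") auto
  qed (rule meas)
qed

text \<open>Coordinate projections turn independence of the path maps into independence of the two
  values, whose means are 0.\<close>

lemma independent_wiener_processes_uncorrelated:
  assumes "prob_space M" "filtration_on M F" "wiener_process M F V" "wiener_process M F W"
    and ind: "independent_processes M V W" and "0 \<le> s" "0 \<le> t"
  shows "(\<integral>\<omega>. V s \<omega> * W t \<omega> \<partial>M) = 0"
proof -
  interpret V: wiener M F V
    using assms by (simp add: wiener_def wiener_axioms_def)
  interpret W: wiener M F W
    using assms by (simp add: wiener_def wiener_axioms_def)
  have "V.indep_var borel ((\<lambda>f. f s) \<circ> (\<lambda>\<omega>. \<lambda>t\<in>{0..}. V t \<omega>)) borel ((\<lambda>f. f t) \<circ> (\<lambda>\<omega>. \<lambda>t\<in>{0..}. W t \<omega>))"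
    using ind unfolding independent_processes_def
    by (rule V.indep_var_compose) (use assms(6,7) in \<open>auto intro: measurable_component_singleton\<close>)
  then have "V.indep_var borel (V s) borel (W t)"
    using assms(6,7) by (simp add: comp_def)
  then have "(\<integral>\<omega>. V s \<omega> * W t \<omega> \<partial>M) = (\<integral>\<omega>. V s \<omega> \<partial>M) * (\<integral>\<omega>. W t \<omega> \<partial>M)"
    by (rule V.indep_var_lebesgue_integral) (intro V.second_moment(3) W.second_moment(3) assms(6,7))+
  then show ?thesis using V.second_moment(4)[OF assms(6)] by simp
qed

text \<open>For each fixed \<open>t\<close> the average is a sum of two Wiener integrals whose
  kernels depend on \<open>t\<close>. They are uncorrelated, so the two isometries add up to
  \<open>v t\<close>. The version \<open>E'\<close> vanishes on the exceptional null set, so that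
  Fubini's theorem can be applied to all its paths.\<close>

lemma filtered_trend_second_moment:
  fixes W\<^sub>S W\<^sub>\<mu> mu E R :: "real \<Rightarrow> 'a \<Rightarrow> real"
  assumes prob: "prob_space M" and filt: "filtration_on M F" and pos: "0 < \<kappa>" "0 < lam"
    and WS: "wiener_process M F W\<^sub>S" and Wm: "wiener_process M F W\<^sub>\<mu>"
    and ind: "independent_processes M W\<^sub>S W\<^sub>\<mu>"
    and mu: "continuous_adapted M F mu" and E: "continuous_adapted M F E"
    and Req: "AE \<omega> in M. \<forall>t\<ge>0. R t \<omega> = integral {0..t} (\<lambda>s. mu s \<omega>) + a * W\<^sub>S t \<omega>"
    and mueq: "AE \<omega> in M. \<forall>t\<ge>0. mu t \<omega> = - lam * integral {0..t} (\<lambda>s. mu s \<omega>) + b * W\<^sub>\<mu> t \<omega>"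
    and Eeq: "AE \<omega> in M. \<forall>t\<ge>0. E t \<omega> = - \<kappa> * integral {0..t} (\<lambda>s. E s \<omega>) + \<kappa> * R t \<omega>"
  obtains E' v where "AE \<omega> in M. \<forall>t. E' t \<omega> = E t \<omega>"
    "\<And>t. 0 \<le> t \<Longrightarrow> E' t \<in> borel_measurable M" "\<And>\<omega>. \<omega> \<in> space M \<Longrightarrow> continuous_on {0..} (\<lambda>t. E' t \<omega>)"
    "\<And>t. 0 \<le> t \<Longrightarrow> integrable M (\<lambda>\<omega>. (E' t \<omega>)\<^sup>2)" "\<And>t. 0 \<le> t \<Longrightarrow> (\<integral>\<omega>. (E' t \<omega>)\<^sup>2 \<partial>M) = v t"
    "continuous_on {0..} v" "(v \<longlongrightarrow> \<kappa> * a\<^sup>2 / 2 + \<kappa> * b\<^sup>2 / (2 * lam * (\<kappa> + lam))) at_top"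
proof -
  interpret prob_space M by fact
  have "AE \<omega> in M. continuous_on {0..} (\<lambda>t. W\<^sub>S t \<omega>) \<and> continuous_on {0..} (\<lambda>t. W\<^sub>\<mu> t \<omega>) \<and>
      continuous_on {0..} (\<lambda>t. mu t \<omega>) \<and> continuous_on {0..} (\<lambda>t. E t \<omega>) \<and>
      (\<forall>t\<ge>0. R t \<omega> = integral {0..t} (\<lambda>s. mu s \<omega>) + a * W\<^sub>S t \<omega>) \<and>
      (\<forall>t\<ge>0. mu t \<omega> = - lam * integral {0..t} (\<lambda>s. mu s \<omega>) + b * W\<^sub>\<mu> t \<omega>) \<and>
      (\<forall>t\<ge>0. E t \<omega> = - \<kappa> * integral {0..t} (\<lambda>s. E s \<omega>) + \<kappa> * R t \<omega>)"
    using WS Wm mu E Req mueq Eeq by (simp add: wiener_process_def continuous_adapted_def)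
  then obtain N where N: "N \<in> null_sets M"
    and good: "\<And>\<omega>. \<omega> \<in> space M - N \<Longrightarrow> continuous_on {0..} (\<lambda>t. W\<^sub>S t \<omega>) \<and> continuous_on {0..} (\<lambda>t. W\<^sub>\<mu> t \<omega>) \<and>
      continuous_on {0..} (\<lambda>t. mu t \<omega>) \<and> continuous_on {0..} (\<lambda>t. E t \<omega>) \<and>
      (\<forall>t\<ge>0. R t \<omega> = integral {0..t} (\<lambda>s. mu s \<omega>) + a * W\<^sub>S t \<omega>) \<and>
      (\<forall>t\<ge>0. mu t \<omega> = - lam * integral {0..t} (\<lambda>s. mu s \<omega>) + b * W\<^sub>\<mu> t \<omega>) \<and>
      (\<forall>t\<ge>0. E t \<omega> = - \<kappa> * integral {0..t} (\<lambda>s. E s \<omega>) + \<kappa> * R t \<omega>)"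
    by (elim AE_E3) blast
  let ?V = "\<lambda>t \<omega>. if \<omega> \<in> N then 0 else W\<^sub>S t \<omega>"
  let ?W = "\<lambda>t \<omega>. if \<omega> \<in> N then 0 else W\<^sub>\<mu> t \<omega>"
  let ?E = "\<lambda>t \<omega>. if \<omega> \<in> N then 0 else E t \<omega>"
  have VW: "wiener_covariance M ?V" "wiener_covariance M ?W"
    using good by (auto intro!: wiener_covariance_off_null_set prob filt WS Wm N)
  interpret V: wiener_covariance M ?V by fact
  interpret W: wiener_covariance M ?W by fact
  obtain k where k: "k 0 = 0" "\<And>s. (k has_real_derivative (exp (- lam * s) - \<kappa> * k s)) (at s)"
    "\<And>s. exp (- lam * s) - \<kappa> * k s = exp (- \<kappa> * s) - lam * k s" "(k \<longlongrightarrow> 0) at_top"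
    by (rule convolution_kernel_exists[OF pos]) blast
  obtain v where v: "continuous_on {0..} v"
    "\<And>t. 0 \<le> t \<Longrightarrow> integral {0..t} (\<lambda>u. (\<kappa> * a * exp (- \<kappa> * (t - u)))\<^sup>2) + integral {0..t} (\<lambda>u. (\<kappa> * b * k (t - u))\<^sup>2) = v t"
    "(v \<longlongrightarrow> \<kappa> * a\<^sup>2 / 2 + \<kappa> * b\<^sup>2 / (2 * lam * (\<kappa> + lam))) at_top"
    by (rule kernel_second_moment[OF pos k(1,2,4)]) blast
  have meas: "?E t \<in> borel_measurable M" if "0 \<le> t" for t
    using N by (intro measurable_If_set continuous_adapted_measurable[OF filt E] that) auto
  have moment: "integrable M (\<lambda>\<omega>. (?E t \<omega>)\<^sup>2) \<and> (\<integral>\<omega>. (?E t \<omega>)\<^sup>2 \<partial>M) = v t" if t: "0 \<le> t" for t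
  proof -
    let ?f = "\<lambda>u. \<kappa> * a * exp (- \<kappa> * (t - u))" and ?f' = "\<lambda>u. \<kappa> * \<kappa> * a * exp (- \<kappa> * (t - u))"
    let ?g = "\<lambda>u. \<kappa> * b * k (t - u)" and ?g' = "\<lambda>u. - (\<kappa> * b * (exp (- lam * (t - u)) - \<kappa> * k (t - u)))"
    have f: "(?f has_real_derivative ?f' u) (at u)" for u
      by (auto intro!: derivative_eq_intros)
    have ktu: "((\<lambda>u. k (t - u)) has_real_derivative (exp (- lam * (t - u)) - \<kappa> * k (t - u)) * - 1) (at u)" for u
      by (rule DERIV_chain2[OF k(2)]) (auto intro!: derivative_eq_intros)
    have g: "(?g has_real_derivative ?g' u) (at u)" for u
      using DERIV_cmult[OF ktu, of "\<kappa> * b" u] by (simp add: algebra_simps)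
    have kc: "continuous_on {0..} (\<lambda>u. k (t - u))"
      using ktu by (meson DERIV_isCont continuous_at_imp_continuous_on)
    have f'c: "continuous_on {0..} ?f'" and g'c: "continuous_on {0..} ?g'"
      by (intro continuous_intros kc)+
    let ?X = "V.wiener_integral ?f ?f' t" and ?Y = "W.wiener_integral ?g ?g' t"
    have rep: "?E t \<omega> = ?X \<omega> + ?Y \<omega>" if "\<omega> \<in> space M" for \<omega>
    proof (cases "\<omega> \<in> N")
      case True
      then show ?thesis by (simp add: V.wiener_integral_def W.wiener_integral_def)
    next
      case False
      with good[of \<omega>] that have G: "continuous_on {0..} (\<lambda>t. W\<^sub>S t \<omega>)" "continuous_on {0..} (\<lambda>t. W\<^sub>\<mu> t \<omega>)"
        "continuous_on {0..} (\<lambda>t. mu t \<omega>)" "continuous_on {0..} (\<lambda>t. E t \<omega>)"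
        "\<And>t. 0 \<le> t \<Longrightarrow> R t \<omega> = integral {0..t} (\<lambda>s. mu s \<omega>) + a * W\<^sub>S t \<omega>"
        "\<And>t. 0 \<le> t \<Longrightarrow> mu t \<omega> = - lam * integral {0..t} (\<lambda>s. mu s \<omega>) + b * W\<^sub>\<mu> t \<omega>"
        "\<And>t. 0 \<le> t \<Longrightarrow> E t \<omega> = - \<kappa> * integral {0..t} (\<lambda>s. E s \<omega>) + \<kappa> * R t \<omega>"
        by auto
      show ?thesis
        \<comment> \<open>The trend noise enters without boundary term: its kernel at
          \<open>u = t\<close> is \<open>\<kappa> * b * k 0 = 0\<close>.\<close>
        using linear_filter_representation[OF G(1-4) G(6) G(5) G(7) k(1-3) t] False k(1)
        by (simp add: V.wiener_integral_def W.wiener_integral_def)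
    qed
    note XY = V.wiener_integral_measurable[OF f'c t] V.wiener_integral_square[OF f'c t]
      W.wiener_integral_measurable[OF g'c t] W.wiener_integral_square[OF g'c t]
    have cross: "(\<integral>\<omega>. ?V s \<omega> * ?W u \<omega> \<partial>M) = 0" if su: "0 \<le> s" "0 \<le> u" for s u
    proof -
      have "(\<integral>\<omega>. ?V s \<omega> * ?W u \<omega> \<partial>M) = (\<integral>\<omega>. W\<^sub>S s \<omega> * W\<^sub>\<mu> u \<omega> \<partial>M)"
      proof (rule integral_cong_AE)
        show "AE \<omega> in M. ?V s \<omega> * ?W u \<omega> = W\<^sub>S s \<omega> * W\<^sub>\<mu> u \<omega>"
          using AE_not_in[OF N] by eventually_elim simp
        have "continuous_adapted M F W\<^sub>S" "continuous_adapted M F W\<^sub>\<mu>"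
          using WS Wm by (auto simp: wiener_process_def)
        then show "(\<lambda>\<omega>. W\<^sub>S s \<omega> * W\<^sub>\<mu> u \<omega>) \<in> borel_measurable M"
          by (intro borel_measurable_times continuous_adapted_measurable[OF filt] su)
        show "(\<lambda>\<omega>. ?V s \<omega> * ?W u \<omega>) \<in> borel_measurable M"
          by (intro borel_measurable_times V.W_meas W.W_meas su)
      qed
      then show ?thesis
        using independent_wiener_processes_uncorrelated[OF prob filt WS Wm ind su] by simp
    qed
    have XYint: "integrable M (\<lambda>\<omega>. ?X \<omega> * ?Y \<omega>)" by (intro integrable_product_if_L2 XY)
    have XY0: "(\<integral>\<omega>. ?X \<omega> * ?Y \<omega> \<partial>M) = 0"
      by (rule wiener_integrals_uncorrelated[OF VW cross f'c g'c t])
    have sq: "(?E t \<omega>)\<^sup>2 = (?X \<omega>)\<^sup>2 + (?Y \<omega>)\<^sup>2 + 2 * (?X \<omega> * ?Y \<omega>)" if "\<omega> \<in> space M" for \<omega>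
      unfolding rep[OF that] by (simp add: power2_sum)
    have "integrable M (\<lambda>\<omega>. (?E t \<omega>)\<^sup>2) \<longleftrightarrow> integrable M (\<lambda>\<omega>. (?X \<omega>)\<^sup>2 + (?Y \<omega>)\<^sup>2 + 2 * (?X \<omega> * ?Y \<omega>))"
      by (rule Bochner_Integration.integrable_cong[OF refl sq])
    moreover have "integrable M (\<lambda>\<omega>. (?X \<omega>)\<^sup>2 + (?Y \<omega>)\<^sup>2 + 2 * (?X \<omega> * ?Y \<omega>))"
      by (intro Bochner_Integration.integrable_add integrable_mult_right XY XYint)
    moreover have "(\<integral>\<omega>. (?E t \<omega>)\<^sup>2 \<partial>M) = (\<integral>\<omega>. (?X \<omega>)\<^sup>2 + (?Y \<omega>)\<^sup>2 + 2 * (?X \<omega> * ?Y \<omega>) \<partial>M)"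
      by (rule Bochner_Integration.integral_cong[OF refl sq])
    moreover have "\<dots> = integral {0..t} (\<lambda>u. (?f u)\<^sup>2) + integral {0..t} (\<lambda>u. (?g u)\<^sup>2)"
      using XY XYint XY0 V.wiener_isometry[OF f'c t f] W.wiener_isometry[OF g'c t g] by simp
    ultimately show ?thesis using v(2)[OF t] by simp
  qed
  show ?thesis
  proof (rule that)
    show "AE \<omega> in M. \<forall>t. ?E t \<omega> = E t \<omega>"
      using AE_not_in[OF N] by eventually_elim simp
    show "continuous_on {0..} (\<lambda>t. ?E t \<omega>)" if "\<omega> \<in> space M" for \<omega>
      using good[of \<omega>] that by (cases "\<omega> \<in> N") auto
  qed (use meas moment v in auto)
qed

lemma expectation_quadratic_functional:
  fixes Y :: "real \<Rightarrow> 'a \<Rightarrow> real"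
  assumes "prob_space M" and Y: "\<And>t. 0 \<le> t \<Longrightarrow> Y t \<in> borel_measurable M"
    and cont: "\<And>\<omega>. \<omega> \<in> space M \<Longrightarrow> continuous_on {0..} (\<lambda>t. Y t \<omega>)"
    and int: "\<And>t. 0 \<le> t \<Longrightarrow> integrable M (\<lambda>\<omega>. (Y t \<omega>)\<^sup>2)" and mom: "\<And>t. 0 \<le> t \<Longrightarrow> (\<integral>\<omega>. (Y t \<omega>)\<^sup>2 \<partial>M) = v t"
    and v: "continuous_on {0..} v" and "0 \<le> T"
  shows "integrable M (\<lambda>\<omega>. p * (Y T \<omega>)\<^sup>2 + q + r * integral {0..T} (\<lambda>u. (Y u \<omega>)\<^sup>2))"
    and "(\<integral>\<omega>. p * (Y T \<omega>)\<^sup>2 + q + r * integral {0..T} (\<lambda>u. (Y u \<omega>)\<^sup>2) \<partial>M) = p * v T + q + r * integral {0..T} v"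
proof -
  interpret prob_space M by fact
  obtain K where K: "\<And>t. 0 \<le> t \<Longrightarrow> t \<le> T \<Longrightarrow> \<bar>v t\<bar> \<le> K"
    using continuous_bounded_on_interval[OF v] by metis
  have 1: "(\<lambda>\<omega>. (Y u \<omega>)\<^sup>2) \<in> borel_measurable M" if "0 \<le> u" for u
    by (intro borel_measurable_power Y that)
  have 2: "continuous_on {0..} (\<lambda>u. (Y u \<omega>)\<^sup>2)" if "\<omega> \<in> space M" for \<omega>
    by (intro continuous_intros cont that)
  have 3: "expectation (\<lambda>\<omega>. \<bar>(Y u \<omega>)\<^sup>2\<bar>) \<le> K" if "0 \<le> u" "u \<le> T" for u
    using K[OF that] mom[OF that(1)] by simp
  note I = expectation_integral[of "\<lambda>u \<omega>. (Y u \<omega>)\<^sup>2", OF 1 2 int 3]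
  have eq: "integral {0..T} (\<lambda>u. expectation (\<lambda>\<omega>. (Y u \<omega>)\<^sup>2)) = integral {0..T} v"
    by (rule Henstock_Kurzweil_Integration.integral_cong) (simp add: mom)
  show "integrable M (\<lambda>\<omega>. p * (Y T \<omega>)\<^sup>2 + q + r * integral {0..T} (\<lambda>u. (Y u \<omega>)\<^sup>2))"
    using I(1) int[OF \<open>0 \<le> T\<close>] by simp
  show "(\<integral>\<omega>. p * (Y T \<omega>)\<^sup>2 + q + r * integral {0..T} (\<lambda>u. (Y u \<omega>)\<^sup>2) \<partial>M) = p * v T + q + r * integral {0..T} v"
    using I(1,2) int[OF \<open>0 \<le> T\<close>] mom[OF \<open>0 \<le> T\<close>] by (simp add: prob_space eq)
qed

text \<open>Integrability belongs to the conclusion because the expectation of a non-integrable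
  function is 0 by convention, and the limit alone would not exclude that reading.\<close>

theorem theorem2p3:
  fixes M :: "'a measure" and F :: "real \<Rightarrow> 'a measure"
    and W\<^sub>S W\<^sub>\<mu> S \<mu> \<mu>_ema P R L :: "real \<Rightarrow> 'a \<Rightarrow> real"
    and lam \<sigma>\<^sub>\<mu> \<sigma>\<^sub>S \<tau> m x S\<^sub>0 \<beta> :: real
  assumes "prob_space M" and "filtration_on M F"
    and "lam > 0" "\<sigma>\<^sub>\<mu> > 0" "\<sigma>\<^sub>S > 0" "\<tau> > 0" "m > 0" "x > 0" "S\<^sub>0 > 0"
    \<comment> \<open>two-dimensional Wiener process with independent components\<close>
    and "wiener_process M F W\<^sub>S" and "wiener_process M F W\<^sub>\<mu>"
    and "independent_processes M W\<^sub>S W\<^sub>\<mu>"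
    and "continuous_adapted M F S" and "continuous_adapted M F \<mu>"
    and "continuous_adapted M F \<mu>_ema" and "continuous_adapted M F P"
    \<comment> \<open>\<open>dS/S = \<mu> dt + \<sigma>\<^sub>S dW\<^sub>S\<close>, \<open>S\<^sub>0\<close> constant; \<open>R\<close> is the integral of \<open>dS/S\<close>\<close>
    and "AE \<omega> in M. S 0 \<omega> = S\<^sub>0" and "AE \<omega> in M. \<forall>t\<ge>0. S t \<omega> > 0"
    and "ito_integral M F (\<lambda>t \<omega>. 1 / S t \<omega>) S R"
    and "AE \<omega> in M. \<forall>t\<ge>0. R t \<omega> = integral {0..t} (\<lambda>s. \<mu> s \<omega>) + \<sigma>\<^sub>S * W\<^sub>S t \<omega>"
    \<comment> \<open>\<open>d\<mu> = - lam \<mu> dt + \<sigma>\<^sub>\<mu> dW\<^sub>\<mu>\<close>, \<open>\<mu>\<close> starting at 0\<close>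
    and "AE \<omega> in M. \<forall>t\<ge>0. \<mu> t \<omega> = - lam * integral {0..t} (\<lambda>s. \<mu> s \<omega>) + \<sigma>\<^sub>\<mu> * W\<^sub>\<mu> t \<omega>"
    \<comment> \<open>\<open>d\<mu>_ema = - (1/\<tau>) \<mu>_ema dt + (1/\<tau>) dS/S\<close>, \<open>\<mu>_ema\<close> starting at 0\<close>
    and "AE \<omega> in M. \<forall>t\<ge>0. \<mu>_ema t \<omega> = - (1 / \<tau>) * integral {0..t} (\<lambda>s. \<mu>_ema s \<omega>) + (1 / \<tau>) * R t \<omega>"
    \<comment> \<open>\<open>dP/P = m (\<mu>_ema / \<sigma>\<^sub>S\<^sup>2) dS/S\<close>, \<open>P\<close> starting at \<open>x\<close>; \<open>L\<close> is the integral of either side\<close>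
    and "AE \<omega> in M. P 0 \<omega> = x" and "AE \<omega> in M. \<forall>t\<ge>0. P t \<omega> > 0"
    and "ito_integral M F (\<lambda>t \<omega>. 1 / P t \<omega>) P L"
    and "ito_integral M F (\<lambda>t \<omega>. m * (\<mu>_ema t \<omega> / \<sigma>\<^sub>S\<^sup>2) * (1 / S t \<omega>)) S L"
    and "\<beta> = (1 + \<sigma>\<^sub>\<mu>\<^sup>2 / (lam\<^sup>2 * \<sigma>\<^sub>S\<^sup>2)) powr (1 / 2)"
  shows "(\<forall>T\<ge>0. integrable M (\<lambda>\<omega>. ln (P T \<omega> / P 0 \<omega>))) \<and>
    ((\<lambda>T. prob_space.expectation M (\<lambda>\<omega>. ln (P T \<omega> / P 0 \<omega>)) / T) \<longlongrightarrow>
       m * ((\<tau> * (\<beta>\<^sup>2 - 1) * (2 - m) - m * (\<tau> + 1 / lam)) / (4 * \<tau> * (\<tau> + 1 / lam)))) at_top"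
proof -
  interpret prob_space M by fact
  have \<kappa>: "0 < 1 / \<tau>" using \<open>\<tau> > 0\<close> by simp
  note ema_eq = \<open>AE \<omega> in M. \<forall>t\<ge>0. \<mu>_ema t \<omega> = _\<close>
  note R_eq = \<open>AE \<omega> in M. \<forall>t\<ge>0. R t \<omega> = _\<close>
  have wealth: "AE \<omega> in M. \<forall>t\<ge>0. ln (P t \<omega> / P 0 \<omega>) = m / \<sigma>\<^sub>S\<^sup>2 * (\<tau> / 2 * (\<mu>_ema t \<omega>)\<^sup>2 - \<sigma>\<^sub>S\<^sup>2 / (2 * \<tau>) * t
      + (1 - m / 2) * integral {0..t} (\<lambda>u. (\<mu>_ema u \<omega>)\<^sup>2))"
    by (rule AE_log_wealth_formula[OF assms(1,2,5,6,10,14,15) \<open>AE \<omega> in M. \<forall>t\<ge>0. S t \<omega> > 0\<close>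
          \<open>ito_integral M F (\<lambda>t \<omega>. 1 / S t \<omega>) S R\<close> R_eq ema_eq \<open>AE \<omega> in M. \<forall>t\<ge>0. P t \<omega> > 0\<close>
          \<open>ito_integral M F (\<lambda>t \<omega>. 1 / P t \<omega>) P L\<close> \<open>ito_integral M F _ S L\<close>])
  obtain E' v where E': "AE \<omega> in M. \<forall>t. E' t \<omega> = \<mu>_ema t \<omega>"
    "\<And>t. 0 \<le> t \<Longrightarrow> E' t \<in> borel_measurable M" "\<And>\<omega>. \<omega> \<in> space M \<Longrightarrow> continuous_on {0..} (\<lambda>t. E' t \<omega>)"
    "\<And>t. 0 \<le> t \<Longrightarrow> integrable M (\<lambda>\<omega>. (E' t \<omega>)\<^sup>2)" "\<And>t. 0 \<le> t \<Longrightarrow> (\<integral>\<omega>. (E' t \<omega>)\<^sup>2 \<partial>M) = v t"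
    and v: "continuous_on {0..} v" "(v \<longlongrightarrow> 1 / \<tau> * \<sigma>\<^sub>S\<^sup>2 / 2 + 1 / \<tau> * \<sigma>\<^sub>\<mu>\<^sup>2 / (2 * lam * (1 / \<tau> + lam))) at_top"
    by (rule filtered_trend_second_moment[OF assms(1,2) \<kappa> assms(3,10,11,12,14,15) R_eq
          \<open>AE \<omega> in M. \<forall>t\<ge>0. \<mu> t \<omega> = _\<close> ema_eq]) blast
  define c where "c = m / \<sigma>\<^sub>S\<^sup>2"
  \<comment> \<open>The log wealth formula with \<open>\<mu>_ema\<close> replaced by its version
    \<open>E'\<close>, arranged as square, constant and time integral to fit
    \<open>expectation_quadratic_functional\<close>.\<close>
  let ?f = "\<lambda>T \<omega>. c * (\<tau> / 2) * (E' T \<omega>)\<^sup>2 + - (c * (\<sigma>\<^sub>S\<^sup>2 / (2 * \<tau>)) * T)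
      + c * (1 - m / 2) * integral {0..T} (\<lambda>u. (E' u \<omega>)\<^sup>2)"
  have f: "integrable M (?f T)"
    "expectation (?f T) = c * (\<tau> / 2) * v T + - (c * (\<sigma>\<^sub>S\<^sup>2 / (2 * \<tau>)) * T) + c * (1 - m / 2) * integral {0..T} v"
    if "0 \<le> T" for T
    using expectation_quadratic_functional[OF assms(1) E'(2-5) v(1) that] by blast+
  have ae: "AE \<omega> in M. ?f T \<omega> = ln (P T \<omega> / P 0 \<omega>)" if "0 \<le> T" for T
    using wealth E'(1)
  proof eventually_elim
    case (elim \<omega>)
    then show ?case using elim(1)[rule_format, OF that, folded c_def] by (simp add: algebra_simps)
  qed
  have [measurable]: "P T \<in> borel_measurable M" if "0 \<le> T" for T
    by (rule continuous_adapted_measurable[OF assms(2,16) that])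
  have meas: "(\<lambda>\<omega>. ln (P T \<omega> / P 0 \<omega>)) \<in> borel_measurable M" if "0 \<le> T" for T
    using that by simp
  have E: "integrable M (\<lambda>\<omega>. ln (P T \<omega> / P 0 \<omega>))"
    "expectation (\<lambda>\<omega>. ln (P T \<omega> / P 0 \<omega>)) = c * (\<tau> / 2) * v T + - (c * (\<sigma>\<^sub>S\<^sup>2 / (2 * \<tau>)) * T) + c * (1 - m / 2) * integral {0..T} v"
    if "0 \<le> T" for T
    using integrable_cong_AE[OF borel_measurable_integrable[OF f(1)[OF that]] meas[OF that] ae[OF that]]
      integral_cong_AE[OF borel_measurable_integrable[OF f(1)[OF that]] meas[OF that] ae[OF that]] f[OF that]
    by simp_all
  let ?l = "1 / \<tau> * \<sigma>\<^sub>S\<^sup>2 / 2 + 1 / \<tau> * \<sigma>\<^sub>\<mu>\<^sup>2 / (2 * lam * (1 / \<tau> + lam))"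
  \<comment> \<open>The second moment converges, so the endpoint term is negligible against
    \<open>T\<close>.\<close>
  have vT: "((\<lambda>T. v T / T) \<longlongrightarrow> 0) at_top"
    by (rule tendsto_divide_0[OF v(2) filterlim_at_top_imp_at_infinity[OF filterlim_ident]])
  have "((\<lambda>T. c * (\<tau> / 2) * (v T / T) + - (c * (\<sigma>\<^sub>S\<^sup>2 / (2 * \<tau>))) + c * (1 - m / 2) * (integral {0..T} v / T))
      \<longlongrightarrow> c * (\<tau> / 2) * 0 + - (c * (\<sigma>\<^sub>S\<^sup>2 / (2 * \<tau>))) + c * (1 - m / 2) * ?l) at_top"
    by (rule tendsto_add[OF tendsto_add[OF tendsto_mult_left[OF vT] tendsto_const]
          tendsto_mult_left[OF time_average_tendsto[OF v]]])
  moreover have "\<forall>\<^sub>F T in at_top. c * (\<tau> / 2) * (v T / T) + - (c * (\<sigma>\<^sub>S\<^sup>2 / (2 * \<tau>))) + c * (1 - m / 2) * (integral {0..T} v / T)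
      = expectation (\<lambda>\<omega>. ln (P T \<omega> / P 0 \<omega>)) / T"
    using eventually_gt_at_top[of 0] by eventually_elim (simp add: E add_divide_distrib diff_divide_distrib)
  ultimately have lim: "((\<lambda>T. expectation (\<lambda>\<omega>. ln (P T \<omega> / P 0 \<omega>)) / T)
      \<longlongrightarrow> c * (\<tau> / 2) * 0 + - (c * (\<sigma>\<^sub>S\<^sup>2 / (2 * \<tau>))) + c * (1 - m / 2) * ?l) at_top"
    by (rule Lim_transform_eventually)
  have "0 < 1 + \<sigma>\<^sub>\<mu>\<^sup>2 / (lam\<^sup>2 * \<sigma>\<^sub>S\<^sup>2)"
    by (intro add_pos_nonneg divide_nonneg_nonneg) auto
  then have \<beta>: "\<beta>\<^sup>2 - 1 = \<sigma>\<^sub>\<mu>\<^sup>2 / (lam\<^sup>2 * \<sigma>\<^sub>S\<^sup>2)"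
    using \<open>\<beta> = _\<close> by (simp add: powr_half_sqrt)
  have "c * (\<tau> / 2) * 0 + - (c * (\<sigma>\<^sub>S\<^sup>2 / (2 * \<tau>))) + c * (1 - m / 2) * ?l
      = m * ((\<tau> * (\<beta>\<^sup>2 - 1) * (2 - m) - m * (\<tau> + 1 / lam)) / (4 * \<tau> * (\<tau> + 1 / lam)))"
  proof -
    have s: "lam * \<tau> + 1 \<noteq> 0" using \<open>lam > 0\<close> \<open>\<tau> > 0\<close> by (metis add_pos_pos less_irrefl mult_pos_pos zero_less_one)
    have l: "?l = \<sigma>\<^sub>S\<^sup>2 / (2 * \<tau>) + \<sigma>\<^sub>\<mu>\<^sup>2 / (2 * lam * (lam * \<tau> + 1))"
      using \<open>lam > 0\<close> \<open>\<tau> > 0\<close> s by (simp add: field_simps)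
    have tl: "\<tau> + 1 / lam = (lam * \<tau> + 1) / lam" using \<open>lam > 0\<close> by (simp add: field_simps)
    have 1: "c * (\<sigma>\<^sub>S\<^sup>2 / (2 * \<tau>)) = m / (2 * \<tau>)" using \<open>\<sigma>\<^sub>S > 0\<close> by (simp add: c_def)
    have 2: "c * (\<sigma>\<^sub>\<mu>\<^sup>2 / (2 * lam * (lam * \<tau> + 1))) = m * ((\<beta>\<^sup>2 - 1) * lam / (2 * (lam * \<tau> + 1)))"
      using \<open>\<sigma>\<^sub>S > 0\<close> \<open>lam > 0\<close> s unfolding \<beta> c_def by (simp add: power2_eq_square)
    \<comment> \<open>The price noise part of \<open>?l\<close>, weighted by
      \<open>1 - m / 2\<close>, meets the term
      \<open>- c * (\<sigma>\<^sub>S\<^sup>2 / (2 * \<tau>))\<close>; only \<open>- m / 2\<close> of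
      it survives. This is the negative summand of the growth rate.\<close>
    have "c * (\<tau> / 2) * 0 + - (c * (\<sigma>\<^sub>S\<^sup>2 / (2 * \<tau>))) + c * (1 - m / 2) * ?l
        = (1 - m / 2) * (c * (\<sigma>\<^sub>\<mu>\<^sup>2 / (2 * lam * (lam * \<tau> + 1)))) - m / 2 * (c * (\<sigma>\<^sub>S\<^sup>2 / (2 * \<tau>)))"
      unfolding l by (simp add: algebra_simps diff_divide_distrib)
    also have "\<dots> = m * ((\<beta>\<^sup>2 - 1) * (2 - m) * lam / (4 * (lam * \<tau> + 1)) - m / (4 * \<tau>))"
    proof -
      define q w where "q = (\<beta>\<^sup>2 - 1) * lam / (4 * (lam * \<tau> + 1))" and "w = m / (4 * \<tau>)"
      have half: "z / (2 * n) = 2 * (z / (4 * n))" for z n :: real by simp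
      have "(\<beta>\<^sup>2 - 1) * lam / (2 * (lam * \<tau> + 1)) = 2 * q" "m / (2 * \<tau>) = 2 * w"
        unfolding q_def w_def by (rule half)+
      moreover have "(\<beta>\<^sup>2 - 1) * (2 - m) * lam / (4 * (lam * \<tau> + 1)) = (2 - m) * q"
        by (simp add: q_def)
      ultimately show ?thesis
        unfolding 1 2 w_def[symmetric] by (simp only:) (simp add: algebra_simps)
    qed
    also have "\<dots> = m * ((\<tau> * (\<beta>\<^sup>2 - 1) * (2 - m) - m * ((lam * \<tau> + 1) / lam)) / (4 * \<tau> * ((lam * \<tau> + 1) / lam)))"
    proof -
      have "\<tau> * (\<beta>\<^sup>2 - 1) * (2 - m) / (4 * \<tau> * ((lam * \<tau> + 1) / lam)) = (\<beta>\<^sup>2 - 1) * (2 - m) * lam / (4 * (lam * \<tau> + 1))"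
        using \<open>\<tau> > 0\<close> by simp
      moreover have "m * ((lam * \<tau> + 1) / lam) / (4 * \<tau> * ((lam * \<tau> + 1) / lam)) = m / (4 * \<tau>)"
        by (rule mult_divide_mult_cancel_right) (use \<open>lam > 0\<close> s in simp)
      ultimately show ?thesis unfolding diff_divide_distrib by (simp only:)
    qed
    finally show ?thesis unfolding tl .
  qed
  with lim show ?thesis using E(1) by simp
qed

end
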